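(* Let $f=(f_1,\ldots,f_n)$ be an $n$-tuple of formal power series with the model property and let $T=(T_1,\ldots,T_n)\in\mathbb B_f(\mathcal H)$ and $T'=(T_1',\ldots,T_n')\in\mathbb B_f(\mathcal H')$ be two pure $n$-tuples of operators. Then $T$ and $T'$ are unitarily equivalent if and only if their characteristic functions $\Theta_{f,T}$ and $\Theta_{f,T'}$ coincide.
   Context: Notation. $\mathbb F_n^+$ is the free semigroup on $g_1,\ldots,g_n$ with identity $g_0$ and length $|\cdot|$. For an $n$-tuple $X$ of elements of a unital algebra, $X_\alpha=X_{i_1}\cdots X_{i_k}$ if $\alpha=g_{i_1}\cdots g_{i_k}$, $X_{g_0}=I$; $[f(X)]_\alpha$ is the corresponding product of $f_1(X),\ldots,f_n(X)$. A tuple $X\in B(\mathcal H)^n$ is viewed as a row operator $\mathcal H^{(n)}\to\mathcal H$, so $\|X\|=\|\sum X_iX_i^*\|^{1/2}$; $[B(\mathcal H)^n]_\gamma=\{X:\|X\|<\gamma\}$. A free holomorphic function on $[B(\mathcal H)^n]_\gamma$ is a formal power series $\sum a_\alpha Z_\alpha$ in noncommuting indeterminates (complex coefficients) with radius of convergence $r$, $r^{-1}=\limsup_k(\sum_{|\alpha|=k}|a_\alpha|^2)^{1/2k}$, at least $\gamma$, identified with the map $X\mapsto\sum_k\sum_{|\alpha|=k}a_\alpha X_\alpha$ (norm convergence; $\mathcal H$ separable infinite-dimensional). $H^2_{\bf ball}$ is the Hilbert space of series with $\sum|a_\alpha|^2<\infty$ (the $Z_\alpha$ being orthonormal). Convergence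 sets. For an $n$-tuple $f$ of formal power series $f_j=\sum c^{(j)}_\alpha Z_\alpha$ and a Hilbert space $\mathcal H$: $\mathcal C_f^{SOT}(\mathcal H)$ is the set of $X\in B(\mathcal H)^n$ such that each series $f_j(X):=\sum_k\sum_{|\alpha|=k}c^{(j)}_\alpha X_\alpha$ is SOT-convergent; $\mathcal C_f^{rad}(\mathcal H)$ is the set of $X$ such that for some $\delta\in(0,1)$ these series converge in norm at $rX$ for all $r\in(\delta,1)$ and $f_j(X):=\text{SOT-}\lim_{r\to1}f_j(rX)$ exists for each $j$. Model property. $f=(f_1,\ldots,f_n)$ has the model property if one of the following holds. (A) $f$ is an $n$-tuple of noncommutative polynomials for which there is an $n$-tuple $g$ of noncommutative polynomials with $f\circ g=g\circ f=\mathrm{id}$. Then $\{f_\alpha\}$ is a linear basis of $\mathbb C[Z_1,\ldots,Z_n]$ and $\mathbb H^2(f)$ is the completion of $\mathbb C[Z_1,\ldots,Z_n]$ for the inner product $\langle f_\alpha,f_\beta\rangle=\delta_{\alpha\beta}$. (S) $f$ is an $n$-tuple of formal power series with $f(0)=0$, nonzero radius of convergence and $\det J_f(0)\neq0$ ($J_f(0)_{ij}$ is the coefficient of $Z_j$ in $f_i$); $\mathbb H^2(f)$ is the Hilbert space of formal power series $\sum a_\alpha f_\alpha$, $\sum|a_\alpha|^2<\infty$, with $\{f_\alpha\}$ orthonormal; $Z_1,\ldots,Z_n\in\mathbb H^2(f)$; left multiplication $M_{Z_i}$ by $Z_i$ is bounded on $\mathbb H^2(f)$; and $M_Z=(M_{Z_1},\ldots,M_{Z_n})$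 belongs to $\mathcal C_f^{SOT}(\mathbb H^2(f))$ or $\mathcal C_f^{rad}(\mathbb H^2(f))$ with $f_j(M_Z)=M_{f_j}$ (left multiplication by $f_j$), $j=1,\ldots,n$. (F) $f$ is an $n$-tuple of free holomorphic functions on some $[B(\mathcal H)^n]_\gamma$, $\gamma>0$, with range in $[B(\mathcal H)^n]_1$, such that $G\circ f\not\equiv0$ for every nonzero free holomorphic $G$ on $[B(\mathcal H)^n]_1$; $\mathbb H^2(f)=\{G\circ f:G\in H^2_{\bf ball}\}$ with $\langle F\circ f,G\circ f\rangle=\langle F,G\rangle$; the coordinate functions $Z_1,\ldots,Z_n$ lie in $\mathbb H^2(f)$, left multiplications $M_{Z_i}$ by them are bounded on $\mathbb H^2(f)$, and $M_Z$ is in $\mathcal C_f^{SOT}(\mathbb H^2(f))$ or $\mathcal C_f^{rad}(\mathbb H^2(f))$ with $f_j(M_Z)=M_{f_j}$ for all $j$. In all cases $\{f_\alpha\}_{\alpha\in\mathbb F_n^+}$ is an orthonormal basis of $\mathbb H^2(f)$, and $M_Z$ is called the universal model. Writing $Z_i=\sum_\alpha a^{(i)}_\alpha f_\alpha$ in $\mathbb H^2(f)$, one has $M_{Z_i}f_\beta=\sum_\alpha a^{(i)}_\alpha f_{\alpha\beta}$, and $g_i:=\sum_\alpha a^{(i)}_\alpha Z_\alpha$ defines the inverse $g=(g_1,\ldots,g_n)$ of $f$ with respect to composition. Domain. $X\in B(\mathcal H)^n$ satisfies $g(f(X))=X$ if $X\in\mathcal C_f^{SOT}(\mathcal H)\cup\mathcal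 C_f^{rad}(\mathcal H)$ and either (for all $i$) $X_i=\sum_k\sum_{|\alpha|=k}a^{(i)}_\alpha[f(X)]_\alpha$ in the SOT, or (for all $i$) $X_i=\text{SOT-}\lim_{r\to1}\sum_k\sum_{|\alpha|=k}a^{(i)}_\alpha r^{|\alpha|}[f(X)]_\alpha$ (automatic in case (A)). Then $\mathbb B_f(\mathcal H):=\{X\in B(\mathcal H)^n:\ g(f(X))=X,\ \|f(X)\|\le1\}$. $T\in\mathbb B_f(\mathcal H)$ is pure if $\text{SOT-}\lim_{k\to\infty}\sum_{|\alpha|=k}[f(T)]_\alpha[f(T)]_\alpha^*=0$. Characteristic function. For $T\in\mathbb B_f(\mathcal H)$ let $f(T)=[f_1(T),\ldots,f_n(T)]:\mathcal H^{(n)}\to\mathcal H$, $\Delta_{f,T}:=(I_{\mathcal H}-\sum_if_i(T)f_i(T)^* )^{1/2}\in B(\mathcal H)$, $\Delta_{f,T^*}:=(I-f(T)^*f(T))^{1/2}\in B(\mathcal H^{(n)})$, $\mathcal D_{f,T}:=\overline{\Delta_{f,T}\mathcal H}$, $\mathcal D_{f,T^*}:=\overline{\Delta_{f,T^*}\mathcal H^{(n)}}$, and let $\Lambda_i$ be right multiplication by $f_i$ on $\mathbb H^2(f)$, $\Lambda_if_\alpha=f_{\alpha g_i}$. The characteristic function $\Theta_{f,T}:\mathbb H^2(f)\otimes\mathcal D_{f,T^*}\to\mathbb H^2(f)\otimes\mathcal D_{f,T}$ is the multi-analytic operator with formal Fourier representation $$-I\otimes f(T)+(I\otimes\Delta_{f,T})\Big(I-\sum_{i=1}^n\Lambda_i\otimes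 f_i(T)^*\Big)^{-1}[\Lambda_1\otimes I_{\mathcal H},\ldots,\Lambda_n\otimes I_{\mathcal H}](I\otimes\Delta_{f,T^*}),$$ i.e. it is the SOT-limit as $r\to1$ of the operators obtained by replacing each $\Lambda_i$ by $r\Lambda_i$. A bounded operator $\Phi:\mathbb H^2(f)\otimes\mathcal K_1\to\mathbb H^2(f)\otimes\mathcal K_2$ is multi-analytic if $\Phi(M_{Z_i}\otimes I_{\mathcal K_1})=(M_{Z_i}\otimes I_{\mathcal K_2})\Phi$ for all $i$. Two multi-analytic operators $\Phi:\mathbb H^2(f)\otimes\mathcal K_1\to\mathbb H^2(f)\otimes\mathcal K_2$ and $\Phi':\mathbb H^2(f)\otimes\mathcal K_1'\to\mathbb H^2(f)\otimes\mathcal K_2'$ coincide if there are unitary multi-analytic operators $W_j:\mathbb H^2(f)\otimes\mathcal K_j\to\mathbb H^2(f)\otimes\mathcal K_j'$, $j=1,2$, with $\Phi'W_1=W_2\Phi$. Tuples $(T_i)$, $(T'_i)$ are unitarily equivalent if there is a unitary $U:\mathcal H\to\mathcal H'$ with $T_i=U^*T_i'U$ for all $i$. *)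

theory Defs
  imports "HOL-Analysis.Analysis"
begin

section \<open>Complex Hilbert spaces\<close>

text \<open>The inner product \<^term>\<open>cinner\<close> is linear in its first argument; its real part is
  the real inner product of the library, so norm and topology are those of the library.\<close>

class chilbert_space = real_inner + complete_space +
  fixes scaleC :: "complex \<Rightarrow> 'a \<Rightarrow> 'a" (infixr "*\<^sub>C" 75)
    and cinner :: "'a \<Rightarrow> 'a \<Rightarrow> complex"
  assumes scaleC_add_right: "c *\<^sub>C (x + y) = c *\<^sub>C x + c *\<^sub>C y"
    and scaleC_add_left: "(c + d) *\<^sub>C x = c *\<^sub>C x + d *\<^sub>C x"
    and scaleC_scaleC: "c *\<^sub>C (d *\<^sub>C x) = (c * d) *\<^sub>C x"
    and scaleR_scaleC: "r *\<^sub>R x = complex_of_real r *\<^sub>C x"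
    and cinner_commute: "cinner x y = cnj (cinner y x)"
    and cinner_add_left: "cinner (x + y) z = cinner x z + cinner y z"
    and cinner_scaleC_left: "cinner (c *\<^sub>C x) y = c * cinner x y"
    and inner_eq_Re_cinner: "inner x y = Re (cinner x y)"
begin

subclass banach ..

end

lemma cinner_scaleC_right:
  "cinner x (c *\<^sub>C y) = cnj c * cinner x (y::'a::chilbert_space)"
  by (metis cinner_commute cinner_scaleC_left complex_cnj_mult)

lemma cinner_self: "cinner x x = complex_of_real ((norm (x::'a::chilbert_space))\<^sup>2)"
proof -
  have "Im (cinner x x) = 0"
    by (metis cinner_commute cnj.simps(2) equal_neg_zero)
  moreover have "Re (cinner x x) = (norm x)\<^sup>2"
    by (metis inner_eq_Re_cinner power2_norm_eq_inner)
  ultimately show ?thesis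
    by (simp add: complex_eq_iff)
qed

lemma norm_scaleC [simp]: "norm (c *\<^sub>C x) = cmod c * norm (x::'a::chilbert_space)"
proof -
  have "complex_of_real ((norm (c *\<^sub>C x))\<^sup>2) = (c * cnj c) * cinner x x"
    by (simp only: cinner_self[symmetric] cinner_scaleC_left cinner_scaleC_right mult_ac)
  also have "\<dots> = complex_of_real ((cmod c * norm x)\<^sup>2)"
    by (simp add: cinner_self power_mult_distrib flip: complex_norm_square)
  finally have "(norm (c *\<^sub>C x))\<^sup>2 = (cmod c * norm x)\<^sup>2"
    using of_real_eq_iff by blast
  then show ?thesis
    by (simp add: power2_eq_iff_nonneg)
qed

lemma cinner_bound: "cmod (cinner x y) \<le> norm x * norm (y::'a::chilbert_space)"
proof (cases "cinner x y = 0")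
  case False
  define u where "u = cnj (sgn (cinner x y))"
  have u: "cmod u = 1"
    using False by (simp add: u_def norm_sgn)
  have "u * cinner x y = complex_of_real (cmod (cinner x y))"
    by (simp add: u_def sgn_eq complex_norm_square[symmetric] power2_eq_square mult.commute
        divide_simps)
  then have "cmod (cinner x y) = inner (u *\<^sub>C x) y"
    by (simp add: inner_eq_Re_cinner cinner_scaleC_left)
  also have "\<dots> \<le> norm (u *\<^sub>C x) * norm y"
    by (rule norm_cauchy_schwarz)
  finally show ?thesis
    by (simp add: u)
qed simp

instantiation complex :: chilbert_space
begin

definition scaleC_complex :: "complex \<Rightarrow> complex \<Rightarrow> complex"
  where "scaleC_complex c x = c * x"

definition cinner_complex :: "complex \<Rightarrow> complex \<Rightarrow> complex"
  where "cinner_complex x y = x * cnj y"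

instance
  by standard
    (auto simp: scaleC_complex_def cinner_complex_def algebra_simps inner_complex_def
      scaleR_conv_of_real)

end

text \<open>The direct sum of finitely many copies of a Hilbert space, indexed by a finite type.\<close>

instantiation vec :: (chilbert_space, finite) chilbert_space
begin

definition scaleC_vec :: "complex \<Rightarrow> ('a, 'b) vec \<Rightarrow> ('a, 'b) vec"
  where "scaleC_vec c x = (\<chi> i. c *\<^sub>C (x $ i))"

definition cinner_vec :: "('a, 'b) vec \<Rightarrow> ('a, 'b) vec \<Rightarrow> complex"
  where "cinner_vec x y = (\<Sum>i\<in>UNIV. cinner (x $ i) (y $ i))"

instance
proof
  fix x y z :: "('a, 'b) vec" and c d :: complex and r :: real
  show "c *\<^sub>C (x + y) = c *\<^sub>C x + c *\<^sub>C y"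
    by (simp add: vec_eq_iff scaleC_vec_def scaleC_add_right)
  show "(c + d) *\<^sub>C x = c *\<^sub>C x + d *\<^sub>C x"
    by (simp add: vec_eq_iff scaleC_vec_def scaleC_add_left)
  show "c *\<^sub>C d *\<^sub>C x = (c * d) *\<^sub>C x"
    by (simp add: vec_eq_iff scaleC_vec_def scaleC_scaleC)
  show "r *\<^sub>R x = complex_of_real r *\<^sub>C x"
    by (simp add: vec_eq_iff scaleC_vec_def scaleR_scaleC)
  show "cinner x y = cnj (cinner y x)"
    unfolding cinner_vec_def cnj_sum by (intro sum.cong refl cinner_commute)
  show "cinner (x + y) z = cinner x z + cinner y z"
    by (simp add: cinner_vec_def cinner_add_left sum.distrib)
  show "cinner (c *\<^sub>C x) y = c * cinner x y"
    by (simp add: cinner_vec_def scaleC_vec_def cinner_scaleC_left sum_distrib_left)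
  show "inner x y = Re (cinner x y)"
    by (simp add: cinner_vec_def inner_vec_def inner_eq_Re_cinner)
qed

end


section \<open>The Hilbert space of square-summable families\<close>

definition sq_summable :: "('i \<Rightarrow> 'a::real_normed_vector) \<Rightarrow> bool"
  where "sq_summable x \<longleftrightarrow> (\<lambda>i. (norm (x i))\<^sup>2) summable_on UNIV"

lemma sq_summable_zero [simp]: "sq_summable (\<lambda>i. 0)"
  by (simp add: sq_summable_def)

lemma sq_summable_bound:
  assumes "sq_summable x" and "\<And>i. norm (y i) \<le> C * norm (x i)"
  shows "sq_summable y"
  unfolding sq_summable_def
proof (rule summable_on_comparison_test)
  show "(\<lambda>i. C\<^sup>2 * (norm (x i))\<^sup>2) summable_on UNIV"
    using assms(1) unfolding sq_summable_def by (rule summable_on_cmult_right)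
  show "(norm (y i))\<^sup>2 \<le> C\<^sup>2 * (norm (x i))\<^sup>2" for i
    using power_mono[OF assms(2)[of i], of 2] by (simp add: power_mult_distrib)
qed simp

lemma norm_add_sq_le: "(norm (x + y))\<^sup>2 \<le> 2 * (norm x)\<^sup>2 + 2 * (norm (y::'a::real_normed_vector))\<^sup>2"
proof -
  have "(norm (x + y))\<^sup>2 \<le> (norm x + norm y)\<^sup>2"
    by (simp add: norm_triangle_ineq power_mono)
  also have "\<dots> \<le> 2 * (norm x)\<^sup>2 + 2 * (norm y)\<^sup>2"
    using sum_squares_bound[of "norm x" "norm y"] by (simp add: power2_sum)
  finally show ?thesis .
qed

lemma sq_summable_add:
  assumes "sq_summable x" and "sq_summable y"
  shows "sq_summable (\<lambda>i. x i + y i)"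
  unfolding sq_summable_def
proof (rule summable_on_comparison_test)
  show "(\<lambda>i. 2 * (norm (x i))\<^sup>2 + 2 * (norm (y i))\<^sup>2) summable_on UNIV"
    using assms unfolding sq_summable_def by (intro summable_on_add summable_on_cmult_right)
qed (simp_all add: norm_add_sq_le)

lemma sq_summable_uminus: "sq_summable x \<Longrightarrow> sq_summable (\<lambda>i. - x i)"
  by (simp add: sq_summable_def)

lemma sq_summable_diff:
  assumes "sq_summable x" and "sq_summable y"
  shows "sq_summable (\<lambda>i. x i - y i)"
  using sq_summable_add[OF assms(1) sq_summable_uminus[OF assms(2)]] by simp

lemma sq_summable_cinner:
  fixes x y :: "'i \<Rightarrow> 'a::chilbert_space"
  assumes "sq_summable x" and "sq_summable y"
  shows "(\<lambda>i. cinner (x i) (y i)) summable_on UNIV"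
proof -
  have "(\<lambda>i. norm (cinner (x i) (y i))) summable_on UNIV"
  proof (rule Infinite_Sum.abs_summable_on_comparison_test')
    show "(\<lambda>i. (norm (x i))\<^sup>2 + (norm (y i))\<^sup>2) summable_on UNIV"
      using assms unfolding sq_summable_def by (rule summable_on_add)
    show "norm (cinner (x i) (y i)) \<le> (norm (x i))\<^sup>2 + (norm (y i))\<^sup>2" for i
    proof -
      have "norm (cinner (x i) (y i)) \<le> norm (x i) * norm (y i)"
        by (rule cinner_bound)
      also have "\<dots> \<le> (norm (x i))\<^sup>2 + (norm (y i))\<^sup>2"
        using sum_squares_bound[of "norm (x i)" "norm (y i)"]
          mult_nonneg_nonneg[OF norm_ge_zero norm_ge_zero, of "x i" "y i"]
        by linarith
      finally show ?thesis .
    qed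
  qed
  then show ?thesis
    by (rule abs_summable_summable)
qed

typedef (overloaded) ('i, 'a) l2 = "{x :: 'i \<Rightarrow> 'a::chilbert_space. sq_summable x}"
  morphisms coord Abs_l2
  by (rule exI[of _ "\<lambda>i. 0"]) simp

setup_lifting type_definition_l2

lemma sq_summable_coord [simp]: "sq_summable (coord x)"
  using coord[of x] by simp

lemma l2_eqI: "(\<And>i. coord x i = coord y i) \<Longrightarrow> x = y"
  using coord_inject by blast

instantiation l2 :: (type, chilbert_space) real_inner
begin

lift_definition zero_l2 :: "('a, 'b) l2" is "\<lambda>i. 0"
  by simp

lift_definition plus_l2 :: "('a, 'b) l2 \<Rightarrow> ('a, 'b) l2 \<Rightarrow> ('a, 'b) l2" is "\<lambda>x y i. x i + y i"
  by (rule sq_summable_add)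

lift_definition minus_l2 :: "('a, 'b) l2 \<Rightarrow> ('a, 'b) l2 \<Rightarrow> ('a, 'b) l2" is "\<lambda>x y i. x i - y i"
  by (rule sq_summable_diff)

lift_definition uminus_l2 :: "('a, 'b) l2 \<Rightarrow> ('a, 'b) l2" is "\<lambda>x i. - x i"
  by (rule sq_summable_uminus)

lift_definition scaleR_l2 :: "real \<Rightarrow> ('a, 'b) l2 \<Rightarrow> ('a, 'b) l2" is "\<lambda>r x i. r *\<^sub>R x i"
proof -
  fix r :: real and x :: "'a \<Rightarrow> 'b"
  assume "sq_summable x"
  then show "sq_summable (\<lambda>i. r *\<^sub>R x i)"
    by (rule sq_summable_bound[where C = "\<bar>r\<bar>"]) simp
qed

definition inner_l2 :: "('a, 'b) l2 \<Rightarrow> ('a, 'b) l2 \<Rightarrow> real"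
  where "inner_l2 x y = (\<Sum>\<^sub>\<infinity>i. inner (coord x i) (coord y i))"

definition norm_l2 :: "('a, 'b) l2 \<Rightarrow> real"
  where "norm_l2 x = sqrt (inner x x)"

definition sgn_l2 :: "('a, 'b) l2 \<Rightarrow> ('a, 'b) l2"
  where "sgn_l2 x = scaleR (inverse (norm x)) x"

definition dist_l2 :: "('a, 'b) l2 \<Rightarrow> ('a, 'b) l2 \<Rightarrow> real"
  where "dist_l2 x y = norm (x - y)"

definition uniformity_l2 :: "(('a, 'b) l2 \<times> ('a, 'b) l2) filter"
  where "uniformity_l2 = (INF e\<in>{0<..}. principal {(x, y). dist x y < e})"

definition open_l2 :: "('a, 'b) l2 set \<Rightarrow> bool"
  where "open_l2 U \<longleftrightarrow> (\<forall>x\<in>U. eventually (\<lambda>(x', y). x' = x \<longrightarrow> y \<in> U) uniformity)"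

lemma coord_add [simp]: "coord (x + y) i = coord x i + coord y i"
  by (simp add: plus_l2.rep_eq)

lemma coord_diff [simp]: "coord (x - y) i = coord x i - coord y i"
  by (simp add: minus_l2.rep_eq)

lemma coord_uminus [simp]: "coord (- x) i = - coord x i"
  by (simp add: uminus_l2.rep_eq)

lemma coord_zero [simp]: "coord 0 i = 0"
  by (simp add: zero_l2.rep_eq)

lemma coord_scaleR [simp]: "coord (r *\<^sub>R x) i = r *\<^sub>R coord x i"
  by (simp add: scaleR_l2.rep_eq)

lemma summable_inner_coord: "(\<lambda>i. inner (coord x i) (coord y i)) summable_on UNIV"
  unfolding inner_eq_Re_cinner by (intro summable_on_Re sq_summable_cinner) simp_all

instance
proof
  fix x y z :: "('a, 'b) l2" and r s :: real
  show "x + y + z = x + (y + z)" "x + y = y + x" "0 + x = x" "- x + x = 0" "x - y = x + - y"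
    "r *\<^sub>R (x + y) = r *\<^sub>R x + r *\<^sub>R y" "(r + s) *\<^sub>R x = r *\<^sub>R x + s *\<^sub>R x"
    "r *\<^sub>R s *\<^sub>R x = (r * s) *\<^sub>R x" "1 *\<^sub>R x = x"
    by (auto intro!: l2_eqI simp: algebra_simps)
  show "sgn x = scaleR (inverse (norm x)) x" "dist x y = norm (x - y)"
    by (simp_all add: sgn_l2_def dist_l2_def)
  show "uniformity = (INF e\<in>{0<..}. principal {(x, y::('a, 'b) l2). dist x y < e})"
    by (rule uniformity_l2_def)
  show "open U \<longleftrightarrow> (\<forall>x\<in>U. eventually (\<lambda>(x', y). x' = x \<longrightarrow> y \<in> U) uniformity)"
    for U :: "('a, 'b) l2 set"
    by (rule open_l2_def)
  show "inner x y = inner y x"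
    by (simp add: inner_l2_def inner_commute)
  show "inner (x + y) z = inner x z + inner y z"
    by (simp add: inner_l2_def inner_add_left infsum_add summable_inner_coord)
  show "inner (r *\<^sub>R x) y = r * inner x y"
    by (simp add: inner_l2_def infsum_cmult_right')
  show "0 \<le> inner x x"
    by (simp add: inner_l2_def infsum_nonneg)
  show "inner x x = 0 \<longleftrightarrow> x = 0"
  proof
    assume "inner x x = 0"
    then have "inner (coord x i) (coord x i) = 0" for i
      unfolding inner_l2_def
      by (intro nonneg_infsum_le_0D[OF _ summable_inner_coord]) auto
    then show "x = 0"
      by (intro l2_eqI) simp
  qed (simp add: inner_l2_def)
  show "norm x = sqrt (inner x x)"
    by (rule norm_l2_def)
qed

end

lemma norm_l2_sq: "(norm x)\<^sup>2 = (\<Sum>\<^sub>\<infinity>i. (norm (coord x i))\<^sup>2)"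
  by (simp add: power2_norm_eq_inner inner_l2_def)

lemma sum_coord_le: "finite F \<Longrightarrow> (\<Sum>i\<in>F. (norm (coord x i))\<^sup>2) \<le> (norm x)\<^sup>2"
  unfolding norm_l2_sq using sq_summable_coord[of x]
  by (intro finite_sum_le_infsum) (auto simp: sq_summable_def)

lemma norm_coord_le: "norm (coord x i) \<le> norm x"
  using sum_coord_le[of "{i}" x] by (simp add: power2_le_iff_abs_le)

instance l2 :: (type, chilbert_space) complete_space
proof
  fix X :: "nat \<Rightarrow> ('a, 'b) l2"
  assume X: "Cauchy X"
  have "Cauchy (\<lambda>n. coord (X n) i)" for i
  proof (rule metric_CauchyI)
    fix e :: real assume "e > 0"
    then obtain N where "\<forall>m\<ge>N. \<forall>n\<ge>N. dist (X m) (X n) < e"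
      using metric_CauchyD[OF X] by blast
    moreover have "dist (coord (X m) i) (coord (X n) i) \<le> dist (X m) (X n)" for m n
      using norm_coord_le[of "X m - X n" i] by (simp add: dist_norm)
    ultimately show "\<exists>N. \<forall>m\<ge>N. \<forall>n\<ge>N. dist (coord (X m) i) (coord (X n) i) < e"
      by (meson le_less_trans)
  qed
  then have "\<forall>i. \<exists>l. (\<lambda>n. coord (X n) i) \<longlonglongrightarrow> l"
    by (simp add: Cauchy_convergent_iff convergent_def)
  then obtain L where L: "(\<lambda>n. coord (X n) i) \<longlonglongrightarrow> L i" for i
    by metis
  have fin: "(\<Sum>i\<in>F. (norm (coord (X n) i - L i))\<^sup>2) \<le> e\<^sup>2"
    if "e > 0" "finite F" "\<forall>m\<ge>N. \<forall>n\<ge>N. dist (X m) (X n) < e" "n \<ge> N" for e F N n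
  proof (rule tendsto_upperbound)
    show "(\<lambda>m. \<Sum>i\<in>F. (norm (coord (X n) i - coord (X m) i))\<^sup>2) \<longlonglongrightarrow>
        (\<Sum>i\<in>F. (norm (coord (X n) i - L i))\<^sup>2)"
      by (intro tendsto_intros L)
    show "\<forall>\<^sub>F m in sequentially. (\<Sum>i\<in>F. (norm (coord (X n) i - coord (X m) i))\<^sup>2) \<le> e\<^sup>2"
      unfolding eventually_sequentially
    proof (intro exI[of _ N] allI impI)
      fix m assume "m \<ge> N"
      then have "norm (X n - X m) < e"
        using that by (simp add: dist_norm)
      then have "(norm (X n - X m))\<^sup>2 \<le> e\<^sup>2"
        by (simp add: power_mono)
      then show "(\<Sum>i\<in>F. (norm (coord (X n) i - coord (X m) i))\<^sup>2) \<le> e\<^sup>2"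
        using sum_coord_le[OF \<open>finite F\<close>, of "X n - X m"] by simp
    qed
  qed simp
  have sq: "sq_summable (\<lambda>i. coord (X n) i - L i)"
    if "e > 0" "\<forall>m\<ge>N. \<forall>n\<ge>N. dist (X m) (X n) < e" "n \<ge> N" for e N n
    unfolding sq_summable_def
    by (rule nonneg_bdd_above_summable_on)
      (use fin[OF that(1) _ that(2,3)] in \<open>auto intro!: bdd_aboveI\<close>)
  obtain N1 where "\<forall>m\<ge>N1. \<forall>n\<ge>N1. dist (X m) (X n) < 1"
    using metric_CauchyD[OF X, of 1] by auto
  then have "sq_summable (\<lambda>i. coord (X N1) i - L i)"
    using sq[of 1 N1 N1] by simp
  from sq_summable_diff[OF sq_summable_coord[of "X N1"] this] have "sq_summable L"
    by simp
  then have coordL: "coord (Abs_l2 L) = L"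
    by (simp add: Abs_l2_inverse)
  have "X \<longlonglongrightarrow> Abs_l2 L"
  proof (rule metric_LIMSEQ_I)
    fix e :: real assume "e > 0"
    then obtain N where N: "\<forall>m\<ge>N. \<forall>n\<ge>N. dist (X m) (X n) < e / 2"
      using metric_CauchyD[OF X, of "e / 2"] by auto
    have "dist (X n) (Abs_l2 L) < e" if "n \<ge> N" for n
    proof -
      have "(norm (X n - Abs_l2 L))\<^sup>2 \<le> (e / 2)\<^sup>2"
        unfolding norm_l2_sq coord_diff coordL
      proof (rule infsum_le_finite_sums)
        show "(\<lambda>i. (norm (coord (X n) i - L i))\<^sup>2) summable_on UNIV"
          using sq[OF _ N that] \<open>e > 0\<close> by (simp add: sq_summable_def)
      qed (use fin[OF _ _ N that] \<open>e > 0\<close> in simp)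
      then have "norm (X n - Abs_l2 L) \<le> e / 2"
        using \<open>e > 0\<close> by (simp add: power2_le_iff_abs_le)
      then show ?thesis
        using \<open>e > 0\<close> by (simp add: dist_norm)
    qed
    then show "\<exists>N. \<forall>n\<ge>N. dist (X n) (Abs_l2 L) < e"
      by blast
  qed
  then show "convergent X"
    by (auto simp: convergent_def)
qed

instantiation l2 :: (type, chilbert_space) chilbert_space
begin

lift_definition scaleC_l2 :: "complex \<Rightarrow> ('a, 'b) l2 \<Rightarrow> ('a, 'b) l2" is "\<lambda>c x i. c *\<^sub>C x i"
proof -
  fix c :: complex and x :: "'a \<Rightarrow> 'b"
  assume "sq_summable x"
  then show "sq_summable (\<lambda>i. c *\<^sub>C x i)"
    by (rule sq_summable_bound[where C = "cmod c"]) simp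
qed

definition cinner_l2 :: "('a, 'b) l2 \<Rightarrow> ('a, 'b) l2 \<Rightarrow> complex"
  where "cinner_l2 x y = (\<Sum>\<^sub>\<infinity>i. cinner (coord x i) (coord y i))"

lemma coord_scaleC [simp]: "coord (c *\<^sub>C x) i = c *\<^sub>C coord x i"
  by (simp add: scaleC_l2.rep_eq)

instance
proof
  fix x y z :: "('a, 'b) l2" and c d :: complex and r :: real
  show "c *\<^sub>C (x + y) = c *\<^sub>C x + c *\<^sub>C y" "(c + d) *\<^sub>C x = c *\<^sub>C x + d *\<^sub>C x"
    "c *\<^sub>C d *\<^sub>C x = (c * d) *\<^sub>C x" "r *\<^sub>R x = complex_of_real r *\<^sub>C x"
    by (auto intro!: l2_eqI
        simp: scaleC_add_right scaleC_add_left scaleC_scaleC scaleR_scaleC)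
  show "cinner x y = cnj (cinner y x)"
    unfolding cinner_l2_def infsum_cnj[symmetric] by (intro infsum_cong cinner_commute)
  show "cinner (x + y) z = cinner x z + cinner y z"
    by (simp add: cinner_l2_def cinner_add_left infsum_add sq_summable_cinner)
  show "cinner (c *\<^sub>C x) y = c * cinner x y"
    by (simp add: cinner_l2_def cinner_scaleC_left infsum_cmult_right')
  show "inner x y = Re (cinner x y)"
    by (simp add: cinner_l2_def inner_l2_def inner_eq_Re_cinner infsum_Re sq_summable_cinner)
qed

end

text \<open>For a Hilbert space \<open>K\<close>, the tensor product of \<open>l2(I)\<close> with \<open>K\<close> is \<open>l2(I; K)\<close>, with
  the following elementary tensors.\<close>

lift_definition tensor :: "('i, complex) l2 \<Rightarrow> 'k::chilbert_space \<Rightarrow> ('i, 'k) l2"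
  is "\<lambda>x k i. x i *\<^sub>C k"
proof -
  fix x :: "'i \<Rightarrow> complex" and k :: 'k
  assume "sq_summable x"
  then show "sq_summable (\<lambda>i. x i *\<^sub>C k)"
    by (rule sq_summable_bound[where C = "norm k"]) simp
qed


section \<open>Bounded operators\<close>

definition bounded_clinear :: "('a::chilbert_space \<Rightarrow> 'b::chilbert_space) \<Rightarrow> bool"
  where "bounded_clinear A \<longleftrightarrow> bounded_linear A \<and> (\<forall>c x. A (c *\<^sub>C x) = c *\<^sub>C A x)"

definition cadjoint :: "('a::chilbert_space \<Rightarrow> 'b::chilbert_space) \<Rightarrow> 'b \<Rightarrow> 'a"
  where "cadjoint A =
    (THE B. bounded_clinear B \<and> (\<forall>x y. cinner (A x) y = cinner x (B y)))"

definition positive_op :: "('a::chilbert_space \<Rightarrow> 'a) \<Rightarrow> bool"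
  where "positive_op A \<longleftrightarrow> bounded_clinear A \<and> (\<forall>x. cinner (A x) x \<in> \<real>\<^sub>\<ge>\<^sub>0)"

definition op_sqrt :: "('a::chilbert_space \<Rightarrow> 'a) \<Rightarrow> 'a \<Rightarrow> 'a"
  where "op_sqrt A = (THE B. positive_op B \<and> B \<circ> B = A)"

definition tensor_op ::
  "(('i, complex) l2 \<Rightarrow> ('j, complex) l2) \<Rightarrow> ('k::chilbert_space \<Rightarrow> 'l::chilbert_space)
    \<Rightarrow> ('i, 'k) l2 \<Rightarrow> ('j, 'l) l2"
  where "tensor_op A C =
    (THE B. bounded_clinear B \<and> (\<forall>x k. B (tensor x k) = tensor (A x) (C k)))"

text \<open>An \<open>n\<close>-tuple of operators on \<open>H\<close> is a function \<open>X :: 'n \<Rightarrow> 'h \<Rightarrow> 'h\<close> on a finite type \<open>'n\<close>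
  with \<open>n\<close> elements; words in the free semigroup on \<open>n\<close> generators are lists over \<open>'n\<close>.\<close>

definition row_op :: "('n::finite \<Rightarrow> 'h \<Rightarrow> 'h::chilbert_space) \<Rightarrow> 'h ^ 'n \<Rightarrow> 'h"
  where "row_op X v = (\<Sum>i\<in>UNIV. X i (v $ i))"

primrec word_op :: "('n \<Rightarrow> 'h \<Rightarrow> 'h) \<Rightarrow> 'n list \<Rightarrow> 'h \<Rightarrow> 'h"
  where
    "word_op X [] = id"
  | "word_op X (i # w) = X i \<circ> word_op X w"

definition op_tuples :: "('n::finite \<Rightarrow> 'h \<Rightarrow> 'h::chilbert_space) set"
  where "op_tuples = {X. \<forall>i. bounded_clinear (X i)}"

definition op_ball :: "real \<Rightarrow> ('n::finite \<Rightarrow> 'h \<Rightarrow> 'h::chilbert_space) set"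
  where "op_ball \<gamma> = {X \<in> op_tuples. onorm (row_op X) < \<gamma>}"

definition norm_tendsto ::
  "('b \<Rightarrow> 'h::chilbert_space \<Rightarrow> 'k::chilbert_space) \<Rightarrow> ('h \<Rightarrow> 'k) \<Rightarrow> 'b filter \<Rightarrow> bool"
  where "norm_tendsto A L F \<longleftrightarrow>
    bounded_clinear L \<and> ((\<lambda>t. onorm (\<lambda>h. A t h - L h)) \<longlongrightarrow> 0) F"

definition sot_tendsto ::
  "('b \<Rightarrow> 'h::chilbert_space \<Rightarrow> 'k::chilbert_space) \<Rightarrow> ('h \<Rightarrow> 'k) \<Rightarrow> 'b filter \<Rightarrow> bool"
  where "sot_tendsto A L F \<longleftrightarrow> bounded_clinear L \<and> (\<forall>h. ((\<lambda>t. A t h) \<longlongrightarrow> L h) F)"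


section \<open>Formal power series in noncommuting indeterminates\<close>

type_synonym 'n ncps = "'n list \<Rightarrow> complex"

definition nc_one :: "'n ncps"
  where "nc_one w = (if w = [] then 1 else 0)"

definition nc_var :: "'n \<Rightarrow> 'n ncps"
  where "nc_var i w = (if w = [i] then 1 else 0)"

definition nc_mult :: "'n ncps \<Rightarrow> 'n ncps \<Rightarrow> 'n ncps"
  where "nc_mult p q w = (\<Sum>k\<le>length w. p (take k w) * q (drop k w))"

primrec nc_word :: "('n \<Rightarrow> 'n ncps) \<Rightarrow> 'n list \<Rightarrow> 'n ncps"
  where
    "nc_word f [] = nc_one"
  | "nc_word f (i # w) = nc_mult (f i) (nc_word f w)"

definition nc_polynomial :: "'n ncps \<Rightarrow> bool"
  where "nc_polynomial p \<longleftrightarrow> finite {w. p w \<noteq> 0}"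

text \<open>Substitution of \<open>f\<close> into a polynomial \<open>p\<close>.\<close>

definition poly_comp :: "'n ncps \<Rightarrow> ('n \<Rightarrow> 'n ncps) \<Rightarrow> 'n ncps"
  where "poly_comp p f w = (\<Sum>\<alpha> | p \<alpha> \<noteq> 0. p \<alpha> * nc_word f \<alpha> w)"

definition nc_radius :: "'n::finite ncps \<Rightarrow> ereal"
  where "nc_radius c = conv_radius (\<lambda>k. sqrt (\<Sum>\<alpha> | length \<alpha> = k. (cmod (c \<alpha>))\<^sup>2))"

definition partial_eval ::
  "'n::finite ncps \<Rightarrow> ('n \<Rightarrow> 'h \<Rightarrow> 'h) \<Rightarrow> nat \<Rightarrow> 'h \<Rightarrow> 'h::chilbert_space"
  where "partial_eval c X N h = (\<Sum>k<N. \<Sum>\<alpha> | length \<alpha> = k. c \<alpha> *\<^sub>C word_op X \<alpha> h)"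

text \<open>The relations \<open>c(X) = Y\<close>, with \<open>c(X)\<close> defined by norm convergence, by convergence in the
  strong operator topology, or as a radial limit.\<close>

definition norm_eval ::
  "'n::finite ncps \<Rightarrow> ('n \<Rightarrow> 'h \<Rightarrow> 'h) \<Rightarrow> ('h \<Rightarrow> 'h::chilbert_space) \<Rightarrow> bool"
  where "norm_eval c X Y \<longleftrightarrow> norm_tendsto (partial_eval c X) Y sequentially"

definition sot_eval ::
  "'n::finite ncps \<Rightarrow> ('n \<Rightarrow> 'h \<Rightarrow> 'h) \<Rightarrow> ('h \<Rightarrow> 'h::chilbert_space) \<Rightarrow> bool"
  where "sot_eval c X Y \<longleftrightarrow> sot_tendsto (partial_eval c X) Y sequentially"

definition rad_eval ::
  "'n::finite ncps \<Rightarrow> ('n \<Rightarrow> 'h \<Rightarrow> 'h) \<Rightarrow> ('h \<Rightarrow> 'h::chilbert_space) \<Rightarrow> bool"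
  where "rad_eval c X Y \<longleftrightarrow>
    (\<exists>\<delta>\<in>{0<..<1}. \<exists>P. (\<forall>r\<in>{\<delta><..<1}. norm_eval c (\<lambda>i h. r *\<^sub>R X i h) (P r)) \<and>
      sot_tendsto P Y (at_left 1))"

definition conv_sot :: "('n::finite \<Rightarrow> 'n ncps) \<Rightarrow> ('n \<Rightarrow> 'h \<Rightarrow> 'h::chilbert_space) set"
  where "conv_sot f = {X \<in> op_tuples. \<forall>j. \<exists>Y. sot_eval (f j) X Y}"

definition conv_rad :: "('n::finite \<Rightarrow> 'n ncps) \<Rightarrow> ('n \<Rightarrow> 'h \<Rightarrow> 'h::chilbert_space) set"
  where "conv_rad f = {X \<in> op_tuples. \<forall>j. \<exists>Y. rad_eval (f j) X Y}"

text \<open>The tuple \<open>f(X)\<close> for \<open>X\<close> in one of the two convergence sets. On their intersection both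
  prescriptions agree, by Abel's theorem.\<close>

definition tuple_eval ::
  "('n::finite \<Rightarrow> 'n ncps) \<Rightarrow> ('n \<Rightarrow> 'h \<Rightarrow> 'h) \<Rightarrow> 'n \<Rightarrow> 'h \<Rightarrow> 'h::chilbert_space"
  where "tuple_eval f X j =
    (if X \<in> conv_sot f then (THE Y. sot_eval (f j) X Y) else (THE Y. rad_eval (f j) X Y))"

text \<open>The value at \<open>X\<close> of a free holomorphic function.\<close>

definition hol_eval ::
  "'n::finite ncps \<Rightarrow> ('n \<Rightarrow> 'h \<Rightarrow> 'h) \<Rightarrow> 'h \<Rightarrow> 'h::chilbert_space"
  where "hol_eval c X = (THE Y. norm_eval c X Y)"


section \<open>The model property\<close>

text \<open>The model property has three cases: (A) \<open>f\<close> is a polynomial automorphism, (S) \<open>f\<close> is a tuple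
  of power series with \<open>f(0) = 0\<close> and invertible Jacobian at 0, (F) \<open>f\<close> is a free holomorphic map
  into the unit ball. In each case the Hilbert space \<open>H2(f)\<close> has the orthonormal basis \<open>f\<^sub>\<alpha>\<close>,
  indexed by words \<open>\<alpha>\<close>, and its elements are represented by their coordinates with respect to
  this basis, that is, by elements \<open>x\<close> of \<open>('n list, complex) l2\<close>. The element with coordinates
  \<open>x\<close> is
  \<^item> the polynomial \<open>poly_comp (coord x) f\<close> in case (A), for finitely supported \<open>x\<close>; \<open>H2(f)\<close> is the
    completion of these,
  \<^item> the power series \<open>series_of f x\<close> in case (S),
  \<^item> the function \<open>X \<mapsto> G(f(X))\<close> with \<open>G = coord x\<close> in case (F).

  The predicates \<open>left_mult_A\<close>, \<open>left_mult_S\<close>, \<open>left_mult_F\<close> say that the operator \<open>A\<close> on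
  coordinates is left multiplication by \<open>p\<close> and is bounded. Throughout, \<open>a i\<close> is the coordinate
  vector of \<open>Z\<^sub>i\<close> and \<open>M i\<close> is left multiplication by \<open>Z\<^sub>i\<close>.\<close>

type_synonym 'n h2 = "('n list, complex) l2"

definition left_mult_A ::
  "('n::finite \<Rightarrow> 'n ncps) \<Rightarrow> 'n ncps \<Rightarrow> ('n h2 \<Rightarrow> 'n h2) \<Rightarrow> bool"
  where "left_mult_A f p A \<longleftrightarrow> bounded_clinear A \<and>
    (\<forall>x. nc_polynomial (coord x) \<longrightarrow> nc_polynomial (coord (A x)) \<and>
      poly_comp (coord (A x)) f = nc_mult p (poly_comp (coord x) f))"

definition model_A ::
  "('n::finite \<Rightarrow> 'n ncps) \<Rightarrow> ('n \<Rightarrow> 'n h2) \<Rightarrow> ('n \<Rightarrow> 'n h2 \<Rightarrow> 'n h2) \<Rightarrow> bool"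
  where "model_A f a M \<longleftrightarrow>
    (\<forall>j. nc_polynomial (f j)) \<and>
    (\<exists>g. (\<forall>j. nc_polynomial (g j)) \<and>
      (\<forall>j. poly_comp (f j) g = nc_var j) \<and> (\<forall>j. poly_comp (g j) f = nc_var j)) \<and>
    (\<forall>i. nc_polynomial (coord (a i)) \<and> poly_comp (coord (a i)) f = nc_var i) \<and>
    (\<forall>i. left_mult_A f (nc_var i) (M i))"

text \<open>As \<open>f(0) = 0\<close> in case (S), the series \<open>f\<^sub>\<alpha>\<close> has no terms of degree below \<open>|\<alpha>|\<close>, so that the
  coefficient of \<open>w\<close> in the sum of all \<open>x\<^sub>\<alpha> f\<^sub>\<alpha>\<close> is a finite sum.\<close>

definition series_of :: "('n::finite \<Rightarrow> 'n ncps) \<Rightarrow> 'n h2 \<Rightarrow> 'n ncps"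
  where "series_of f x w = (\<Sum>\<alpha> | length \<alpha> \<le> length w. coord x \<alpha> * nc_word f \<alpha> w)"

definition left_mult_S ::
  "('n::finite \<Rightarrow> 'n ncps) \<Rightarrow> 'n ncps \<Rightarrow> ('n h2 \<Rightarrow> 'n h2) \<Rightarrow> bool"
  where "left_mult_S f p A \<longleftrightarrow> bounded_clinear A \<and>
    (\<forall>x. series_of f (A x) = nc_mult p (series_of f x))"

definition model_S ::
  "('n::finite \<Rightarrow> 'n ncps) \<Rightarrow> ('n \<Rightarrow> 'n h2) \<Rightarrow> ('n \<Rightarrow> 'n h2 \<Rightarrow> 'n h2) \<Rightarrow> bool"
  where "model_S f a M \<longleftrightarrow>
    (\<forall>j. f j [] = 0) \<and> (\<forall>j. nc_radius (f j) > 0) \<and>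
    det (\<chi> i j. f i [j]) \<noteq> 0 \<and>
    (\<forall>i. series_of f (a i) = nc_var i) \<and>
    (\<forall>i. left_mult_S f (nc_var i) (M i)) \<and>
    M \<in> conv_sot f \<union> conv_rad f \<and>
    (\<forall>j. left_mult_S f (f j) (tuple_eval f M j))"

text \<open>Free holomorphic functions are evaluated on the separable infinite-dimensional Hilbert space
  \<open>(nat, complex) l2\<close>.\<close>

type_synonym 'n ell2_tuple = "'n \<Rightarrow> (nat, complex) l2 \<Rightarrow> (nat, complex) l2"

definition left_mult_F ::
  "real \<Rightarrow> ('n::finite \<Rightarrow> 'n ncps) \<Rightarrow> 'n ncps \<Rightarrow> ('n h2 \<Rightarrow> 'n h2) \<Rightarrow> bool"
  where "left_mult_F \<gamma> f p A \<longleftrightarrow> bounded_clinear A \<and>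
    (\<forall>x. \<forall>X\<in>op_ball \<gamma> :: 'n ell2_tuple set.
      hol_eval (coord (A x)) (\<lambda>j. hol_eval (f j) X) =
      hol_eval p X \<circ> hol_eval (coord x) (\<lambda>j. hol_eval (f j) X))"

definition model_F ::
  "('n::finite \<Rightarrow> 'n ncps) \<Rightarrow> ('n \<Rightarrow> 'n h2) \<Rightarrow> ('n \<Rightarrow> 'n h2 \<Rightarrow> 'n h2) \<Rightarrow> bool"
  where "model_F f a M \<longleftrightarrow> (\<exists>\<gamma>>0.
    (\<forall>j. nc_radius (f j) \<ge> ereal \<gamma>) \<and>
    (\<forall>X\<in>op_ball \<gamma> :: 'n ell2_tuple set. (\<lambda>j. hol_eval (f j) X) \<in> op_ball 1) \<and>
    (\<forall>G. nc_radius G \<ge> 1 \<and> G \<noteq> (\<lambda>\<alpha>. 0) \<longrightarrow>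
      (\<exists>X\<in>op_ball \<gamma> :: 'n ell2_tuple set. hol_eval G (\<lambda>j. hol_eval (f j) X) \<noteq> (\<lambda>h. 0))) \<and>
    (\<forall>i. \<forall>X\<in>op_ball \<gamma> :: 'n ell2_tuple set.
      hol_eval (coord (a i)) (\<lambda>j. hol_eval (f j) X) = X i) \<and>
    (\<forall>i. left_mult_F \<gamma> f (nc_var i) (M i)) \<and>
    M \<in> conv_sot f \<union> conv_rad f \<and>
    (\<forall>j. left_mult_F \<gamma> f (f j) (tuple_eval f M j)))"

text \<open>\<open>f\<close> has the model property, \<open>Z\<^sub>i\<close> is the sum of all \<open>a\<^sub>i\<^sub>\<alpha> f\<^sub>\<alpha>\<close> in \<open>H2(f)\<close>, and \<open>M\<close> is the
  universal model. As \<open>a\<close> and \<open>M\<close> are determined by \<open>f\<close>, the tuple \<open>f\<close> has the model property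
  if and only if this holds for some \<open>a\<close> and \<open>M\<close>.\<close>

definition model_property ::
  "('n::finite \<Rightarrow> 'n ncps) \<Rightarrow> ('n \<Rightarrow> 'n h2) \<Rightarrow> ('n \<Rightarrow> 'n h2 \<Rightarrow> 'n h2) \<Rightarrow> bool"
  where "model_property f a M \<longleftrightarrow> model_A f a M \<or> model_S f a M \<or> model_F f a M"


section \<open>The noncommutative domain and its pure elements\<close>

text \<open>The equation \<open>g(f(X)) = X\<close>, where the coefficients of the inverse \<open>g\<^sub>i\<close> of \<open>f\<close> are those
  of \<open>Z\<^sub>i\<close> with respect to the basis \<open>f\<^sub>\<alpha>\<close>.\<close>

definition inverse_eq ::
  "('n::finite \<Rightarrow> 'n ncps) \<Rightarrow> ('n \<Rightarrow> 'n h2) \<Rightarrow> ('n \<Rightarrow> 'h \<Rightarrow> 'h::chilbert_space) \<Rightarrow> bool"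
  where "inverse_eq f a X \<longleftrightarrow> X \<in> conv_sot f \<union> conv_rad f \<and>
    ((\<forall>i. sot_eval (coord (a i)) (tuple_eval f X) (X i)) \<or>
     (\<forall>i. rad_eval (coord (a i)) (tuple_eval f X) (X i)))"

definition nc_domain ::
  "('n::finite \<Rightarrow> 'n ncps) \<Rightarrow> ('n \<Rightarrow> 'n h2) \<Rightarrow> ('n \<Rightarrow> 'h \<Rightarrow> 'h::chilbert_space) set"
  where "nc_domain f a =
    {X \<in> op_tuples. inverse_eq f a X \<and> onorm (row_op (tuple_eval f X)) \<le> 1}"

definition pure_tuple ::
  "('n::finite \<Rightarrow> 'n ncps) \<Rightarrow> ('n \<Rightarrow> 'h \<Rightarrow> 'h::chilbert_space) \<Rightarrow> bool"
  where "pure_tuple f T \<longleftrightarrow>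
    sot_tendsto
      (\<lambda>k h. \<Sum>\<alpha> | length \<alpha> = k.
        word_op (tuple_eval f T) \<alpha> (cadjoint (word_op (tuple_eval f T) \<alpha>) h))
      (\<lambda>h. 0) sequentially"

definition unitary_between ::
  "'a::chilbert_space set \<Rightarrow> 'b::chilbert_space set \<Rightarrow> ('a \<Rightarrow> 'b) \<Rightarrow> bool"
  where "unitary_between S S' U \<longleftrightarrow>
    (\<forall>x\<in>S. \<forall>y\<in>S. U (x + y) = U x + U y) \<and> (\<forall>c. \<forall>x\<in>S. U (c *\<^sub>C x) = c *\<^sub>C U x) \<and>
    (\<forall>x\<in>S. \<forall>y\<in>S. cinner (U x) (U y) = cinner x y) \<and> U ` S = S'"

definition unitarily_equivalent ::
  "('n \<Rightarrow> 'h \<Rightarrow> 'h::chilbert_space) \<Rightarrow> ('n \<Rightarrow> 'k \<Rightarrow> 'k::chilbert_space) \<Rightarrow> bool"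
  where "unitarily_equivalent T T' \<longleftrightarrow>
    (\<exists>U. unitary_between UNIV UNIV U \<and> (\<forall>i. T i = cadjoint U \<circ> T' i \<circ> U))"


section \<open>Multi-analytic operators and the characteristic function\<close>

definition defect ::
  "('n::finite \<Rightarrow> 'n ncps) \<Rightarrow> ('n \<Rightarrow> 'h \<Rightarrow> 'h::chilbert_space) \<Rightarrow> 'h \<Rightarrow> 'h"
  where "defect f T =
    op_sqrt (\<lambda>h. h - (\<Sum>i\<in>UNIV. tuple_eval f T i (cadjoint (tuple_eval f T i) h)))"

definition defect_star ::
  "('n::finite \<Rightarrow> 'n ncps) \<Rightarrow> ('n \<Rightarrow> 'h \<Rightarrow> 'h::chilbert_space) \<Rightarrow> 'h ^ 'n \<Rightarrow> 'h ^ 'n"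
  where "defect_star f T =
    op_sqrt (\<lambda>v. v - cadjoint (row_op (tuple_eval f T)) (row_op (tuple_eval f T) v))"

definition defect_space ::
  "('n::finite \<Rightarrow> 'n ncps) \<Rightarrow> ('n \<Rightarrow> 'h \<Rightarrow> 'h::chilbert_space) \<Rightarrow> 'h set"
  where "defect_space f T = closure (range (defect f T))"

definition defect_space_star ::
  "('n::finite \<Rightarrow> 'n ncps) \<Rightarrow> ('n \<Rightarrow> 'h \<Rightarrow> 'h::chilbert_space) \<Rightarrow> ('h ^ 'n) set"
  where "defect_space_star f T = closure (range (defect_star f T))"

text \<open>For a closed subspace \<open>D\<close> of \<open>K\<close>, the subspace of the tensor product of \<open>H2(f)\<close> and \<open>K\<close>
  that is the tensor product of \<open>H2(f)\<close> and \<open>D\<close>.\<close>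

definition h2_tensor :: "'k::chilbert_space set \<Rightarrow> ('n list, 'k) l2 set"
  where "h2_tensor D = {x. \<forall>\<alpha>. coord x \<alpha> \<in> D}"

text \<open>Right multiplication by \<open>f\<^sub>i\<close>, mapping \<open>f\<^sub>\<alpha>\<close> to the basis vector for the word \<open>\<alpha> @ [i]\<close>.\<close>

lift_definition right_mult :: "'n \<Rightarrow> 'n h2 \<Rightarrow> 'n h2"
  is "\<lambda>i x \<beta>. if \<beta> \<noteq> [] \<and> last \<beta> = i then x (butlast \<beta>) else 0"
proof -
  fix i :: 'n and x :: "'n list \<Rightarrow> complex"
  assume x: "sq_summable x"
  let ?y = "\<lambda>\<beta>. if \<beta> \<noteq> [] \<and> last \<beta> = i then x (butlast \<beta>) else 0"
  let ?e = "\<lambda>\<alpha>. \<alpha> @ [i]"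
  have "inj ?e"
    by (simp add: inj_def)
  then have "(\<lambda>\<beta>. (norm (?y \<beta>))\<^sup>2) summable_on range ?e"
    using x by (simp add: summable_on_reindex sq_summable_def o_def)
  moreover have "?y \<beta> = 0" if "\<beta> \<notin> range ?e" for \<beta>
    using that by (metis append_butlast_last_id rangeI)
  then have "(\<lambda>\<beta>. (norm (?y \<beta>))\<^sup>2) summable_on range ?e \<longleftrightarrow> (\<lambda>\<beta>. (norm (?y \<beta>))\<^sup>2) summable_on UNIV"
    by (intro summable_on_cong_neutral) auto
  ultimately show "sq_summable ?y"
    by (simp only: sq_summable_def)
qed

text \<open>The formal Fourier representation with each \<open>\<Lambda>\<^sub>i\<close> replaced by \<open>r \<Lambda>\<^sub>i\<close>. The row operator
  with entries \<open>\<Lambda>\<^sub>i \<otimes> I\<close> is the sum of the operators \<open>\<Lambda>\<^sub>i \<otimes> \<pi>\<^sub>i\<close>, where \<open>\<pi>\<^sub>i\<close> is the projection of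
  \<open>'h ^ 'n\<close> onto its \<open>i\<close>th component.\<close>

definition char_fun_r ::
  "('n::finite \<Rightarrow> 'n ncps) \<Rightarrow> ('n \<Rightarrow> 'h \<Rightarrow> 'h::chilbert_space) \<Rightarrow> real
    \<Rightarrow> ('n list, 'h ^ 'n) l2 \<Rightarrow> ('n list, 'h) l2"
  where "char_fun_r f T r x =
    - tensor_op id (row_op (tuple_eval f T)) x
    + tensor_op id (defect f T)
        (inv (\<lambda>z. z - (\<Sum>i\<in>UNIV.
            tensor_op (\<lambda>u. r *\<^sub>R right_mult i u) (cadjoint (tuple_eval f T i)) z))
          (\<Sum>i\<in>UNIV. tensor_op (\<lambda>u. r *\<^sub>R right_mult i u) (\<lambda>v. v $ i)
            (tensor_op id (defect_star f T) x)))"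

text \<open>The characteristic function is an operator from \<open>h2_tensor (defect_space_star f T)\<close> to
  \<open>h2_tensor (defect_space f T)\<close>; only its values on the former set matter.\<close>

definition char_fun ::
  "('n::finite \<Rightarrow> 'n ncps) \<Rightarrow> ('n \<Rightarrow> 'h \<Rightarrow> 'h::chilbert_space)
    \<Rightarrow> ('n list, 'h ^ 'n) l2 \<Rightarrow> ('n list, 'h) l2"
  where "char_fun f T x = Lim (at_left 1) (\<lambda>r. char_fun_r f T r x)"

definition multi_analytic ::
  "('n \<Rightarrow> 'n h2 \<Rightarrow> 'n h2) \<Rightarrow> 'k::chilbert_space set \<Rightarrow> 'l::chilbert_space set
    \<Rightarrow> (('n list, 'k) l2 \<Rightarrow> ('n list, 'l) l2) \<Rightarrow> bool"
  where "multi_analytic M D E \<Phi> \<longleftrightarrow>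
    \<Phi> ` h2_tensor D \<subseteq> h2_tensor E \<and>
    (\<forall>x\<in>h2_tensor D. \<forall>y\<in>h2_tensor D. \<Phi> (x + y) = \<Phi> x + \<Phi> y) \<and>
    (\<forall>c. \<forall>x\<in>h2_tensor D. \<Phi> (c *\<^sub>C x) = c *\<^sub>C \<Phi> x) \<and>
    (\<exists>B. \<forall>x\<in>h2_tensor D. norm (\<Phi> x) \<le> B * norm x) \<and>
    (\<forall>i. \<forall>x\<in>h2_tensor D. \<Phi> (tensor_op (M i) id x) = tensor_op (M i) id (\<Phi> x))"

text \<open>Here \<open>\<Phi>\<close> acts from \<open>h2_tensor D\<close> to \<open>h2_tensor E\<close>, and \<open>\<Phi>'\<close> from \<open>h2_tensor D'\<close> to
  \<open>h2_tensor E'\<close>.\<close>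

definition coincide ::
  "('n \<Rightarrow> 'n h2 \<Rightarrow> 'n h2)
    \<Rightarrow> 'k::chilbert_space set \<Rightarrow> 'l::chilbert_space set
    \<Rightarrow> (('n list, 'k) l2 \<Rightarrow> ('n list, 'l) l2)
    \<Rightarrow> 'p::chilbert_space set \<Rightarrow> 'q::chilbert_space set
    \<Rightarrow> (('n list, 'p) l2 \<Rightarrow> ('n list, 'q) l2) \<Rightarrow> bool"
  where "coincide M D E \<Phi> D' E' \<Phi>' \<longleftrightarrow>
    (\<exists>W\<^sub>1 W\<^sub>2.
      multi_analytic M D D' W\<^sub>1 \<and> unitary_between (h2_tensor D) (h2_tensor D') W\<^sub>1 \<and>
      multi_analytic M E E' W\<^sub>2 \<and> unitary_between (h2_tensor E) (h2_tensor E') W\<^sub>2 \<and>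
      (\<forall>x\<in>h2_tensor D. \<Phi>' (W\<^sub>1 x) = W\<^sub>2 (\<Phi> x)))"

end

theory Submission
  imports Defs
begin

text \<open>Write \<open>Y = f(T)\<close>, a pure row contraction with defect operators \<open>\<Delta>\<close>, \<open>\<Delta>\<^sub>*\<close>. The characteristic
  function \<open>\<Theta>\<close> is the transfer function of the unitary colligation built from \<open>Y\<close>, and the Poisson
  kernel \<open>K h = \<Sum>\<^sub>\<alpha> f\<^sub>\<alpha> \<otimes> \<Delta> Y\<^sub>\<alpha>\<^sup>* h\<close> is its response to the initial state \<open>h\<close>. The energy balance of
  the colligation shows that \<open>K\<close> is an isometry with range orthogonal to that of \<open>\<Theta>\<close>, and running
  the colligation backwards shows that the two ranges span \<open>H\<^sup>2(f) \<otimes> \<D>\<close>. The equation \<open>g(f(T)) = T\<close> gives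
  \<open>T\<^sub>i = K\<^sup>* (M\<^sub>i \<otimes> I) K\<close>. A coincidence of \<open>\<Theta>\<close> and \<open>\<Theta>'\<close> maps the range of \<open>K\<close> onto that
  of \<open>K'\<close> and intertwines the compressions of \<open>M\<^sub>i \<otimes> I\<close> to these ranges, which are \<open>T\<^sub>i\<close> and \<open>T'\<^sub>i\<close>.
  Conversely a unitary \<open>U\<close> between \<open>T\<close> and \<open>T'\<close> induces the coincidence
  \<open>I \<otimes> (U \<oplus> \<dots> \<oplus> U)\<close>, \<open>I \<otimes> U\<close>.\<close>

section \<open>Bounded operators and their adjoints\<close>

text \<open>The three cases of the model property describe \<open>M\<close> through three
  realizations of \<open>H\<^sup>2(f)\<close>. They meet in one formula, \<open>M\<^sub>i
  f\<^sub>\<beta> = \<Sum>\<^sub>\<alpha> a\<^sub>i\<^sub>\<alpha>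
  f\<^sub>\<alpha>\<^sub>\<beta>\<close>, which each case yields because coordinates are determined
  by the polynomial, series or function that they represent. This formula is the link between
  g(f(T)) = T and \<open>M\<close>: the operator \<open>K\<^sup>*\<close> sends
  \<open>f\<^sub>\<beta> \<otimes> k\<close> to \<open>Y\<^sub>\<beta> \<Delta> k\<close>, hence
  \<open>M\<^sub>i f\<^sub>\<beta> \<otimes> k\<close> to \<open>g\<^sub>i(Y) Y\<^sub>\<beta>
  \<Delta> k = T\<^sub>i Y\<^sub>\<beta> \<Delta> k\<close>. Adjoints, square roots and
  \<open>A \<otimes> I\<close> are definite descriptions, so their existence and uniqueness have to
  be settled first. Square roots are written as binomial series because a power series passes
  termwise through every intertwining relation; this gives the relations of both defect operators
  with \<open>Y\<close> and with a unitary \<open>U\<close>. Purity removes the boundary term of the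
  energy balance.\<close>

lemma cnj_cinner [simp]: "cnj (cinner x y) = cinner y (x::'a::chilbert_space)"
  by (metis cinner_commute)

lemma cinner_add_right: "cinner x (y + z) = cinner x y + cinner x (z::'a::chilbert_space)"
  by (metis cinner_add_left cinner_commute complex_cnj_add)

lemma cinner_zero_left [simp]: "cinner 0 (y::'a::chilbert_space) = 0"
  using cinner_add_left[of 0 0 y] by simp

lemma cinner_zero_right [simp]: "cinner (y::'a::chilbert_space) 0 = 0"
  using cinner_add_right[of y 0 0] by simp

lemma cinner_minus_left [simp]: "cinner (- x) (y::'a::chilbert_space) = - cinner x y"
  using cinner_add_left[of x "- x" y] by (simp add: eq_neg_iff_add_eq_0 add.commute)

lemma cinner_minus_right [simp]: "cinner x (- y::'a::chilbert_space) = - cinner x y"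
  using cinner_add_right[of x y "- y"] by (simp add: eq_neg_iff_add_eq_0 add.commute)

lemma cinner_diff_left: "cinner (x - y) (z::'a::chilbert_space) = cinner x z - cinner y z"
  using cinner_add_left[of x "- y" z] by simp

lemma cinner_diff_right: "cinner x (y - z::'a::chilbert_space) = cinner x y - cinner x z"
  using cinner_add_right[of x y "- z"] by simp

lemma cinner_sum_left: "cinner (\<Sum>i\<in>I. f i) (y::'a::chilbert_space) = (\<Sum>i\<in>I. cinner (f i) y)"
  by (induction I rule: infinite_finite_induct) (auto simp: cinner_add_left)

lemma cinner_sum_right: "cinner (y::'a::chilbert_space) (\<Sum>i\<in>I. f i) = (\<Sum>i\<in>I. cinner y (f i))"
  by (induction I rule: infinite_finite_induct) (auto simp: cinner_add_right)

lemma cinner_scaleR_left: "cinner (r *\<^sub>R x) (y::'a::chilbert_space) = complex_of_real r * cinner x y"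
  by (simp add: scaleR_scaleC cinner_scaleC_left)

lemma cinner_scaleR_right: "cinner (x::'a::chilbert_space) (r *\<^sub>R y) = complex_of_real r * cinner x y"
  by (simp add: scaleR_scaleC cinner_scaleC_right)

lemma scaleC_zero_left [simp]: "0 *\<^sub>C x = (0::'a::chilbert_space)"
  using scaleR_scaleC[of 0 x] by simp

lemma scaleC_zero_right [simp]: "c *\<^sub>C 0 = (0::'a::chilbert_space)"
  using scaleC_add_right[of c "0::'a" 0] by simp

lemma scaleC_one [simp]: "1 *\<^sub>C x = (x::'a::chilbert_space)"
  using scaleR_scaleC[of 1 x] by simp

lemma scaleC_sum_right: "c *\<^sub>C (\<Sum>i\<in>I. f i) = (\<Sum>i\<in>I. c *\<^sub>C (f i::'a::chilbert_space))"
  by (induction I rule: infinite_finite_induct) (auto simp: scaleC_add_right)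

lemma scaleC_diff_right: "c *\<^sub>C (x - y) = c *\<^sub>C x - c *\<^sub>C (y::'a::chilbert_space)"
  by (metis add_diff_cancel diff_add_cancel scaleC_add_right)

lemma scaleC_scaleR_commute: "c *\<^sub>C (r *\<^sub>R x) = r *\<^sub>R (c *\<^sub>C (x::'a::chilbert_space))"
  by (simp add: scaleR_scaleC scaleC_scaleC mult.commute)

lemma cinner_self_eq_0 [simp]: "cinner x x = 0 \<longleftrightarrow> x = (0::'a::chilbert_space)"
  by (simp add: cinner_self)

lemma cinner_eqI:
  fixes x y :: "'a::chilbert_space"
  assumes "\<And>z. cinner x z = cinner y z"
  shows "x = y"
  using assms[of "x - y"] cinner_self_eq_0[of "x - y"] by (simp add: cinner_diff_left)

lemma cinner_eqI_right:
  fixes x y :: "'a::chilbert_space"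
  assumes "\<And>z. cinner z x = cinner z y"
  shows "x = y"
  by (rule cinner_eqI) (metis assms cinner_commute)

lemma bounded_linear_cinner_left: "bounded_linear (\<lambda>x. cinner x (y::'a::chilbert_space))"
  by (rule bounded_linear_intro[where K = "norm y"])
    (simp_all add: cinner_add_left cinner_scaleR_left scaleR_conv_of_real cinner_bound)

lemma bounded_linear_scaleC: "bounded_linear (\<lambda>x::'a::chilbert_space. c *\<^sub>C x)"
  by (rule bounded_linear_intro[where K = "cmod c"])
    (simp_all add: scaleC_add_right scaleC_scaleR_commute mult.commute)

lemma bounded_clinearI:
  assumes "\<And>x y. A (x + y) = A x + A y" "\<And>c x. A (c *\<^sub>C x) = c *\<^sub>C A x"
    "\<And>x. norm (A x) \<le> K * norm x"
  shows "bounded_clinear A"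
  unfolding bounded_clinear_def
proof (intro conjI allI)
  show "bounded_linear A"
    by (rule bounded_linear_intro[where K = K])
      (use assms in \<open>simp_all add: scaleR_scaleC mult.commute\<close>)
qed (fact assms)

lemma bounded_clinearD: "bounded_clinear A \<Longrightarrow> bounded_linear A"
  by (simp add: bounded_clinear_def)

lemma bounded_clinear_scaleC: "bounded_clinear A \<Longrightarrow> A (c *\<^sub>C x) = c *\<^sub>C A x"
  by (simp add: bounded_clinear_def)

lemmas bounded_clinear_simps =
  linear_add[OF bounded_linear.linear[OF bounded_clinearD]]
  linear_diff[OF bounded_linear.linear[OF bounded_clinearD]]
  linear_neg[OF bounded_linear.linear[OF bounded_clinearD]]
  linear_0[OF bounded_linear.linear[OF bounded_clinearD]]
  linear_sum[OF bounded_linear.linear[OF bounded_clinearD]]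
  linear_scale[OF bounded_linear.linear[OF bounded_clinearD]]
  bounded_clinear_scaleC

lemma bounded_clinear_id: "bounded_clinear id" "bounded_clinear (\<lambda>x. x)"
  by (auto intro: bounded_clinearI[where K = 1])

lemma bounded_clinear_compose:
  assumes "bounded_clinear A" "bounded_clinear B"
  shows "bounded_clinear (\<lambda>x. A (B x))"
  using assms unfolding bounded_clinear_def by (auto intro: bounded_linear_compose)

lemma bounded_clinear_diff:
  assumes "bounded_clinear A" "bounded_clinear B"
  shows "bounded_clinear (\<lambda>x. A x - B x)"
  using assms unfolding bounded_clinear_def
  by (auto intro: bounded_linear_sub simp: scaleC_diff_right)

lemma bounded_clinear_sum:
  assumes "\<And>i. i \<in> I \<Longrightarrow> bounded_clinear (A i)"
  shows "bounded_clinear (\<lambda>x. \<Sum>i\<in>I. A i x)"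
  using assms unfolding bounded_clinear_def
  by (auto intro: bounded_linear_sum simp: scaleC_sum_right)

lemma bounded_clinear_scaleC_op:
  assumes "bounded_clinear A"
  shows "bounded_clinear (\<lambda>x. c *\<^sub>C A x)"
  unfolding bounded_clinear_def
  using bounded_linear_compose[OF bounded_linear_scaleC bounded_clinearD[OF assms]]
  by (auto simp: bounded_clinear_scaleC[OF assms] scaleC_scaleC mult.commute)

lemma bounded_clinear_scaleR_op:
  "bounded_clinear A \<Longrightarrow> bounded_clinear (\<lambda>x. r *\<^sub>R A x)"
  unfolding scaleR_scaleC by (rule bounded_clinear_scaleC_op)

lemma bounded_clinear_funpow:
  fixes C :: "'a::chilbert_space \<Rightarrow> 'a"
  assumes "bounded_clinear C"
  shows "bounded_clinear (C ^^ k)"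
proof (induction k)
  case (Suc k)
  then show ?case
    using bounded_clinear_compose[OF assms, of "C ^^ k"] by (simp add: o_def)
qed (use bounded_clinear_id(1) in \<open>simp add: id_def\<close>)

lemma bounded_clinear_nth: "bounded_clinear (\<lambda>v::('a::chilbert_space)^'n. v $ i)"
  by (rule bounded_clinearI[where K = 1]) (auto simp: scaleC_vec_def Finite_Cartesian_Product.norm_nth_le)

lemma norm_vec_sq: "(norm (v::('a::real_normed_vector)^'n))\<^sup>2 = (\<Sum>i\<in>UNIV. (norm (v $ i))\<^sup>2)"
  by (simp add: norm_vec_def L2_set_def sum_nonneg)

lemma norm_axis: "norm (axis i (x::'a::real_normed_vector)) = norm x"
proof -
  have "(norm (axis i x))\<^sup>2 = (\<Sum>j\<in>UNIV. if j = i then (norm x)\<^sup>2 else 0)"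
    unfolding norm_vec_sq by (intro sum.cong) (auto simp: axis_def)
  then show ?thesis by simp
qed

lemma bounded_clinear_vec:
  assumes "\<And>i. bounded_clinear (A i)"
  shows "bounded_clinear (\<lambda>x. \<chi> i. A i x)"
proof -
  have *: "(\<lambda>x. \<chi> i. A i x) = (\<lambda>x. \<Sum>i\<in>UNIV. axis i (A i x))"
    by (auto simp: vec_eq_iff axis_def if_distrib cong: if_cong)
  have "bounded_clinear (\<lambda>x. axis i (A i x))" for i
  proof (rule bounded_clinear_compose[OF _ assms])
    show "bounded_clinear (axis i)"
      by (rule bounded_clinearI[where K = 1])
        (simp_all add: norm_axis, auto simp: vec_eq_iff axis_def scaleC_vec_def)
  qed
  then show ?thesis
    unfolding * by (intro bounded_clinear_sum)
qed

text \<open>First-order condition at a minimum: a quadratic with minimal value 0 at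
  \<open>t = 0\<close> has slope 0 there. It serves the variational arguments in
  \<open>riesz_real\<close> and \<open>positive_op_eq_0\<close>.\<close>

lemma linear_coeff_eq_0:
  fixes c d :: real
  assumes "\<And>t. 0 \<le> t\<^sup>2 * c + t * d"
  shows "d = 0"
proof (rule ccontr)
  assume "d \<noteq> 0"
  \<comment> \<open>Any positive \<open>C\<close> above \<open>c\<close> will do: at
    \<open>t = - d / C\<close> the quadratic lies strictly below
    \<open>d\<^sup>2 / C - d\<^sup>2 / C = 0\<close>.\<close>
  define C where "C = \<bar>c\<bar> + 1"
  have C: "C > 0" "c < C"
    by (auto simp: C_def)
  have "0 \<le> (d / C)\<^sup>2 * c - d / C * d"
    using assms[of "- (d / C)"] by simp
  also have "\<dots> < (d / C)\<^sup>2 * C - d / C * d"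
    using \<open>d \<noteq> 0\<close> C by (intro diff_strict_right_mono mult_strict_left_mono) auto
  also have "\<dots> = 0"
    using C by (simp add: power2_eq_square)
  finally show False by simp
qed

text \<open>The functional \<open>x \<mapsto> \<parallel>x\<parallel>\<^sup>2 - 2 \<phi> x\<close> is minimized exactly at the representing vector.\<close>

lemma riesz_real:
  fixes \<phi> :: "'a::chilbert_space \<Rightarrow> real"
  assumes "bounded_linear \<phi>"
  shows "\<exists>y. \<forall>x. \<phi> x = inner x y"
proof -
  interpret \<phi>: bounded_linear \<phi> by fact
  define J where "J x = inner x x - 2 * \<phi> x" for x
  obtain K where K: "\<And>x. norm (\<phi> x) \<le> norm x * K"
    using \<phi>.bounded by blast
  have bd: "- K\<^sup>2 \<le> J x" for x
  proof -
    have "\<phi> x \<le> norm x * K"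
      using K[of x] by simp
    moreover have "0 \<le> (norm x - K)\<^sup>2"
      by simp
    ultimately show ?thesis
      by (simp add: J_def power2_diff power2_norm_eq_inner)
  qed
  then have bdd: "bdd_below (range J)"
    by (auto intro!: bdd_belowI)
  define m where "m = Inf (range J)"
  have m: "m \<le> J x" for x
    unfolding m_def by (rule cInf_lower[OF _ bdd]) simp
  have "\<exists>x. J x < m + 1 / (real n + 1)" for n
  proof -
    have "\<exists>v\<in>range J. v < m + 1 / (real n + 1)"
      unfolding m_def by (intro cInf_lessD) auto
    then show ?thesis by auto
  qed
  then obtain s where s: "\<And>n. J (s n) < m + 1 / (real n + 1)"
    by metis
  \<comment> \<open>The parallelogram law, in which the linear parts of \<open>J\<close> cancel. It
    makes every minimizing sequence Cauchy.\<close>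
  have par: "(norm (x - y))\<^sup>2 = 2 * J x + 2 * J y - 4 * J ((1/2) *\<^sub>R (x + y))" for x y
    unfolding J_def power2_norm_eq_inner
    by (simp add: inner_diff_left inner_diff_right inner_add_left inner_add_right inner_commute
        \<phi>.add \<phi>.scaleR algebra_simps)
  have close: "(norm (s n - s k))\<^sup>2 < 4 / (real N + 1)" if "n \<ge> N" "k \<ge> N" for n k N
  proof -
    have "1 / (real n + 1) \<le> 1 / (real N + 1)" "1 / (real k + 1) \<le> 1 / (real N + 1)"
      using that by (auto intro!: divide_left_mono)
    then show ?thesis
      using par[of "s n" "s k"] s[of n] s[of k] m[of "(1/2) *\<^sub>R (s n + s k)"] by simp
  qed
  have "Cauchy s"
  proof (rule CauchyI)
    fix e :: real assume e: "e > 0"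
    obtain N where N: "4 / e\<^sup>2 < real N"
      using reals_Archimedean2 by blast
    then have N': "4 / (real N + 1) < e\<^sup>2"
      using e by (simp add: field_simps) (smt (verit) zero_less_power)
    have "norm (s n - s k) < e" if "n \<ge> N" "k \<ge> N" for n k
      using close[OF that] N' e by (meson less_le less_trans power2_less_imp_less)
    then show "\<exists>N. \<forall>n\<ge>N. \<forall>k\<ge>N. norm (s n - s k) < e"
      by blast
  qed
  then obtain y where y: "s \<longlonglongrightarrow> y"
    using Cauchy_convergent convergent_def by blast
  have "(\<lambda>n. J (s n)) \<longlonglongrightarrow> J y"
    unfolding J_def by (intro tendsto_intros y \<phi>.tendsto)
  moreover have "(\<lambda>n. m + 1 / (real n + 1)) \<longlonglongrightarrow> m + 0"
    using LIMSEQ_inverse_real_of_nat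
    by (intro tendsto_add tendsto_const) (simp add: inverse_eq_divide add.commute)
  ultimately have "J y \<le> m"
    using s by (intro LIMSEQ_le) (auto intro!: less_imp_le)
  then have Jy: "J y \<le> J z" for z
    using m[of z] by simp
  have "\<phi> x = inner x y" for x
  proof -
    have "0 \<le> t\<^sup>2 * inner x x + t * (2 * (inner x y - \<phi> x))" for t
      using Jy[of "y + t *\<^sub>R x"] unfolding J_def
      by (simp add: inner_add_left inner_add_right \<phi>.add \<phi>.scaleR inner_commute power2_eq_square
          algebra_simps)
    then have "2 * (inner x y - \<phi> x) = 0"
      by (rule linear_coeff_eq_0)
    then show ?thesis by simp
  qed
  then show ?thesis by blast
qed

text \<open>Riesz representation of the real parts gives an adjoint for \<open>inner\<close>. The
  identity Im z = - Re (i z) and the complex linearity of \<open>A\<close> extend it to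
  \<open>cinner\<close>.\<close>

lemma cadjoint_exists:
  fixes A :: "'a::chilbert_space \<Rightarrow> 'b::chilbert_space"
  assumes A: "bounded_clinear A"
  shows "\<exists>B. bounded_clinear B \<and> (\<forall>x y. cinner (A x) y = cinner x (B y))"
proof -
  obtain K where K: "K \<ge> 0" "\<And>x. norm (A x) \<le> norm x * K"
    using bounded_linear.nonneg_bounded[OF bounded_clinearD[OF A]] by blast
  have "\<exists>z. \<forall>x. inner (A x) y = inner x z" for y
    by (rule riesz_real)
      (intro bounded_linear_inner_left_comp bounded_clinearD[OF A])
  then obtain B where B: "\<And>x y. inner (A x) y = inner x (B y)"
    by metis
  have Im: "Im (cinner x y) = - Re (cinner (\<i> *\<^sub>C x) y)" for x y :: "'c::chilbert_space"
    by (simp add: cinner_scaleC_left)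
  have cB: "cinner (A x) y = cinner x (B y)" for x y
    using B[of x y] B[of "\<i> *\<^sub>C x" y]
    by (simp add: complex_eq_iff Im inner_eq_Re_cinner bounded_clinear_scaleC[OF A])
  have "bounded_clinear B"
  proof (rule bounded_clinearI[where K = K])
    show "B (x + y) = B x + B y" for x y
      by (rule cinner_eqI_right) (simp add: cB[symmetric] cinner_add_right)
    show "B (c *\<^sub>C x) = c *\<^sub>C B x" for c x
      by (rule cinner_eqI_right) (simp add: cB[symmetric] cinner_scaleC_right)
    show "norm (B y) \<le> K * norm y" for y
    proof (cases "B y = 0")
      case True
      then show ?thesis using K(1) by simp
    next
      case False
      have "norm (B y) * norm (B y) = inner (A (B y)) y"
        by (simp add: B power2_norm_eq_inner flip: power2_eq_square)
      also have "\<dots> \<le> norm (A (B y)) * norm y"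
        by (rule norm_cauchy_schwarz)
      also have "\<dots> \<le> norm (B y) * (K * norm y)"
        using mult_right_mono[OF K(2)[of "B y"], of "norm y"] by (simp add: mult.assoc)
      finally show ?thesis
        using False by simp
    qed
  qed
  with cB show ?thesis by blast
qed

lemma cadjoint_eqI:
  assumes "bounded_clinear B" "\<And>x y. cinner (A x) y = cinner x (B y)"
  shows "cadjoint A = B"
  unfolding cadjoint_def
proof (rule the_equality)
  show "B' = B" if "bounded_clinear B' \<and> (\<forall>x y. cinner (A x) y = cinner x (B' y))" for B'
    by (rule ext, rule cinner_eqI_right) (metis that assms(2))
qed (use assms in blast)

lemma
  fixes A :: "'a::chilbert_space \<Rightarrow> 'b::chilbert_space"
  assumes "bounded_clinear A"
  shows bounded_clinear_cadjoint: "bounded_clinear (cadjoint A)"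
    and cinner_cadjoint_right: "cinner x (cadjoint A y) = cinner (A x) y"
    and cinner_cadjoint_left: "cinner (cadjoint A y) x = cinner y (A x)"
proof -
  obtain B where B: "bounded_clinear B" "\<And>x y. cinner (A x) y = cinner x (B y)"
    using cadjoint_exists[OF assms] by blast
  then have eq: "cadjoint A = B"
    by (rule cadjoint_eqI)
  show "bounded_clinear (cadjoint A)" "cinner x (cadjoint A y) = cinner (A x) y"
    by (simp_all add: eq B)
  then show "cinner (cadjoint A y) x = cinner y (A x)"
    by (metis cinner_commute)
qed

lemma norm_cadjoint_le:
  assumes "bounded_clinear A" "K \<ge> 0" "\<And>x. norm (A x) \<le> K * norm x"
  shows "norm (cadjoint A y) \<le> K * norm y"
proof (cases "cadjoint A y = 0")
  case False
  let ?z = "cadjoint A y"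
  have "(norm ?z)\<^sup>2 = cmod (cinner (A ?z) y)"
    unfolding cinner_cadjoint_right[OF assms(1), symmetric] cinner_self
    by (simp add: norm_power flip: of_real_power)
  also have "\<dots> \<le> norm (A ?z) * norm y"
    by (rule cinner_bound)
  also have "\<dots> \<le> (K * norm ?z) * norm y"
    by (intro mult_right_mono assms) simp
  finally show ?thesis
    using False by (simp add: power2_eq_square mult.assoc mult.left_commute)
qed (use assms in simp)

section \<open>Square roots of positive operators\<close>

text \<open>Coefficient of \<open>t ^ k\<close> in the binomial series of (1 - t)^(1/2), so that the
  series in \<open>C\<close> is a root of I - C.\<close>

definition sqrt_coeff :: "nat \<Rightarrow> real"
  where "sqrt_coeff k = (- 1) ^ k * ((1 / 2) gchoose k)"

lemma sqrt_coeff_0 [simp]: "sqrt_coeff 0 = 1"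
  by (simp add: sqrt_coeff_def)

text \<open>The rising factorial of -1/2 has one negative factor, the first.\<close>

lemma sqrt_coeff_nonpos: "k > 0 \<Longrightarrow> sqrt_coeff k \<le> 0"
proof -
  assume "k > 0"
  then obtain n where n: "k = Suc n"
    using gr0_implies_Suc by blast
  have "sqrt_coeff k = pochhammer (- (1 / 2)) k / fact k"
    unfolding sqrt_coeff_def gbinomial_pochhammer by (simp flip: power_mult_distrib)
  moreover have "pochhammer (- (1 / 2)) k = - (1 / 2) * pochhammer (1 / 2 :: real) n"
    unfolding n pochhammer_rec by simp
  moreover have "pochhammer (1 / 2 :: real) n > 0"
    by (rule pochhammer_pos) simp
  ultimately show ?thesis
    by (simp add: divide_nonpos_pos)
qed

text \<open>Partial sums are the coefficients of (1 - t)^(1/2) / (1 - t) = (1 - t)^(-1/2), which are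
  positive.\<close>

lemma sum_sqrt_coeff_nonneg: "(\<Sum>k\<le>N. sqrt_coeff k) \<ge> 0"
proof -
  have "(\<Sum>k\<le>N. sqrt_coeff k) = (- 1) ^ N * (1 / 2 - 1 gchoose N)"
    unfolding sqrt_coeff_def gbinomial_sum_lower_neg[symmetric] by (simp add: mult.commute)
  also have "\<dots> = pochhammer (1 / 2) N / fact N"
    unfolding gbinomial_pochhammer by (simp flip: power_mult_distrib)
  also have "\<dots> \<ge> 0"
    using pochhammer_pos[of "1 / 2 :: real" N] by simp
  finally show ?thesis .
qed

lemma sum_abs_sqrt_coeff: "(\<Sum>k\<le>N. \<bar>sqrt_coeff k\<bar>) = 2 - (\<Sum>k\<le>N. sqrt_coeff k)"
  by (induction N) (simp_all add: abs_of_nonpos sqrt_coeff_nonpos)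

text \<open>Absolute convergence at the boundary point t = 1 admits every contraction
  \<open>C\<close>, also of norm 1. The bound 2 arises because only the zeroth coefficient, 1, is
  positive and all partial sums are nonnegative.\<close>

lemma summable_abs_sqrt_coeff: "summable (\<lambda>k. \<bar>sqrt_coeff k\<bar>)"
proof (rule summableI_nonneg_bounded)
  fix n
  have "(\<Sum>k<n. \<bar>sqrt_coeff k\<bar>) \<le> (\<Sum>k\<le>n. \<bar>sqrt_coeff k\<bar>)"
    by (rule sum_mono2) auto
  also have "\<dots> \<le> 2"
    using sum_sqrt_coeff_nonneg[of n] by (simp add: sum_abs_sqrt_coeff)
  finally show "(\<Sum>k<n. \<bar>sqrt_coeff k\<bar>) \<le> 2" .
qed simp

text \<open>Vandermonde's identity for 1/2 + 1/2 = 1: the square of the series is 1 - t.\<close>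

lemma sqrt_coeff_convolution:
  "(\<Sum>i\<le>n. sqrt_coeff i * sqrt_coeff (n - i)) = (if n = 0 then 1 else if n = 1 then - 1 else 0)"
proof -
  have "(\<Sum>i\<le>n. sqrt_coeff i * sqrt_coeff (n - i)) =
      (\<Sum>i\<le>n. (- 1) ^ n * ((1 / 2 gchoose i) * (1 / 2 gchoose (n - i))))"
    unfolding sqrt_coeff_def
    by (intro sum.cong refl) (auto simp: power_add[symmetric] algebra_simps)
  also have "\<dots> = (- 1) ^ n * (1 / 2 + 1 / 2 gchoose n)"
    by (simp only: sum_distrib_left[symmetric] atMost_atLeast0 gbinomial_Vandermonde)
  also have "\<dots> = (- 1) ^ n * real (1 choose n)"
    by (simp add: binomial_gbinomial)
  also have "\<dots> = (if n = 0 then 1 else if n = 1 then - 1 else 0)"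
    by (cases n) (auto simp: binomial_eq_0)
  finally show ?thesis .
qed

definition sqrt_series :: "('a::chilbert_space \<Rightarrow> 'a) \<Rightarrow> 'a \<Rightarrow> 'a"
  where "sqrt_series C x = (\<Sum>k. sqrt_coeff k *\<^sub>R (C ^^ k) x)"

lemma norm_funpow_le:
  fixes C :: "'a::real_normed_vector \<Rightarrow> 'a"
  assumes "\<And>x. norm (C x) \<le> norm x"
  shows "norm ((C ^^ k) x) \<le> norm x"
  by (induction k) (auto intro: order_trans assms)

lemma summable_norm_sqrt_series:
  fixes C :: "'a::chilbert_space \<Rightarrow> 'a"
  assumes "\<And>x. norm (C x) \<le> norm x"
  shows "summable (\<lambda>k. norm (sqrt_coeff k *\<^sub>R (C ^^ k) x))"
proof (rule summable_comparison_test')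
  show "summable (\<lambda>k. \<bar>sqrt_coeff k\<bar> * norm x)"
    by (intro summable_mult2 summable_abs_sqrt_coeff)
  show "norm (norm (sqrt_coeff k *\<^sub>R (C ^^ k) x)) \<le> \<bar>sqrt_coeff k\<bar> * norm x" for k
    using norm_funpow_le[of C k x] assms by (simp add: mult_left_mono)
qed

lemma sums_sqrt_series:
  assumes "\<And>x. norm (C x) \<le> norm x"
  shows "(\<lambda>k. sqrt_coeff k *\<^sub>R (C ^^ k) x) sums sqrt_series C x"
  unfolding sqrt_series_def
  by (rule summable_sums, rule summable_norm_cancel, rule summable_norm_sqrt_series, rule assms)

lemma has_sum_sqrt_series:
  assumes "\<And>x. norm (C x) \<le> norm x"
  shows "((\<lambda>k. sqrt_coeff k *\<^sub>R (C ^^ k) x) has_sum sqrt_series C x) UNIV"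
  by (rule norm_summable_imp_has_sum[OF summable_norm_sqrt_series sums_sqrt_series]) (rule assms)+

lemma bounded_clinear_sqrt_series:
  assumes C: "bounded_clinear C" and contr: "\<And>x. norm (C x) \<le> norm x"
  shows "bounded_clinear (sqrt_series C)"
proof (rule bounded_clinearI[where K = "\<Sum>k. \<bar>sqrt_coeff k\<bar>"])
  note sums = sums_sqrt_series[of C, OF contr]
  note Ck = bounded_clinear_funpow[OF C]
  show "sqrt_series C (x + y) = sqrt_series C x + sqrt_series C y" for x y
    using sums_unique2[OF sums[of "x + y"] ] sums_add[OF sums[of x] sums[of y]]
    by (simp add: bounded_clinear_simps(1)[OF Ck] scaleR_add_right)
  show "sqrt_series C (c *\<^sub>C x) = c *\<^sub>C sqrt_series C x" for c x
    using sums_unique2[OF sums[of "c *\<^sub>C x"]]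
      bounded_linear.sums[OF bounded_linear_scaleC sums[of x], of c]
    by (simp add: bounded_clinear_scaleC[OF Ck] scaleC_scaleR_commute)
  show "norm (sqrt_series C x) \<le> (\<Sum>k. \<bar>sqrt_coeff k\<bar>) * norm x" for x
  proof -
    have "norm (sqrt_series C x) \<le> (\<Sum>k. norm (sqrt_coeff k *\<^sub>R (C ^^ k) x))"
      unfolding sqrt_series_def by (rule summable_norm[OF summable_norm_sqrt_series[of C, OF contr]])
    also have "\<dots> \<le> (\<Sum>k. \<bar>sqrt_coeff k\<bar> * norm x)"
      by (intro suminf_le summable_mult2 summable_abs_sqrt_coeff summable_norm_sqrt_series contr)
        (use norm_funpow_le[of C _ x] contr in \<open>simp add: mult_left_mono\<close>)
    finally show ?thesis
      by (simp add: suminf_mult2[OF summable_abs_sqrt_coeff])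
  qed
qed

text \<open>\<open>V\<close> carries each power of \<open>C\<close> to the same power of
  \<open>C'\<close>. All commutation relations of defect operators below are instances of this
  lemma.\<close>

lemma sqrt_series_intertwine:
  assumes "\<And>x. norm (C x) \<le> norm x" "\<And>x. norm (C' x) \<le> norm x"
    and V: "bounded_linear V" and "\<And>x. V (C x) = C' (V x)"
  shows "V (sqrt_series C x) = sqrt_series C' (V x)"
proof -
  have "V ((C ^^ k) x) = (C' ^^ k) (V x)" for k
    by (induction k) (simp_all add: assms)
  then have "(\<lambda>k. V (sqrt_coeff k *\<^sub>R (C ^^ k) x)) = (\<lambda>k. sqrt_coeff k *\<^sub>R (C' ^^ k) (V x))"
    by (simp add: linear_scale[OF bounded_linear.linear[OF V]])
  with bounded_linear.sums[OF V sums_sqrt_series[of C x, OF assms(1)]]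
  have "(\<lambda>k. sqrt_coeff k *\<^sub>R (C' ^^ k) (V x)) sums V (sqrt_series C x)"
    by simp
  then show ?thesis
    using sums_sqrt_series[of C' "V x", OF assms(2)] by (rule sums_unique2)
qed

text \<open>Cauchy product: the double series is absolutely summable, since the coefficients are and
  \<open>C\<close> is contractive. Its sum by rows is the iterated root, its sum by antidiagonals
  collapses by \<open>sqrt_coeff_convolution\<close>.\<close>

lemma sqrt_series_sqrt_series:
  assumes C: "bounded_clinear C" and contr: "\<And>x. norm (C x) \<le> norm x"
  shows "sqrt_series C (sqrt_series C x) = x - C x"
proof -
  let ?b = sqrt_coeff and ?B = "sqrt_series C"
  define F where "F = (\<lambda>(j, k). (?b j * ?b k) *\<^sub>R (C ^^ (j + k)) x)"
  define F' where "F' = (\<lambda>(n, i). (?b i * ?b (n - i)) *\<^sub>R (C ^^ n) x)"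
  have absb: "((\<lambda>k. norm (?b k)) has_sum (\<Sum>k. norm (?b k))) UNIV"
    using summable_abs_sqrt_coeff
    by (intro norm_summable_imp_has_sum summable_sums) simp_all
  have "(\<lambda>p. case p of (j, k) \<Rightarrow> norm (?b j) * (norm (?b k) * norm x)) summable_on UNIV \<times> UNIV"
  proof (rule summable_on_SigmaI)
    show "((\<lambda>k. case (j, k) of (j, k) \<Rightarrow> norm (?b j) * (norm (?b k) * norm x)) has_sum
        norm (?b j) * ((\<Sum>k. norm (?b k)) * norm x)) UNIV" for j
      unfolding prod.case by (intro has_sum_cmult_right has_sum_cmult_left absb)
    show "(\<lambda>j. norm (?b j) * ((\<Sum>k. norm (?b k)) * norm x)) summable_on UNIV"
      by (intro summable_on_cmult_left has_sum_imp_summable[OF absb])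
  qed auto
  then have absF: "(\<lambda>p. norm (F p)) summable_on UNIV \<times> UNIV"
  proof (rule summable_on_comparison_test)
    show "norm (F p) \<le> (case p of (j, k) \<Rightarrow> norm (?b j) * (norm (?b k) * norm x))" for p
      using norm_funpow_le[of C _ x, OF contr]
      by (auto simp: F_def abs_mult mult.assoc intro!: mult_left_mono split: prod.split)
  qed simp
  have row: "((\<lambda>k. F (j, k)) has_sum (?b j *\<^sub>R (C ^^ j) (?B x))) UNIV" for j
  proof -
    have bl: "bounded_linear (\<lambda>y. ?b j *\<^sub>R (C ^^ j) y)"
      by (intro bounded_clinearD bounded_clinear_scaleR_op bounded_clinear_funpow C)
    show ?thesis
      using has_sum_bounded_linear[OF bl has_sum_sqrt_series[of C x, OF contr]]
      by (simp add: F_def o_def funpow_add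
          linear_scale[OF bounded_linear.linear[OF bounded_clinearD[OF bounded_clinear_funpow[OF C]]]])
  qed
  have hsF: "(F has_sum infsum F (UNIV \<times> UNIV)) (UNIV \<times> UNIV)"
    using absF by (rule has_sum_infsum[OF abs_summable_summable])
  then have "((\<lambda>j. ?b j *\<^sub>R (C ^^ j) (?B x)) has_sum infsum F (UNIV \<times> UNIV)) UNIV"
    by (rule has_sum_SigmaD) (rule row)
  with has_sum_sqrt_series[of C "?B x", OF contr]
  have 1: "?B (?B x) = infsum F (UNIV \<times> UNIV)"
    by (rule has_sum_unique)
  \<comment> \<open>Regroups the index pairs (j, k) by n = j + k, with i = j.\<close>
  have bij: "bij_betw (\<lambda>(n, i). (i, n - i)) (SIGMA n:UNIV. {..n}) (UNIV \<times> (UNIV :: nat set))"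
    by (rule bij_betwI[where g = "\<lambda>(i, j). (i + j, i)"]) auto
  from hsF have "((\<lambda>p. F (case p of (n, i) \<Rightarrow> (i, n - i))) has_sum infsum F (UNIV \<times> UNIV))
      (SIGMA n:UNIV. {..n})"
    by (subst has_sum_reindex_bij_betw[OF bij])
  then have "(F' has_sum infsum F (UNIV \<times> UNIV)) (SIGMA n:UNIV. {..n})"
    by (rule has_sum_cong[THEN iffD1, rotated]) (auto simp: F_def F'_def)
  then have "((\<lambda>n. \<Sum>i\<le>n. F' (n, i)) has_sum infsum F (UNIV \<times> UNIV)) UNIV"
    by (rule has_sum_SigmaD) (simp add: has_sum_finite)
  moreover have "(\<Sum>i\<le>n. F' (n, i)) = (if n = 0 then x else if n = 1 then - C x else 0)" for n
    unfolding F'_def by (simp add: scaleR_sum_left[symmetric] sqrt_coeff_convolution)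
  ultimately have "((\<lambda>n::nat. if n = 0 then x else if n = 1 then - C x else 0) has_sum
      infsum F (UNIV \<times> UNIV)) UNIV"
    by simp
  moreover have "((\<lambda>n::nat. if n = 0 then x else if n = 1 then - C x else 0) has_sum
      (x - C x)) (UNIV :: nat set)"
  proof (rule has_sum_cong_neutral[THEN iffD1])
    show "((\<lambda>n::nat. if n = 0 then x else - C x) has_sum (x - C x)) {0, 1}"
      using has_sum_finite[of "{0, 1::nat}" "\<lambda>n. if n = 0 then x else - C x"] by simp
  qed auto
  ultimately have "infsum F (UNIV \<times> UNIV) = x - C x"
    by (rule has_sum_unique)
  with 1 show ?thesis by simp
qed

text \<open>For k > 0 the coefficients are nonpositive and the real part of the form of
  \<open>C ^^ k\<close> at \<open>x\<close> is at most \<open>(norm x)\<^sup>2\<close>. The partial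
  sums of the form are therefore at least \<open>(norm x)\<^sup>2\<close> times a partial sum of the
  coefficients, which is nonnegative.\<close>

lemma positive_op_sqrt_series:
  assumes C: "bounded_clinear C" and contr: "\<And>x. norm (C x) \<le> norm x"
    and sym: "\<And>x y. cinner (C x) y = cinner x (C y)"
  shows "positive_op (sqrt_series C)"
proof -
  have symk: "cinner ((C ^^ k) x) y = cinner x ((C ^^ k) y)" for k x y
    by (induction k arbitrary: x y) (simp_all add: sym funpow_swap1)
  have "cinner (sqrt_series C x) x \<in> \<real>\<^sub>\<ge>\<^sub>0" for x
  proof -
    have s: "(\<lambda>k. cinner (sqrt_coeff k *\<^sub>R (C ^^ k) x) x) sums cinner (sqrt_series C x) x"
      by (rule bounded_linear.sums[OF bounded_linear_cinner_left sums_sqrt_series[OF contr]])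
    have "cinner (sqrt_series C x) x = cnj (cinner (sqrt_series C x) x)"
    proof (rule sums_unique2[OF s])
      have "(\<lambda>k. cnj (cinner (sqrt_coeff k *\<^sub>R (C ^^ k) x) x)) sums cnj (cinner (sqrt_series C x) x)"
        using s by (simp only: sums_cnj)
      moreover have "cnj (cinner (sqrt_coeff k *\<^sub>R (C ^^ k) x) x) =
          cinner (sqrt_coeff k *\<^sub>R (C ^^ k) x) x" for k
        by (simp add: cinner_scaleR_left cinner_scaleR_right symk)
      ultimately show "(\<lambda>k. cinner (sqrt_coeff k *\<^sub>R (C ^^ k) x) x) sums cnj (cinner (sqrt_series C x) x)"
        by (simp only:)
    qed
    moreover have "Re (cinner (sqrt_series C x) x) \<ge> 0"
    proof (rule tendsto_lowerbound)
      show "(\<lambda>N. \<Sum>k\<le>N. Re (cinner (sqrt_coeff k *\<^sub>R (C ^^ k) x) x)) \<longlonglongrightarrow>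
          Re (cinner (sqrt_series C x) x)"
        using bounded_linear.sums[OF bounded_linear_Re s] by (simp add: sums_def_le)
      have "(\<Sum>k\<le>N. Re (cinner (sqrt_coeff k *\<^sub>R (C ^^ k) x) x)) \<ge> 0" for N
      proof -
        have "sqrt_coeff k * (norm x)\<^sup>2 \<le> Re (cinner (sqrt_coeff k *\<^sub>R (C ^^ k) x) x)" for k
        proof (cases "k = 0")
          case False
          have "Re (cinner ((C ^^ k) x) x) \<le> cmod (cinner ((C ^^ k) x) x)"
            by (rule complex_Re_le_cmod)
          also have "\<dots> \<le> norm ((C ^^ k) x) * norm x"
            by (rule cinner_bound)
          also have "\<dots> \<le> norm x * norm x"
            by (intro mult_right_mono norm_funpow_le contr) simp
          finally show ?thesis
            using sqrt_coeff_nonpos[of k] False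
            by (simp add: cinner_scaleR_left power2_eq_square mult_left_mono_neg)
        qed (simp add: cinner_self)
        then have "(\<Sum>k\<le>N. sqrt_coeff k * (norm x)\<^sup>2) \<le>
            (\<Sum>k\<le>N. Re (cinner (sqrt_coeff k *\<^sub>R (C ^^ k) x) x))"
          by (intro sum_mono)
        moreover have "(\<Sum>k\<le>N. sqrt_coeff k * (norm x)\<^sup>2) \<ge> 0"
          using sum_sqrt_coeff_nonneg[of N] by (simp flip: sum_distrib_right)
        ultimately show ?thesis by linarith
      qed
      then show "\<forall>\<^sub>F N in sequentially. 0 \<le> (\<Sum>k\<le>N. Re (cinner (sqrt_coeff k *\<^sub>R (C ^^ k) x) x))"
        by simp
    qed simp
    ultimately show ?thesis
      by (metis complex_nonneg_Reals_iff Reals_cnj_iff complex_is_Real_iff)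
  qed
  then show ?thesis
    unfolding positive_op_def using bounded_clinear_sqrt_series[OF C contr] by blast
qed

text \<open>Polarization: that the form is real at x + y and at x + i y gives a sum identity and a
  difference identity, which together are the claim.\<close>

lemma positive_op_self_adjoint:
  assumes "positive_op B"
  shows "cinner (B x) y = cinner x (B y)"
proof -
  have B: "bounded_clinear B" and real: "\<And>x. cinner (B x) x = cnj (cinner (B x) x)"
    using assms unfolding positive_op_def
    by (simp_all only: complex_nonneg_Reals_iff complex_eq_iff cnj.simps) simp_all
  note simps = cinner_add_left cinner_add_right bounded_clinear_simps[OF B] cinner_scaleC_left
    cinner_scaleC_right
  have 1: "cinner (B x) y + cinner (B y) x = cinner y (B x) + cinner x (B y)"
    using real[of "x + y"] real[of x] real[of y] by (simp add: simps add.commute)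
  have "- \<i> * cinner (B x) y + \<i> * cinner (B y) x = \<i> * cinner y (B x) - \<i> * cinner x (B y)"
    using real[of "x + \<i> *\<^sub>C y"] real[of x] real[of y]
    by (simp add: simps distrib_left complex_i_mult_minus)
  then have "\<i> * (cinner (B y) x - cinner (B x) y) = \<i> * (cinner y (B x) - cinner x (B y))"
    by (simp add: algebra_simps)
  then have "cinner (B y) x - cinner (B x) y = cinner y (B x) - cinner x (B y)"
    by (simp only: mult_cancel_left) simp
  with 1 show ?thesis
    by (auto simp only: complex_eq_iff plus_complex.simps minus_complex.simps; linarith)
qed

text \<open>Along \<open>y - t B y\<close> the form of \<open>B\<close> is a nonnegative quadratic
  in \<open>t\<close> without constant term; its linear coefficient is a multiple of
  \<open>(norm (B y))\<^sup>2\<close>.\<close>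

lemma positive_op_eq_0:
  assumes "positive_op B" "cinner (B y) y = 0"
  shows "B y = 0"
proof -
  have B: "bounded_clinear B"
    using assms by (simp add: positive_op_def)
  note sa = positive_op_self_adjoint[OF assms(1)]
  define c where "c = Re (cinner (B (B y)) (B y))"
  have "0 \<le> t\<^sup>2 * c + t * (- 2 * (norm (B y))\<^sup>2)" for t :: real
  proof -
    let ?z = "y - t *\<^sub>R B y"
    have "cinner (B ?z) ?z = complex_of_real (t\<^sup>2) * cinner (B (B y)) (B y)
        - 2 * complex_of_real t * cinner (B y) (B y)"
      using assms(2)
      by (simp add: bounded_clinear_simps[OF B] cinner_diff_left cinner_diff_right
          cinner_scaleR_left cinner_scaleR_right sa[of "B y"] power2_eq_square algebra_simps)
    then have "Re (cinner (B ?z) ?z) = t\<^sup>2 * c + t * (- 2 * (norm (B y))\<^sup>2)"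
      by (simp add: c_def cinner_self flip: of_real_power)
    moreover have "Re (cinner (B ?z) ?z) \<ge> 0"
      using assms(1) by (simp add: positive_op_def complex_nonneg_Reals_iff)
    ultimately show ?thesis by simp
  qed
  then have "- 2 * (norm (B y))\<^sup>2 = 0"
    by (rule linear_coeff_eq_0)
  then show ?thesis by simp
qed

text \<open>Uniqueness of the positive root: a root \<open>B\<close> commutes with its square, hence
  with \<open>C\<close> and with the series S. For y = B x - S x this gives (B + S) y = 0, so both
  nonnegative forms vanish at y. Then B y = S y = 0, and y is orthogonal to itself.\<close>

lemma op_sqrt_eq_sqrt_series:
  assumes C: "bounded_clinear C" and contr: "\<And>x. norm (C x) \<le> norm x"
    and sym: "\<And>x y. cinner (C x) y = cinner x (C y)"
  shows "op_sqrt (\<lambda>x. x - C x) = sqrt_series C"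
  unfolding op_sqrt_def
proof (rule the_equality)
  let ?B = "sqrt_series C"
  show "positive_op ?B \<and> ?B \<circ> ?B = (\<lambda>x. x - C x)"
    using positive_op_sqrt_series[OF assms] sqrt_series_sqrt_series[OF C contr] by auto
  fix B assume B: "positive_op B \<and> B \<circ> B = (\<lambda>x. x - C x)"
  then have lin: "bounded_clinear B" and pos: "positive_op B" and sq: "\<And>x. B (B x) = x - C x"
    by (auto simp: positive_op_def fun_eq_iff)
  have "B (C x) = C (B x)" for x
  proof -
    have "B x - B (C x) = B x - C (B x)"
      using arg_cong[OF sq[of x], of B] sq[of "B x"] by (simp add: bounded_clinear_simps[OF lin])
    then show ?thesis by simp
  qed
  then have comm: "B (?B x) = ?B (B x)" for x
    by (intro sqrt_series_intertwine contr bounded_clinearD lin)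
  note lin' = bounded_clinear_sqrt_series[OF C contr]
  note pos' = positive_op_sqrt_series[OF assms]
  show "B = ?B"
  proof
    fix x
    define y where "y = B x - ?B x"
    have "B y + ?B y = 0"
      by (simp add: y_def bounded_clinear_simps[OF lin] bounded_clinear_simps[OF lin'] comm sq
          sqrt_series_sqrt_series[OF C contr])
    then have "cinner (B y) y + cinner (?B y) y = 0"
      using cinner_add_left[of "B y" "?B y" y] by simp
    moreover have "cinner (B y) y \<in> \<real>\<^sub>\<ge>\<^sub>0" "cinner (?B y) y \<in> \<real>\<^sub>\<ge>\<^sub>0"
      using pos pos' by (auto simp: positive_op_def)
    ultimately have "cinner (B y) y = 0" "cinner (?B y) y = 0"
      by (simp_all only: complex_nonneg_Reals_iff complex_eq_iff plus_complex.simps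
          zero_complex.simps) linarith+
    then have "B y = 0" and "?B y = 0"
      using positive_op_eq_0[OF pos] positive_op_eq_0[OF pos'] by simp_all
    have "cinner y y = cinner (B x) y - cinner (?B x) y"
      by (simp add: y_def cinner_diff_left)
    also have "\<dots> = 0"
      by (simp add: positive_op_self_adjoint[OF pos, of x y]
          positive_op_self_adjoint[OF pos', of x y] \<open>B y = 0\<close> \<open>?B y = 0\<close>)
    finally have "y = 0" by simp
    then show "B x = ?B x"
      by (simp add: y_def)
  qed
qed

section \<open>Square-summable families and tensor products\<close>

lemma bounded_clinear_coord: "bounded_clinear (\<lambda>x. coord x i)"
  by (rule bounded_clinearI[where K = 1]) (simp_all add: norm_coord_le)

lemmas bounded_linear_coord = bounded_clinearD[OF bounded_clinear_coord]

lemma coord_sum: "coord (\<Sum>j\<in>J. f j) i = (\<Sum>j\<in>J. coord (f j) i)"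
  by (rule linear_sum[OF bounded_linear.linear[OF bounded_linear_coord]])

lemma coord_zero_fun: "coord 0 = (\<lambda>_. 0)"
  by auto

lemma coord_Abs_l2: "sq_summable x \<Longrightarrow> coord (Abs_l2 x) = x"
  by (simp add: Abs_l2_inverse)

lemma sq_summableI:
  assumes "\<And>F. finite F \<Longrightarrow> (\<Sum>i\<in>F. (norm (x i))\<^sup>2) \<le> B"
  shows "sq_summable x"
  unfolding sq_summable_def
  by (rule nonneg_bdd_above_summable_on) (use assms in \<open>auto intro!: bdd_aboveI\<close>)

lemma has_sum_norm_sq: "((\<lambda>i. (norm (coord x i))\<^sup>2) has_sum (norm x)\<^sup>2) UNIV"
  using sq_summable_coord[of x] unfolding norm_l2_sq sq_summable_def by simp

lemma has_sum_cinner_l2: "((\<lambda>i. cinner (coord x i) (coord y i)) has_sum cinner x y) UNIV"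
  unfolding cinner_l2_def by (intro has_sum_infsum sq_summable_cinner) simp_all

lemma norm_sq_le_of_finite_sums:
  assumes "\<And>F. finite F \<Longrightarrow> (\<Sum>i\<in>F. (norm (coord x i))\<^sup>2) \<le> B"
  shows "(norm x)\<^sup>2 \<le> B"
  using has_sum_norm_sq by (rule has_sum_le_finite_sums) (use assms in auto)

lemma norm_l2_mono:
  assumes "\<And>i. norm (coord y i) \<le> K * norm (coord x i)" "K \<ge> 0"
  shows "norm y \<le> K * norm x"
proof -
  have "(norm y)\<^sup>2 \<le> (K * norm x)\<^sup>2"
  proof (rule norm_sq_le_of_finite_sums)
    fix F :: "'a set" assume "finite F"
    have "(\<Sum>i\<in>F. (norm (coord y i))\<^sup>2) \<le> (\<Sum>i\<in>F. K\<^sup>2 * (norm (coord x i))\<^sup>2)"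
      using assms by (intro sum_mono) (metis norm_ge_zero power_mono power_mult_distrib)
    also have "\<dots> \<le> (K * norm x)\<^sup>2"
      using sum_coord_le[OF \<open>finite F\<close>, of x]
      by (simp add: power_mult_distrib mult_left_mono flip: sum_distrib_left)
    finally show "(\<Sum>i\<in>F. (norm (coord y i))\<^sup>2) \<le> (K * norm x)\<^sup>2" .
  qed
  then show ?thesis
    using assms(2) by (simp add: power2_le_iff_abs_le)
qed

text \<open>When the index type consists of words, \<open>ket \<beta>\<close> is the coordinate
  vector of \<open>f\<^sub>\<beta>\<close>.\<close>

lift_definition ket :: "'i \<Rightarrow> ('i, complex) l2" is "\<lambda>i j. if j = i then 1 else 0"
proof (rule sq_summableI)
  fix i :: 'i and F :: "'i set" assume "finite F"
  then show "(\<Sum>j\<in>F. (norm (if j = i then 1 else 0 :: complex))\<^sup>2) \<le> 1"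
    by (simp add: if_distrib if_distribR cong: if_cong)
qed

lemma coord_ket: "coord (ket i) j = (if j = i then 1 else 0)"
  by (simp add: ket.rep_eq)

lemma coord_tensor: "coord (tensor x k) i = coord x i *\<^sub>C k"
  by (simp add: tensor.rep_eq)

lemma coord_tensor_ket: "coord (tensor (ket i) k) j = (if j = i then k else 0)"
  by (simp add: coord_tensor coord_ket)

lemma cinner_tensor: "cinner (tensor x k) (tensor y l) = cinner x y * cinner k l"
proof -
  have "((\<lambda>i. cinner (coord x i) (coord y i) * cinner k l) has_sum cinner x y * cinner k l) UNIV"
    by (intro has_sum_cmult_left has_sum_cinner_l2)
  moreover have "((\<lambda>i. cinner (coord x i) (coord y i) * cinner k l) has_sum
      cinner (tensor x k) (tensor y l)) UNIV"
    using has_sum_cinner_l2[of "tensor x k" "tensor y l"]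
    by (simp add: coord_tensor cinner_scaleC_left cinner_scaleC_right cinner_complex_def mult_ac)
  ultimately show ?thesis
    by (rule has_sum_unique[symmetric])
qed

lemma norm_tensor: "norm (tensor x k) = norm x * norm k"
proof -
  have "complex_of_real ((norm (tensor x k))\<^sup>2) = complex_of_real ((norm x * norm k)\<^sup>2)"
    by (simp only: cinner_self[symmetric] cinner_tensor)
      (simp add: cinner_self power_mult_distrib)
  then show ?thesis
    by (simp only: of_real_eq_iff) (simp add: power2_eq_iff_nonneg)
qed

lemma bounded_clinear_tensor_left: "bounded_clinear (\<lambda>x. tensor x k)"
  by (rule bounded_clinearI[where K = "norm k"])
    (auto intro!: l2_eqI simp: coord_tensor scaleC_add_left norm_tensor scaleC_scaleC
      scaleC_complex_def)

lemma bounded_clinear_tensor_right: "bounded_clinear (\<lambda>k. tensor x k)"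
  by (rule bounded_clinearI[where K = "norm x"])
    (auto intro!: l2_eqI simp: coord_tensor scaleC_add_right norm_tensor scaleC_scaleC mult.commute)

text \<open>The Cauchy criterion for unordered sums, with the bound applied to finite sets away from
  a large \<open>F0\<close>. It covers orthogonal families and, in \<open>tensor_op_exists\<close>,
  the images of one under a bounded operator.\<close>

lemma summable_on_sq_bound:
  fixes g :: "'i \<Rightarrow> 'b::chilbert_space" and x :: "'i \<Rightarrow> real"
  assumes x: "(x has_sum s) UNIV" "\<And>i. x i \<ge> 0" and K: "K \<ge> 0"
    and bound: "\<And>F. finite F \<Longrightarrow> (norm (\<Sum>i\<in>F. g i))\<^sup>2 \<le> K * (\<Sum>i\<in>F. x i)"
  shows "g summable_on UNIV" and "(norm (infsum g UNIV))\<^sup>2 \<le> K * s"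
proof -
  have "\<exists>P. eventually P (finite_subsets_at_top UNIV) \<and>
      (\<forall>F1 F2. P F1 \<longrightarrow> P F2 \<longrightarrow> dist (sum g F1) (sum g F2) < e)" if "e > 0" for e
  proof -
    \<comment> \<open>Chosen such that \<open>(K + 1) * d = (e / 2)\<^sup>2\<close>; adding 1 keeps
      the denominator positive for \<open>K = 0\<close>.\<close>
    define d where "d = e\<^sup>2 / (4 * (K + 1))"
    have d: "d > 0"
      using that K by (simp add: d_def)
    obtain F0 where F0: "finite F0" "dist (sum x F0) s \<le> d / 2"
      using has_sum_finite_approximation[OF x(1), of "d / 2"] d by auto
    have small: "norm (sum g F - sum g F0) < e / 2" if F: "finite F" "F0 \<subseteq> F" for F
    proof -
      have "sum x F \<le> s"
        by (rule finite_sum_le_has_sum[OF x(1) F(1)]) (use x in auto)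
      then have "sum x (F - F0) < d"
        using F0 F d by (simp add: sum_diff dist_real_def abs_if split: if_splits)
      have "(norm (sum g F - sum g F0))\<^sup>2 = (norm (sum g (F - F0)))\<^sup>2"
        using F F0 by (simp add: sum_diff)
      also have "\<dots> \<le> K * sum x (F - F0)"
        using F by (intro bound) simp
      also have "\<dots> \<le> K * d"
        using \<open>sum x (F - F0) < d\<close> K by (intro mult_left_mono) auto
      also have "\<dots> < (K + 1) * d"
        using d by simp
      also have "\<dots> = (e / 2)\<^sup>2"
        using K by (simp add: d_def power2_eq_square field_simps)
      finally show ?thesis
        by (rule power2_less_imp_less) (use \<open>e > 0\<close> in simp)
    qed
    show ?thesis
    proof (intro exI[of _ "\<lambda>F. finite F \<and> F0 \<subseteq> F"] conjI allI impI)
      show "eventually (\<lambda>F. finite F \<and> F0 \<subseteq> F) (finite_subsets_at_top UNIV)"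
        unfolding eventually_finite_subsets_at_top using F0 by auto
      fix F1 F2 assume "finite F1 \<and> F0 \<subseteq> F1" "finite F2 \<and> F0 \<subseteq> F2"
      then show "dist (sum g F1) (sum g F2) < e"
        using small[of F1] small[of F2] norm_triangle_ineq4[of "sum g F1 - sum g F0" "sum g F2 - sum g F0"]
        by (simp add: dist_norm)
    qed
  qed
  then have "cauchy_filter (filtermap (sum g) (finite_subsets_at_top UNIV))"
    unfolding cauchy_filter_metric_filtermap by meson
  moreover have "complete (UNIV::'b set)"
    by (rule complete_UNIV)
  ultimately obtain L where "(sum g \<longlongrightarrow> L) (finite_subsets_at_top UNIV)"
    using complete_uniform[where S=UNIV] by (force simp add: filterlim_def)
  then show summ: "g summable_on UNIV"
    using summable_on_def has_sum_def by blast
  have lim: "((\<lambda>F. (norm (sum g F))\<^sup>2) \<longlongrightarrow> (norm (infsum g UNIV))\<^sup>2) (finite_subsets_at_top UNIV)"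
    by (intro tendsto_intros infsum_tendsto summ)
  have lim': "((\<lambda>F. K * sum x F) \<longlongrightarrow> K * s) (finite_subsets_at_top UNIV)"
    using x(1) by (intro tendsto_mult_left) (simp add: has_sum_def)
  show "(norm (infsum g UNIV))\<^sup>2 \<le> K * s"
    by (rule tendsto_le[OF _ lim' lim]) (auto intro!: eventually_finite_subsets_at_top_weakI bound)
qed

lemma norm_sum_tensor_ket:
  assumes "finite F"
  shows "(norm (\<Sum>i\<in>F. tensor (ket i) (v i)))\<^sup>2 = (\<Sum>i\<in>F. (norm (v i))\<^sup>2)"
proof -
  have c: "coord (\<Sum>i\<in>F. tensor (ket i) (v i)) j = (if j \<in> F then v j else 0)" for j
    using assms by (simp add: coord_sum coord_tensor_ket)
  have "((\<lambda>j. (norm (if j \<in> F then v j else 0))\<^sup>2) has_sum (\<Sum>i\<in>F. (norm (v i))\<^sup>2)) UNIV"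
    by (rule has_sum_finite_neutralI[of F]) (use assms in auto)
  with has_sum_norm_sq[of "\<Sum>i\<in>F. tensor (ket i) (v i)", unfolded c] show ?thesis
    by (rule has_sum_unique)
qed

lemma has_sum_tensor_ket: "((\<lambda>i. tensor (ket i) (coord x i)) has_sum x) UNIV"
proof -
  let ?g = "\<lambda>i. tensor (ket i) (coord x i)"
  have "?g summable_on UNIV"
    by (rule summable_on_sq_bound(1)[OF has_sum_norm_sq[of x], where K = 1])
      (simp_all add: norm_sum_tensor_ket)
  then have hs: "(?g has_sum infsum ?g UNIV) UNIV"
    by (rule has_sum_infsum)
  have "infsum ?g UNIV = x"
  proof (rule l2_eqI)
    fix j
    have "((\<lambda>i. coord (?g i) j) has_sum coord (infsum ?g UNIV) j) UNIV"
      by (rule has_sum_bounded_linear[OF bounded_linear_coord hs])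
    moreover have "((\<lambda>i. coord (?g i) j) has_sum coord x j) UNIV"
      by (rule has_sum_finite_neutralI[of "{j}"]) (auto simp: coord_tensor_ket)
    ultimately show "coord (infsum ?g UNIV) j = coord x j"
      by (rule has_sum_unique)
  qed
  with hs show ?thesis by simp
qed

lemma bounded_linear_eq_on_tensor_ket:
  assumes "bounded_linear A" "bounded_linear B"
    and "\<And>i. A (tensor (ket i) (coord x i)) = B (tensor (ket i) (coord x i))"
  shows "A x = B x"
  using has_sum_bounded_linear[OF assms(1) has_sum_tensor_ket[of x]]
    has_sum_bounded_linear[OF assms(2) has_sum_tensor_ket[of x]] assms(3)
  by (simp add: has_sum_unique)

lemma tensor_op_eqI:
  fixes B :: "('i, 'k::chilbert_space) l2 \<Rightarrow> ('j, 'l::chilbert_space) l2"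
  assumes "bounded_clinear B" "\<And>x k. B (tensor x k) = tensor (A x) (C k)"
  shows "tensor_op A C = B"
  unfolding tensor_op_def
proof (rule the_equality)
  fix B' assume B': "bounded_clinear B' \<and> (\<forall>x k. B' (tensor x k) = tensor (A x) (C k))"
  show "B' = B"
  proof
    show "B' x = B x" for x
      by (rule bounded_linear_eq_on_tensor_ket)
        (use B' assms in \<open>auto intro: bounded_clinearD\<close>)
  qed
qed (use assms in blast)

lemma norm_sum_tensor:
  "complex_of_real ((norm (\<Sum>i\<in>F. tensor (u i) (v i)))\<^sup>2) =
    (\<Sum>i\<in>F. \<Sum>j\<in>F. cinner (u i) (u j) * cinner (v i) (v j))"
  unfolding cinner_self[symmetric] cinner_sum_left by (simp only: cinner_sum_right cinner_tensor)

text \<open>The squares of the two sides differ by the square of the norm of the sum for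
  \<open>(I - A\<^sup>* A)\<^sup>1\<^sup>/\<^sup>2\<close> in place of \<open>A\<close>.\<close>

lemma norm_sum_tensor_contraction:
  assumes A: "bounded_clinear A" and contr: "\<And>x. norm (A x) \<le> norm x"
  shows "norm (\<Sum>i\<in>F. tensor (A (ket i)) (v i)) \<le> norm (\<Sum>i\<in>F. tensor (ket i) (v i))"
proof -
  define C where "C x = cadjoint A (A x)" for x
  note adj = cinner_cadjoint_left[OF A] cinner_cadjoint_right[OF A]
  have C: "bounded_clinear C"
    unfolding C_def[abs_def] by (rule bounded_clinear_compose[OF bounded_clinear_cadjoint[OF A] A])
  have C_le: "norm (C x) \<le> norm x" for x
    unfolding C_def using norm_cadjoint_le[OF A, of 1 "A x"] contr order_trans by fastforce
  have sym: "cinner (C x) y = cinner x (C y)" for x y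
    by (simp add: C_def adj)
  define S where "S = sqrt_series C"
  have S: "cinner (S x) (S y) = cinner x y - cinner (A x) (A y)" for x y
    unfolding S_def positive_op_self_adjoint[OF positive_op_sqrt_series[OF C C_le sym]]
    by (simp add: sqrt_series_sqrt_series[OF C C_le] cinner_diff_right C_def adj)
  have "complex_of_real ((norm (\<Sum>i\<in>F. tensor (ket i) (v i)))\<^sup>2) =
      complex_of_real ((norm (\<Sum>i\<in>F. tensor (A (ket i)) (v i)))\<^sup>2 +
        (norm (\<Sum>i\<in>F. tensor (S (ket i)) (v i)))\<^sup>2)"
    by (simp only: of_real_add norm_sum_tensor S left_diff_distrib sum_subtractf) simp
  then show ?thesis
    unfolding of_real_eq_iff by - (rule power2_le_imp_le, simp_all)
qed

text \<open>The vectors \<open>A (ket i)\<close> need not be orthogonal, so the series of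
  \<open>A (ket i) \<otimes> x\<^sub>i\<close> cannot be estimated term by term. Its finite sums are
  controlled by \<open>norm_sum_tensor_contraction\<close> for the contraction
  \<open>A / K\<close>.\<close>

lemma tensor_op_exists:
  fixes A :: "('i, complex) l2 \<Rightarrow> ('j, complex) l2"
  assumes A: "bounded_clinear A"
  shows "\<exists>B :: ('i, 'k::chilbert_space) l2 \<Rightarrow> ('j, 'k) l2.
    bounded_clinear B \<and> (\<forall>x k. B (tensor x k) = tensor (A x) k)"
proof -
  obtain K where K: "K > 0" "\<And>x. norm (A x) \<le> norm x * K"
    using bounded_linear.pos_bounded[OF bounded_clinearD[OF A]] by blast
  define g where "g x i = tensor (A (ket i)) (coord x i)" for x :: "('i, 'k) l2" and i
  have bound: "(norm (\<Sum>i\<in>F. g x i))\<^sup>2 \<le> K\<^sup>2 * (\<Sum>i\<in>F. (norm (coord x i))\<^sup>2)" if F: "finite F" for F x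
  proof -
    have "norm (\<Sum>i\<in>F. tensor ((1 / K) *\<^sub>R A (ket i)) (coord x i)) \<le>
        norm (\<Sum>i\<in>F. tensor (ket i) (coord x i))"
      by (rule norm_sum_tensor_contraction[OF bounded_clinear_scaleR_op[OF A]])
        (use K in \<open>simp add: field_simps\<close>)
    moreover have "(\<Sum>i\<in>F. g x i) = K *\<^sub>R (\<Sum>i\<in>F. tensor ((1 / K) *\<^sub>R A (ket i)) (coord x i))"
      using K(1) by (simp add: g_def bounded_clinear_simps[OF bounded_clinear_tensor_left]
          flip: scaleR_sum_right)
    ultimately have "(norm (\<Sum>i\<in>F. g x i))\<^sup>2 \<le> (K * norm (\<Sum>i\<in>F. tensor (ket i) (coord x i)))\<^sup>2"
      using K(1) by (intro power_mono) simp_all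
    then show ?thesis
      by (simp only: power_mult_distrib norm_sum_tensor_ket[OF F])
  qed
  have summ: "g x summable_on UNIV"
    and nrm: "(norm (infsum (g x) UNIV))\<^sup>2 \<le> K\<^sup>2 * (norm x)\<^sup>2" for x
    using summable_on_sq_bound[OF has_sum_norm_sq[of x], where K = "K\<^sup>2" and g = "g x"] bound
    by auto
  define B where "B x = infsum (g x) UNIV" for x
  have hs: "(g x has_sum B x) UNIV" for x
    unfolding B_def by (rule has_sum_infsum[OF summ])
  have "bounded_clinear B"
  proof (rule bounded_clinearI[where K = K])
    note r = bounded_clinear_simps[OF bounded_clinear_tensor_right]
    show "B (x + y) = B x + B y" for x y
      by (rule has_sum_unique[OF hs[of "x + y"]])
        (use has_sum_add[OF hs[of x] hs[of y]] in \<open>simp add: g_def[abs_def] r\<close>)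
    show "B (c *\<^sub>C x) = c *\<^sub>C B x" for c x
      by (rule has_sum_unique[OF hs[of "c *\<^sub>C x"]])
        (use has_sum_bounded_linear[OF bounded_linear_scaleC hs[of x], of c]
          in \<open>simp add: g_def[abs_def] r\<close>)
    show "norm (B x) \<le> K * norm x" for x
      using nrm[of x] K(1) unfolding B_def power_mult_distrib[symmetric]
      by (simp add: power2_le_iff_abs_le)
  qed
  moreover have "B (tensor x k) = tensor (A x) k" for x k
  proof -
    have "bounded_linear (\<lambda>x. tensor (A x) k)"
      by (rule bounded_linear_compose[OF bounded_clinearD[OF bounded_clinear_tensor_left]
            bounded_clinearD[OF A]])
    then have "((\<lambda>i. tensor (A (tensor (ket i) (coord x i))) k) has_sum tensor (A x) k) UNIV"
      by (rule has_sum_bounded_linear[OF _ has_sum_tensor_ket])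
    moreover have "tensor (A (tensor (ket i) (coord x i))) k = g (tensor x k) i" for i
    proof -
      have "tensor (ket i) (coord x i) = coord x i *\<^sub>C ket i"
        by (rule l2_eqI) (simp add: coord_tensor scaleC_complex_def mult.commute)
      then show ?thesis
        by (intro l2_eqI) (simp add: g_def coord_tensor bounded_clinear_simps[OF A] scaleC_scaleC
            scaleC_complex_def mult.commute)
    qed
    ultimately have "(g (tensor x k) has_sum tensor (A x) k) UNIV"
      by simp
    with hs[of "tensor x k"] show ?thesis
      by (rule has_sum_unique)
  qed
  ultimately show ?thesis by blast
qed

lemma
  fixes A :: "('i, complex) l2 \<Rightarrow> ('j, complex) l2"
  assumes "bounded_clinear A"
  shows bounded_clinear_tensor_op_id:
      "bounded_clinear (tensor_op A id :: ('i, 'k::chilbert_space) l2 \<Rightarrow> ('j, 'k) l2)"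
    and tensor_op_id_tensor: "tensor_op A id (tensor x (k::'k)) = tensor (A x) k"
proof -
  obtain B :: "('i, 'k) l2 \<Rightarrow> ('j, 'k) l2"
    where B: "bounded_clinear B" "\<And>x k. B (tensor x k) = tensor (A x) k"
    using tensor_op_exists[OF assms] by blast
  then have "tensor_op A id = B"
    by (intro tensor_op_eqI) auto
  with B show "bounded_clinear (tensor_op A id :: ('i, 'k::chilbert_space) l2 \<Rightarrow> ('j, 'k) l2)"
    "tensor_op A id (tensor x (k::'k)) = tensor (A x) k"
    by auto
qed

section \<open>Coordinate forms of \<open>I \<otimes> C\<close> (\<open>l2_map\<close>),
  \<open>\<Lambda>\<^sub>i \<otimes> I\<close> (\<open>right_shift\<close>) and the backward shifts
  (\<open>pull_Cons\<close>)\<close>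

definition l2_map :: "('k::chilbert_space \<Rightarrow> 'l::chilbert_space) \<Rightarrow> ('i, 'k) l2 \<Rightarrow> ('i, 'l) l2"
  where "l2_map C x = Abs_l2 (\<lambda>i. C (coord x i))"

lemma coord_l2_map:
  assumes "bounded_linear C"
  shows "coord (l2_map C x) i = C (coord x i)"
proof -
  obtain K where "\<And>x. norm (C x) \<le> norm x * K"
    using bounded_linear.bounded[OF assms] by blast
  then have "sq_summable (\<lambda>i. C (coord x i))"
    by (intro sq_summable_bound[OF sq_summable_coord[of x], where C = K]) (simp add: mult.commute)
  then show ?thesis
    by (simp add: l2_map_def coord_Abs_l2)
qed

lemma bounded_clinear_l2_map:
  assumes "bounded_clinear C"
  shows "bounded_clinear (l2_map C)"
proof -
  note C = bounded_clinearD[OF assms]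
  obtain K where "K \<ge> 0" "\<And>x. norm (C x) \<le> norm x * K"
    using bounded_linear.nonneg_bounded[OF C] by blast
  then show ?thesis
    by (intro bounded_clinearI[where K = K] norm_l2_mono l2_eqI)
      (simp_all add: coord_l2_map[OF C] bounded_clinear_simps[OF assms] mult.commute)
qed

lemma l2_map_tensor:
  assumes "bounded_clinear C"
  shows "l2_map C (tensor x k) = tensor x (C k)"
  by (rule l2_eqI)
    (simp add: coord_l2_map[OF bounded_clinearD[OF assms]] coord_tensor
      bounded_clinear_scaleC[OF assms])

lemma tensor_op_id_left:
  assumes "bounded_clinear C"
  shows "tensor_op id C = l2_map C"
  by (rule tensor_op_eqI) (simp_all add: bounded_clinear_l2_map assms l2_map_tensor)

definition right_shift :: "'n \<Rightarrow> ('n list, 'k::chilbert_space) l2 \<Rightarrow> ('n list, 'k) l2"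
  where "right_shift i x =
    Abs_l2 (\<lambda>\<beta>. if \<beta> \<noteq> [] \<and> last \<beta> = i then coord x (butlast \<beta>) else 0)"

lemma
  shows coord_right_shift: "coord (right_shift i x) \<beta> =
      (if \<beta> \<noteq> [] \<and> last \<beta> = i then coord x (butlast \<beta>) else 0)"
    and norm_right_shift_le: "norm (right_shift i x) \<le> norm x"
proof -
  let ?y = "\<lambda>\<beta>. if \<beta> \<noteq> [] \<and> last \<beta> = i then coord x (butlast \<beta>) else 0"
  have fin: "(\<Sum>\<beta>\<in>F. (norm (?y \<beta>))\<^sup>2) \<le> (norm x)\<^sup>2" if F: "finite F" for F
  proof -
    let ?G = "{\<beta> \<in> F. \<beta> \<noteq> [] \<and> last \<beta> = i}"
    have "(\<Sum>\<beta>\<in>F. (norm (?y \<beta>))\<^sup>2) = (\<Sum>\<beta>\<in>?G. (norm (coord x (butlast \<beta>)))\<^sup>2)"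
      using F by (intro sum.mono_neutral_cong_right) auto
    also have "\<dots> = (\<Sum>\<alpha>\<in>butlast ` ?G. (norm (coord x \<alpha>))\<^sup>2)"
    proof (rule sum.reindex_cong[symmetric])
      show "inj_on butlast ?G"
        by (intro inj_onI) (metis (mono_tags, lifting) append_butlast_last_id mem_Collect_eq)
    qed auto
    also have "\<dots> \<le> (norm x)\<^sup>2"
      using F by (intro sum_coord_le) auto
    finally show ?thesis .
  qed
  have sq: "sq_summable ?y"
    using fin by (rule sq_summableI)
  then show c: "coord (right_shift i x) \<beta> = ?y \<beta>" for \<beta>
    by (simp add: right_shift_def coord_Abs_l2)
  have "(norm (right_shift i x))\<^sup>2 \<le> (norm x)\<^sup>2"
    by (rule norm_sq_le_of_finite_sums) (simp only: c fin)
  then show "norm (right_shift i x) \<le> norm x"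
    by (simp add: power2_le_iff_abs_le)
qed

lemma bounded_clinear_right_shift: "bounded_clinear (right_shift i)"
  by (rule bounded_clinearI[where K = 1])
    (auto intro!: l2_eqI simp: coord_right_shift norm_right_shift_le)

lemma tensor_op_right_mult:
  assumes "bounded_clinear C"
  shows "tensor_op (\<lambda>u. r *\<^sub>R right_mult i u) C = (\<lambda>x. r *\<^sub>R right_shift i (l2_map C x))"
proof (rule tensor_op_eqI)
  show "bounded_clinear (\<lambda>x. r *\<^sub>R right_shift i (l2_map C x))"
    by (intro bounded_clinear_scaleR_op bounded_clinear_compose[OF bounded_clinear_right_shift]
        bounded_clinear_l2_map assms)
  show "r *\<^sub>R right_shift i (l2_map C (tensor x k)) = tensor (r *\<^sub>R right_mult i x) (C k)" for x k
    by (rule l2_eqI)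
      (simp add: l2_map_tensor[OF assms] coord_right_shift coord_tensor right_mult.rep_eq
        scaleR_scaleC scaleC_scaleC scaleC_complex_def)
qed

text \<open>The backward shift: adjoint of the isometry that sends
  \<open>f\<^sub>\<alpha> \<otimes> k\<close> to \<open>f\<^sub>\<beta> \<otimes> k\<close> for
  \<open>\<beta> = i # \<alpha>\<close>.\<close>

definition pull_Cons :: "'n \<Rightarrow> ('n list, 'k::chilbert_space) l2 \<Rightarrow> ('n list, 'k) l2"
  where "pull_Cons i x = Abs_l2 (\<lambda>\<alpha>. coord x (i # \<alpha>))"

lemma coord_pull_Cons:
  fixes x :: "('n list, 'k::chilbert_space) l2"
  shows "coord (pull_Cons i x) \<alpha> = coord x (i # \<alpha>)"
proof -
  have "sq_summable (\<lambda>\<alpha>. coord x (i # \<alpha>))"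
  proof (rule sq_summableI)
    fix F :: "'n list set" assume "finite F"
    have "(\<Sum>\<alpha>\<in>F. (norm (coord x (i # \<alpha>)))\<^sup>2) = (\<Sum>\<beta>\<in>(#) i ` F. (norm (coord x \<beta>))\<^sup>2)"
      by (subst sum.reindex) (auto simp: o_def)
    also have "\<dots> \<le> (norm x)\<^sup>2"
      using \<open>finite F\<close> by (intro sum_coord_le) auto
    finally show "(\<Sum>\<alpha>\<in>F. (norm (coord x (i # \<alpha>)))\<^sup>2) \<le> (norm x)\<^sup>2" .
  qed
  then show ?thesis
    by (simp add: pull_Cons_def coord_Abs_l2)
qed

text \<open>A word is empty or begins with exactly one letter.\<close>

lemma cinner_pull_Cons:
  fixes x y :: "('n::finite list, 'k::chilbert_space) l2"
  shows "cinner x y = cinner (coord x []) (coord y []) +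
    (\<Sum>i\<in>UNIV. cinner (pull_Cons i x) (pull_Cons i y))"
proof -
  let ?f = "\<lambda>\<alpha>. cinner (coord x \<alpha>) (coord y \<alpha>)"
  have "(?f has_sum cinner (pull_Cons i x) (pull_Cons i y)) (range ((#) i))" for i
    by (subst has_sum_reindex)
      (use has_sum_cinner_l2[of "pull_Cons i x" "pull_Cons i y"] in \<open>auto simp: o_def coord_pull_Cons\<close>)
  then have "(?f has_sum (\<Sum>i\<in>UNIV. cinner (pull_Cons i x) (pull_Cons i y))) (\<Union>i. range ((#) i))"
    by (intro sum_has_sum) auto
  moreover have "(?f has_sum ?f []) {[]}"
    by (simp add: has_sum_finiteI)
  ultimately have "(?f has_sum (?f [] + (\<Sum>i\<in>UNIV. cinner (pull_Cons i x) (pull_Cons i y))))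
      ({[]} \<union> (\<Union>i. range ((#) i)))"
    by (intro has_sum_Un_disjoint) auto
  moreover have "\<alpha> \<in> {[]} \<union> (\<Union>i. range ((#) i))" for \<alpha> :: "'n list"
    by (cases \<alpha>) auto
  then have "{[]} \<union> (\<Union>i. range ((#) i)) = (UNIV :: 'n list set)"
    by blast
  ultimately have "(?f has_sum (?f [] + (\<Sum>i\<in>UNIV. cinner (pull_Cons i x) (pull_Cons i y)))) UNIV"
    by (simp only:)
  with has_sum_cinner_l2 show ?thesis
    by (rule has_sum_unique)
qed

lemma norm_pull_Cons:
  fixes x :: "('n::finite list, 'k::chilbert_space) l2"
  shows "(norm x)\<^sup>2 = (norm (coord x []))\<^sup>2 + (\<Sum>i\<in>UNIV. (norm (pull_Cons i x))\<^sup>2)"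
  using cinner_pull_Cons[of x x] unfolding cinner_self
  by (simp only: of_real_add[symmetric] of_real_sum[symmetric] of_real_eq_iff)

section \<open>The transfer function of a row contraction\<close>

text \<open>Uniform contractivity carries convergence from elementary tensors to finite sums and
  then, as these are dense, to all of the space.\<close>

lemma strong_limit_l2:
  assumes A: "\<forall>\<^sub>F r in \<F>. bounded_linear (A r) \<and> (\<forall>x. norm (A r x) \<le> norm x)"
    and B: "bounded_linear B" "\<And>x. norm (B x) \<le> norm x"
    and lim: "\<And>i v. ((\<lambda>r. A r (tensor (ket i) v)) \<longlongrightarrow> B (tensor (ket i) v)) \<F>"
  shows "((\<lambda>r. A r x) \<longlongrightarrow> B x) \<F>"
proof (rule tendstoI)
  fix e :: real assume e: "e > 0"
  obtain F where F: "finite F" "dist (\<Sum>i\<in>F. tensor (ket i) (coord x i)) x \<le> e / 4"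
    using has_sum_finite_approximation[OF has_sum_tensor_ket[of x], of "e / 4"] e by auto
  define s where "s = (\<Sum>i\<in>F. tensor (ket i) (coord x i))"
  have "((\<lambda>r. \<Sum>i\<in>F. A r (tensor (ket i) (coord x i))) \<longlongrightarrow> B s) \<F>"
    unfolding s_def linear_sum[OF bounded_linear.linear[OF B(1)]] by (intro tendsto_sum lim)
  then have "\<forall>\<^sub>F r in \<F>. dist (\<Sum>i\<in>F. A r (tensor (ket i) (coord x i))) (B s) < e / 4"
    using e by (intro tendstoD) auto
  with A show "\<forall>\<^sub>F r in \<F>. dist (A r x) (B x) < e"
  proof eventually_elim
    case (elim r)
    then have lin: "linear (A r)" and le: "norm (A r (x - s)) \<le> norm (x - s)"
      by (auto intro: bounded_linear.linear)
    have "norm (A r s - B s) < e / 4"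
      using elim(2) by (simp add: s_def linear_sum[OF lin] dist_norm)
    moreover have "norm (x - s) \<le> e / 4"
      using F(2) by (simp add: s_def dist_norm norm_minus_commute)
    moreover have "norm (B (x - s)) \<le> norm (x - s)"
      by (rule B(2))
    moreover have "A r x - B x = A r (x - s) + (A r s - B s) - B (x - s)"
      by (simp add: linear_diff[OF lin] linear_diff[OF bounded_linear.linear[OF B(1)]])
    moreover have "norm (A r (x - s) + (A r s - B s) - B (x - s)) \<le>
        norm (A r (x - s)) + norm (A r s - B s) + norm (B (x - s))"
      by (meson add_mono norm_triangle_ineq norm_triangle_ineq4 order_refl order_trans)
    ultimately show ?case
      using le e by (simp add: dist_norm)
  qed
qed

section \<open>Sums over words of bounded length\<close>

lemma finite_words: "finite {\<alpha> :: 'n::finite list. length \<alpha> = N}"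
  using finite_lists_length_eq[of "UNIV :: 'n set" N] by simp

lemma finite_words_le: "finite {\<alpha> :: 'n::finite list. length \<alpha> \<le> N}"
  using finite_lists_length_le[of "UNIV :: 'n set" N] by simp

lemma sum_words_le_Suc:
  "(\<Sum>\<alpha> | length \<alpha> \<le> Suc N. f \<alpha>) =
    (\<Sum>\<alpha> | length \<alpha> \<le> N. f \<alpha>) + (\<Sum>\<alpha> :: 'n::finite list | length \<alpha> = Suc N. f \<alpha>)"
proof -
  have "{\<alpha> :: 'n list. length \<alpha> \<le> Suc N} = {\<alpha>. length \<alpha> \<le> N} \<union> {\<alpha>. length \<alpha> = Suc N}"
    by auto
  then show ?thesis
    by (simp add: sum.union_disjoint finite_words finite_words_le disjoint_iff)
qed

text \<open>Splits off the last letter, the direction in which \<open>state\<close> grows;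
  \<open>sum_words_Cons\<close> below splits off the first one, as needed for \<open>word_op\<close>
  and \<open>pull\<close>.\<close>

lemma sum_words_snoc:
  "(\<Sum>\<alpha> | length \<alpha> \<le> Suc N. f \<alpha>) =
    f [] + (\<Sum>\<beta> :: 'n::finite list | length \<beta> \<le> N. \<Sum>i\<in>UNIV. f (\<beta> @ [i]))"
proof -
  have "(\<Sum>\<beta> :: 'n list | length \<beta> \<le> N. \<Sum>i\<in>UNIV. f (\<beta> @ [i])) =
      (\<Sum>p\<in>{\<beta>. length \<beta> \<le> N} \<times> UNIV. f (fst p @ [snd p]))"
    by (simp only: sum.cartesian_product split_def)
  also have "\<dots> = (\<Sum>\<alpha>\<in>{\<alpha>. length \<alpha> \<le> Suc N} - {[]}. f \<alpha>)"
    by (rule sum.reindex_bij_witness[of _ "\<lambda>\<alpha>. (butlast \<alpha>, last \<alpha>)" "\<lambda>p. fst p @ [snd p]"]) auto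
  finally show ?thesis
    by (simp add: sum.remove[of _ "[]"] finite_words_le)
qed

lemma sum_words_Cons:
  "(\<Sum>\<alpha> :: 'n::finite list | length \<alpha> = Suc N. f \<alpha>) =
    (\<Sum>i\<in>UNIV. \<Sum>\<beta> | length \<beta> = N. f (i # \<beta>))"
proof -
  have "(\<Sum>i\<in>UNIV. \<Sum>\<beta> :: 'n list | length \<beta> = N. f (i # \<beta>)) =
      (\<Sum>p\<in>UNIV \<times> {\<beta>. length \<beta> = N}. f (fst p # snd p))"
    by (simp only: sum.cartesian_product split_def)
  also have "\<dots> = (\<Sum>\<alpha> | length \<alpha> = Suc N. f \<alpha>)"
  proof (rule sum.reindex_bij_witness[of _ "\<lambda>\<alpha>. (hd \<alpha>, tl \<alpha>)" "\<lambda>p. fst p # snd p"])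
    fix \<alpha> :: "'n list" assume "\<alpha> \<in> {\<alpha>. length \<alpha> = Suc N}"
    then show "fst (hd \<alpha>, tl \<alpha>) # snd (hd \<alpha>, tl \<alpha>) = \<alpha>"
      "(hd \<alpha>, tl \<alpha>) \<in> UNIV \<times> {\<beta>. length \<beta> = N}"
      by (cases \<alpha>; simp)+
  qed auto
  finally show ?thesis by simp
qed

text \<open>Turns unordered sums over words into limits of the partial sums up to length
  \<open>N\<close>, the form in which the energy balance is available.\<close>

lemma filterlim_words_le:
  "filterlim (\<lambda>N. {\<alpha> :: 'n::finite list. length \<alpha> \<le> N}) (finite_subsets_at_top UNIV) sequentially"
  unfolding filterlim_finite_subsets_at_top
proof (intro allI impI)
  fix X :: "'n list set" assume "finite X \<and> X \<subseteq> UNIV"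
  then have "length \<alpha> \<le> Max (length ` X)" if "\<alpha> \<in> X" for \<alpha>
    using that by simp
  then have "X \<subseteq> {\<alpha>. length \<alpha> \<le> N}" if "N \<ge> Max (length ` X)" for N
    using that order_trans by blast
  then show "\<forall>\<^sub>F N in sequentially. finite {\<alpha> :: 'n list. length \<alpha> \<le> N} \<and>
      X \<subseteq> {\<alpha>. length \<alpha> \<le> N} \<and> {\<alpha> :: 'n list. length \<alpha> \<le> N} \<subseteq> UNIV"
    unfolding eventually_sequentially using finite_words_le by (intro exI[of _ "Max (length ` X)"]) auto
qed

lemma has_sum_words_tendsto:
  fixes f :: "'n::finite list \<Rightarrow> 'b::{comm_monoid_add, topological_space}"
  assumes "(f has_sum S) UNIV"
  shows "(\<lambda>N. \<Sum>\<alpha> | length \<alpha> \<le> N. f \<alpha>) \<longlonglongrightarrow> S"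
  using filterlim_compose[OF assms[unfolded has_sum_def] filterlim_words_le] .

lemma
  fixes x :: "'n::finite list \<Rightarrow> 'a::chilbert_space"
  assumes "\<And>N. (\<Sum>\<alpha> | length \<alpha> \<le> N. (norm (x \<alpha>))\<^sup>2) \<le> B"
  shows sq_summable_words: "sq_summable x"
    and norm_Abs_l2_words: "(norm (Abs_l2 x))\<^sup>2 \<le> B"
proof -
  have fin: "(\<Sum>\<alpha>\<in>F. (norm (x \<alpha>))\<^sup>2) \<le> B" if "finite F" for F
  proof -
    have "F \<subseteq> {\<alpha>. length \<alpha> \<le> Max (length ` F)}"
      using that by auto
    then have "(\<Sum>\<alpha>\<in>F. (norm (x \<alpha>))\<^sup>2) \<le> (\<Sum>\<alpha> | length \<alpha> \<le> Max (length ` F). (norm (x \<alpha>))\<^sup>2)"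
      by (intro sum_mono2 finite_words_le) auto
    also have "\<dots> \<le> B" by (rule assms)
    finally show ?thesis .
  qed
  then show sq: "sq_summable x"
    by (rule sq_summableI)
  show "(norm (Abs_l2 x))\<^sup>2 \<le> B"
    by (rule norm_sq_le_of_finite_sums) (simp add: coord_Abs_l2[OF sq] fin)
qed

section \<open>The colligation of a row contraction\<close>

definition row_adj :: "('n::finite \<Rightarrow> 'h \<Rightarrow> 'h::chilbert_space) \<Rightarrow> 'h \<Rightarrow> 'h ^ 'n"
  where "row_adj Y h = (\<chi> i. cadjoint (Y i) h)"

text \<open>This and \<open>row_defect_star\<close> are the two defect operators for an arbitrary
  tuple, so that the colligation can be studied without \<open>f\<close> and
  \<open>T\<close>.\<close>

definition row_defect :: "('n::finite \<Rightarrow> 'h \<Rightarrow> 'h::chilbert_space) \<Rightarrow> 'h \<Rightarrow> 'h"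
  where "row_defect Y = op_sqrt (\<lambda>h. h - (\<Sum>i\<in>UNIV. Y i (cadjoint (Y i) h)))"

definition row_defect_star :: "('n::finite \<Rightarrow> 'h \<Rightarrow> 'h::chilbert_space) \<Rightarrow> 'h ^ 'n \<Rightarrow> 'h ^ 'n"
  where "row_defect_star Y = op_sqrt (\<lambda>v. v - cadjoint (row_op Y) (row_op Y v))"

text \<open>The linear system whose transition is the unitary colligation
  \<open>(z, x) \<mapsto> (Y\<^sup>* z + \<Delta>\<^sub>* x, \<Delta> z - Y x)\<close>, with initial state \<open>h\<close> and input \<open>x\<close>; its output for
  \<open>h = 0\<close> is \<open>\<Theta> x\<close> with \<open>\<Lambda>\<^sub>i\<close> replaced by \<open>r \<Lambda>\<^sub>i\<close>. As \<open>\<Lambda>\<^sub>i\<close> appends a letter at the end, the recursion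
  runs over reversed words.\<close>

primrec rev_state ::
  "('n::finite \<Rightarrow> 'h \<Rightarrow> 'h::chilbert_space) \<Rightarrow> real \<Rightarrow> 'h \<Rightarrow> ('n list \<Rightarrow> 'h ^ 'n) \<Rightarrow> 'n list \<Rightarrow> 'h"
  where
    "rev_state Y r h x [] = h"
  | "rev_state Y r h x (i # \<rho>) =
      r *\<^sub>R ((row_adj Y (rev_state Y r h x \<rho>) + row_defect_star Y (x (rev \<rho>))) $ i)"

definition state ::
  "('n::finite \<Rightarrow> 'h \<Rightarrow> 'h::chilbert_space) \<Rightarrow> real \<Rightarrow> 'h \<Rightarrow> ('n list \<Rightarrow> 'h ^ 'n) \<Rightarrow> 'n list \<Rightarrow> 'h"
  where "state Y r h x \<beta> = rev_state Y r h x (rev \<beta>)"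

definition response ::
  "('n::finite \<Rightarrow> 'h \<Rightarrow> 'h::chilbert_space) \<Rightarrow> real \<Rightarrow> 'h \<Rightarrow> ('n list \<Rightarrow> 'h ^ 'n) \<Rightarrow> 'n list \<Rightarrow> 'h"
  where "response Y r h x \<beta> = row_defect Y (state Y r h x \<beta>) - row_op Y (x \<beta>)"

lemma state_Nil [simp]: "state Y r h x [] = h"
  by (simp add: state_def)

lemma state_snoc [simp]:
  "state Y r h x (\<beta> @ [i]) =
    r *\<^sub>R ((row_adj Y (state Y r h x \<beta>) + row_defect_star Y (x \<beta>)) $ i)"
  by (simp add: state_def)

definition transfer ::
  "('n::finite \<Rightarrow> 'h \<Rightarrow> 'h::chilbert_space) \<Rightarrow> real \<Rightarrow> ('n list, 'h ^ 'n) l2 \<Rightarrow> ('n list, 'h) l2"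
  where "transfer Y r x = Abs_l2 (response Y r 0 (coord x))"

definition poisson ::
  "('n::finite \<Rightarrow> 'h \<Rightarrow> 'h::chilbert_space) \<Rightarrow> 'h \<Rightarrow> ('n list, 'h) l2"
  where "poisson Y h = Abs_l2 (response Y 1 h (\<lambda>_. 0))"

locale row_contraction =
  fixes Y :: "'n::finite \<Rightarrow> 'h \<Rightarrow> 'h::chilbert_space"
  assumes bounded: "bounded_clinear (Y i)"
    and contraction: "norm (row_op Y v) \<le> norm v"
begin

lemma bounded_row_op: "bounded_clinear (row_op Y)"
  unfolding row_op_def[abs_def]
  by (rule bounded_clinear_sum, rule bounded_clinear_compose[OF bounded bounded_clinear_nth])

lemma bounded_row_adj: "bounded_clinear (row_adj Y)"
  unfolding row_adj_def[abs_def]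
  by (rule bounded_clinear_vec, rule bounded_clinear_cadjoint, rule bounded)

lemma row_op_cinner: "cinner (row_op Y v) h = cinner v (row_adj Y h)"
  by (simp add: row_op_def row_adj_def cinner_vec_def cinner_sum_left
      cinner_cadjoint_right[OF bounded])

lemma row_adj_cinner: "cinner (row_adj Y h) v = cinner h (row_op Y v)"
  using arg_cong[OF row_op_cinner[of v h], of cnj] by simp

lemma cadjoint_row_op: "cadjoint (row_op Y) = row_adj Y"
  by (rule cadjoint_eqI) (simp_all add: bounded_row_adj row_op_cinner)

lemma norm_row_adj: "norm (row_adj Y h) \<le> norm h"
  using norm_cadjoint_le[OF bounded_row_op, of 1 h] contraction by (simp add: cadjoint_row_op)

lemma defect_eq_series: "row_defect Y = sqrt_series (\<lambda>h. row_op Y (row_adj Y h))"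
proof -
  have "(\<Sum>i\<in>UNIV. Y i (cadjoint (Y i) h)) = row_op Y (row_adj Y h)" for h
    by (simp add: row_op_def row_adj_def)
  then show ?thesis
    unfolding row_defect_def
    by (simp, intro op_sqrt_eq_sqrt_series bounded_clinear_compose[OF bounded_row_op bounded_row_adj])
      (auto intro: order_trans[OF contraction norm_row_adj] simp: row_op_cinner row_adj_cinner)
qed

lemma defect_star_eq_series: "row_defect_star Y = sqrt_series (\<lambda>v. row_adj Y (row_op Y v))"
  unfolding row_defect_star_def cadjoint_row_op
  by (intro op_sqrt_eq_sqrt_series bounded_clinear_compose[OF bounded_row_adj bounded_row_op])
    (auto intro: order_trans[OF norm_row_adj contraction] simp: row_op_cinner row_adj_cinner)

lemma contraction_RRs: "norm (row_op Y (row_adj Y h)) \<le> norm h"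
  by (rule order_trans[OF contraction norm_row_adj])

lemma contraction_RsR: "norm (row_adj Y (row_op Y v)) \<le> norm v"
  by (rule order_trans[OF norm_row_adj contraction])

lemma bounded_defect: "bounded_clinear (row_defect Y)"
  unfolding defect_eq_series
  by (rule bounded_clinear_sqrt_series[OF bounded_clinear_compose[OF bounded_row_op bounded_row_adj]
        contraction_RRs])

lemma bounded_defect_star: "bounded_clinear (row_defect_star Y)"
  unfolding defect_star_eq_series
  by (rule bounded_clinear_sqrt_series[OF bounded_clinear_compose[OF bounded_row_adj bounded_row_op]
        contraction_RsR])

lemma defect_defect: "row_defect Y (row_defect Y h) = h - row_op Y (row_adj Y h)"
  unfolding defect_eq_series
  by (rule sqrt_series_sqrt_series[OF bounded_clinear_compose[OF bounded_row_op bounded_row_adj]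
        contraction_RRs])

lemma defect_star_defect_star:
  "row_defect_star Y (row_defect_star Y v) = v - row_adj Y (row_op Y v)"
  unfolding defect_star_eq_series
  by (rule sqrt_series_sqrt_series[OF bounded_clinear_compose[OF bounded_row_adj bounded_row_op]
        contraction_RsR])

lemma defect_cinner: "cinner (row_defect Y h) k = cinner h (row_defect Y k)"
proof (rule positive_op_self_adjoint)
  show "positive_op (row_defect Y)"
    unfolding defect_eq_series
    by (rule positive_op_sqrt_series[OF bounded_clinear_compose[OF bounded_row_op bounded_row_adj]
          contraction_RRs]) (simp add: row_op_cinner row_adj_cinner)
qed

lemma defect_star_cinner: "cinner (row_defect_star Y v) u = cinner v (row_defect_star Y u)"
proof (rule positive_op_self_adjoint)
  show "positive_op (row_defect_star Y)"
    unfolding defect_star_eq_series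
    by (rule positive_op_sqrt_series[OF bounded_clinear_compose[OF bounded_row_adj bounded_row_op]
          contraction_RsR]) (simp add: row_op_cinner row_adj_cinner)
qed

text \<open>With \<open>R = row_op Y\<close>, the operator \<open>R\<close> intertwines
  \<open>R\<^sup>* R\<close> and \<open>R R\<^sup>*\<close>, hence also the roots of their
  complements in the identity.\<close>

lemma row_op_defect_star: "row_op Y (row_defect_star Y v) = row_defect Y (row_op Y v)"
  unfolding defect_eq_series defect_star_eq_series
  by (rule sqrt_series_intertwine)
    (simp_all add: contraction_RsR contraction_RRs bounded_clinearD bounded_row_op)

lemma row_adj_defect: "row_adj Y (row_defect Y h) = row_defect_star Y (row_adj Y h)"
  unfolding defect_eq_series defect_star_eq_series
  by (rule sqrt_series_intertwine)
    (simp_all add: contraction_RsR contraction_RRs bounded_clinearD bounded_row_adj)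

lemmas colligation_simps =
  bounded_clinear_simps[OF bounded_row_op] bounded_clinear_simps[OF bounded_row_adj]
  bounded_clinear_simps[OF bounded_defect] bounded_clinear_simps[OF bounded_defect_star]

text \<open>The diagonal terms add up because the squares of the defect operators are the
  complements of \<open>R R\<^sup>*\<close> and \<open>R\<^sup>* R\<close>, for
  \<open>R = row_op Y\<close>. The mixed terms cancel because
  \<open>R \<Delta>\<^sub>* = \<Delta> R\<close>. This is the Julia operator of the row.\<close>

lemma colligation_unitary:
  "cinner (row_adj Y z + row_defect_star Y x) (row_adj Y z' + row_defect_star Y x') +
    cinner (row_defect Y z - row_op Y x) (row_defect Y z' - row_op Y x') =
    cinner z z' + cinner x x'"
proof -
  have e1: "cinner (row_adj Y z) (row_adj Y z') + cinner (row_defect Y z) (row_defect Y z') = cinner z z'"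
    by (simp add: row_adj_cinner defect_cinner defect_defect cinner_diff_right)
  have e2: "cinner (row_defect_star Y x) (row_defect_star Y x') + cinner (row_op Y x) (row_op Y x')
      = cinner x x'"
    by (simp add: row_op_cinner defect_star_cinner defect_star_defect_star cinner_diff_right)
  have e3: "cinner (row_adj Y z) (row_defect_star Y x') = cinner (row_defect Y z) (row_op Y x')"
    by (simp add: row_adj_cinner defect_cinner row_op_defect_star)
  have e4: "cinner (row_defect_star Y x) (row_adj Y z') = cinner (row_op Y x) (row_defect Y z')"
    by (simp add: row_op_cinner defect_star_cinner row_adj_defect)
  show ?thesis
    unfolding cinner_add_left cinner_add_right cinner_diff_left cinner_diff_right e3 e4
      e1[symmetric] e2[symmetric] by simp
qed

lemma colligation_norm:
  "(norm (row_adj Y z + row_defect_star Y x))\<^sup>2 + (norm (row_defect Y z - row_op Y x))\<^sup>2 =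
    (norm z)\<^sup>2 + (norm x)\<^sup>2"
  using colligation_unitary[of z x z x] unfolding cinner_self of_real_add[symmetric] of_real_eq_iff .

text \<open>Summed over all words up to length \<open>N\<close>, the colligation identity
  telescopes: a nonempty word of at most that length occurs once as a state and once as a successor.
  The initial state and level \<open>Suc N\<close> remain. The sesquilinear form gives orthogonality
  as well as norms.\<close>

lemma state_balance:
  "(\<Sum>\<beta> | length \<beta> = Suc N. cinner (state Y 1 h x \<beta>) (state Y 1 h' x' \<beta>)) +
    (\<Sum>\<beta> | length \<beta> \<le> N. cinner (response Y 1 h x \<beta>) (response Y 1 h' x' \<beta>)) =
    cinner h h' + (\<Sum>\<beta> | length \<beta> \<le> N. cinner (x \<beta>) (x' \<beta>))"
proof -
  let ?g = "\<lambda>\<beta>. cinner (state Y 1 h x \<beta>) (state Y 1 h' x' \<beta>)"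
  have "(\<Sum>i\<in>UNIV. ?g (\<beta> @ [i])) + cinner (response Y 1 h x \<beta>) (response Y 1 h' x' \<beta>) =
      ?g \<beta> + cinner (x \<beta>) (x' \<beta>)" for \<beta>
    using colligation_unitary[of "state Y 1 h x \<beta>" "x \<beta>" "state Y 1 h' x' \<beta>" "x' \<beta>"]
    by (simp add: response_def cinner_vec_def)
  then have "(\<Sum>\<beta> | length \<beta> \<le> N. (\<Sum>i\<in>UNIV. ?g (\<beta> @ [i])) +
      cinner (response Y 1 h x \<beta>) (response Y 1 h' x' \<beta>)) =
      (\<Sum>\<beta> | length \<beta> \<le> N. ?g \<beta> + cinner (x \<beta>) (x' \<beta>))"
    by simp
  then show ?thesis
    using sum_words_le_Suc[of ?g N] sum_words_snoc[of ?g N]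
    unfolding sum.distrib state_Nil by algebra
qed

lemma state_norm_balance:
  "(\<Sum>\<beta> | length \<beta> = Suc N. (norm (state Y 1 h x \<beta>))\<^sup>2) +
    (\<Sum>\<beta> | length \<beta> \<le> N. (norm (response Y 1 h x \<beta>))\<^sup>2) =
    (norm h)\<^sup>2 + (\<Sum>\<beta> | length \<beta> \<le> N. (norm (x \<beta>))\<^sup>2)"
  using state_balance[of h x h x N]
  unfolding cinner_self of_real_add[symmetric] of_real_sum[symmetric] of_real_eq_iff .

lemma sum_state_snoc:
  "(\<Sum>i\<in>UNIV. (norm (state Y r h x (\<beta> @ [i])))\<^sup>2) =
    r\<^sup>2 * (norm (row_adj Y (state Y r h x \<beta>) + row_defect_star Y (x \<beta>)))\<^sup>2"
  unfolding state_snoc norm_vec_sq by (simp add: power_mult_distrib sum_distrib_left)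

text \<open>A factor \<open>r \<le> 1\<close> on the successor states can only lose energy, so the
  balance becomes an inequality. It bounds the operators \<open>transfer Y r\<close> uniformly in
  \<open>r\<close>.\<close>

lemma response_norm_le:
  assumes "0 \<le> r" "r \<le> 1"
  shows "(\<Sum>\<beta> | length \<beta> \<le> N. (norm (response Y r h x \<beta>))\<^sup>2) \<le>
    (norm h)\<^sup>2 + (\<Sum>\<beta> | length \<beta> \<le> N. (norm (x \<beta>))\<^sup>2)"
proof -
  let ?g = "\<lambda>\<beta>. (norm (state Y r h x \<beta>))\<^sup>2"
  have r: "r\<^sup>2 \<le> 1"
    using assms by (simp add: power_le_one)
  have "(\<Sum>i\<in>UNIV. ?g (\<beta> @ [i])) + (norm (response Y r h x \<beta>))\<^sup>2 \<le> ?g \<beta> + (norm (x \<beta>))\<^sup>2" for \<beta>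
    using colligation_norm[of "state Y r h x \<beta>" "x \<beta>"] mult_right_mono[OF r, of
        "(norm (row_adj Y (state Y r h x \<beta>) + row_defect_star Y (x \<beta>)))\<^sup>2"]
    unfolding sum_state_snoc response_def by simp
  then have "(\<Sum>\<beta> | length \<beta> \<le> N. (\<Sum>i\<in>UNIV. ?g (\<beta> @ [i])) + (norm (response Y r h x \<beta>))\<^sup>2) \<le>
      (\<Sum>\<beta> | length \<beta> \<le> N. ?g \<beta> + (norm (x \<beta>))\<^sup>2)"
    by (rule sum_mono)
  moreover have "(\<Sum>\<beta> | length \<beta> = Suc N. ?g \<beta>) \<ge> 0"
    by (simp add: sum_nonneg)
  ultimately show ?thesis
    using sum_words_le_Suc[of ?g N] sum_words_snoc[of ?g N]
    by (simp only: sum.distrib state_Nil)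
qed

lemma
  assumes "0 \<le> r" "r \<le> 1"
  shows sq_summable_response: "sq_summable (response Y r h (coord x))"
    and norm_response_le: "(norm (Abs_l2 (response Y r h (coord x))))\<^sup>2 \<le> (norm h)\<^sup>2 + (norm x)\<^sup>2"
proof -
  have "(\<Sum>\<beta> | length \<beta> \<le> N. (norm (response Y r h (coord x) \<beta>))\<^sup>2) \<le> (norm h)\<^sup>2 + (norm x)\<^sup>2" for N
    using response_norm_le[OF assms, of h "coord x" N] sum_coord_le[OF finite_words_le[of N], of x]
    by linarith
  then show "sq_summable (response Y r h (coord x))"
    "(norm (Abs_l2 (response Y r h (coord x))))\<^sup>2 \<le> (norm h)\<^sup>2 + (norm x)\<^sup>2"
    by (rule sq_summable_words norm_Abs_l2_words)+
qed

lemma state_add: "state Y r (h + h') (\<lambda>\<beta>. x \<beta> + x' \<beta>) \<beta> = state Y r h x \<beta> + state Y r h' x' \<beta>"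
  by (induction \<beta> rule: rev_induct) (simp_all add: colligation_simps scaleR_add_right)

lemma state_scaleC: "state Y r (c *\<^sub>C h) (\<lambda>\<beta>. c *\<^sub>C x \<beta>) \<beta> = c *\<^sub>C state Y r h x \<beta>"
  by (induction \<beta> rule: rev_induct)
    (simp_all add: colligation_simps scaleC_add_right scaleC_scaleR_commute
      bounded_clinear_scaleC[OF bounded_clinear_nth])

lemma response_add: "response Y r (h + h') (\<lambda>\<beta>. x \<beta> + x' \<beta>) \<beta> = response Y r h x \<beta> + response Y r h' x' \<beta>"
  by (simp add: response_def state_add colligation_simps)

lemma response_scaleC: "response Y r (c *\<^sub>C h) (\<lambda>\<beta>. c *\<^sub>C x \<beta>) \<beta> = c *\<^sub>C response Y r h x \<beta>"
  by (simp add: response_def state_scaleC colligation_simps scaleC_diff_right)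

lemma coord_transfer:
  "0 \<le> r \<Longrightarrow> r \<le> 1 \<Longrightarrow> coord (transfer Y r x) \<beta> = response Y r 0 (coord x) \<beta>"
  by (simp add: transfer_def coord_Abs_l2 sq_summable_response)

lemma coord_poisson: "coord (poisson Y h) \<beta> = response Y 1 h (\<lambda>_. 0) \<beta>"
  using sq_summable_response[of 1 h 0] by (simp add: coord_zero_fun poisson_def coord_Abs_l2)

lemma norm_transfer_le: "0 \<le> r \<Longrightarrow> r \<le> 1 \<Longrightarrow> norm (transfer Y r x) \<le> norm x"
  using norm_response_le[of r 0 x] by (simp add: transfer_def power2_le_iff_abs_le)

lemma norm_poisson_le: "norm (poisson Y h) \<le> norm h"
  using norm_response_le[of 1 h 0] by (simp add: coord_zero_fun poisson_def power2_le_iff_abs_le)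

lemma bounded_transfer:
  assumes "0 \<le> r" "r \<le> 1"
  shows "bounded_clinear (transfer Y r)"
proof (rule bounded_clinearI[where K = 1])
  show "transfer Y r (x + y) = transfer Y r x + transfer Y r y" for x y
    using response_add[of r 0 0 "coord x" "coord y"]
    by (intro l2_eqI) (simp add: coord_transfer[OF assms] plus_l2.rep_eq)
  show "transfer Y r (c *\<^sub>C x) = c *\<^sub>C transfer Y r x" for c x
    using response_scaleC[of r c 0 "coord x"]
    by (intro l2_eqI) (simp add: coord_transfer[OF assms] scaleC_l2.rep_eq)
qed (use norm_transfer_le[OF assms] in simp)

lemma bounded_poisson: "bounded_clinear (poisson Y)"
proof (rule bounded_clinearI[where K = 1])
  show "poisson Y (h + k) = poisson Y h + poisson Y k" for h k
    using response_add[of 1 h k "\<lambda>_. 0" "\<lambda>_. 0"]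
    by (intro l2_eqI) (simp add: coord_poisson)
  show "poisson Y (c *\<^sub>C h) = c *\<^sub>C poisson Y h" for c h
    using response_scaleC[of 1 c h "\<lambda>_. 0"]
    by (intro l2_eqI) (simp add: coord_poisson)
qed (use norm_poisson_le in simp)

end

section \<open>Closed subspaces and the spaces \<open>h2_tensor\<close>\<close>

definition closed_csubspace :: "'a::chilbert_space set \<Rightarrow> bool"
  where "closed_csubspace D \<longleftrightarrow> closed D \<and> 0 \<in> D \<and> (\<forall>x\<in>D. \<forall>y\<in>D. x + y \<in> D) \<and>
    (\<forall>c. \<forall>x\<in>D. c *\<^sub>C x \<in> D)"

lemma
  assumes "closed_csubspace D"
  shows closed_csubspace_closed: "closed D"
    and closed_csubspace_0: "0 \<in> D"
    and closed_csubspace_add: "x \<in> D \<Longrightarrow> y \<in> D \<Longrightarrow> x + y \<in> D"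
    and closed_csubspace_scaleC: "x \<in> D \<Longrightarrow> c *\<^sub>C x \<in> D"
  using assms by (auto simp: closed_csubspace_def)

lemma closed_csubspace_diff:
  assumes "closed_csubspace D" "x \<in> D" "y \<in> D"
  shows "x - y \<in> D"
proof -
  have "x + (- 1) *\<^sub>C y \<in> D"
    by (intro closed_csubspace_add closed_csubspace_scaleC assms)
  moreover have "(- 1) *\<^sub>C y = - y"
    using scaleR_scaleC[of "- 1" y] by simp
  ultimately show ?thesis by simp
qed

lemma closed_csubspace_sum:
  assumes "closed_csubspace D" "\<And>i. i \<in> I \<Longrightarrow> f i \<in> D"
  shows "(\<Sum>i\<in>I. f i) \<in> D"
  using assms(2)
  by (induction I rule: infinite_finite_induct)
    (auto intro: closed_csubspace_0[OF assms(1)] closed_csubspace_add[OF assms(1)])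

lemma closure_range_intertwine:
  assumes "bounded_linear V" "\<And>x. V (A x) = B (V' x)" "y \<in> closure (range A)"
  shows "V y \<in> closure (range B)"
proof -
  have "V ` range A \<subseteq> range B"
    using assms(2) by auto
  then show ?thesis
    using closure_bounded_linear_image_subset[OF assms(1), of "range A"]
      closure_mono[of "V ` range A" "range B"] assms(3) by auto
qed

lemma closed_csubspace_closure_range:
  assumes A: "bounded_clinear A"
  shows "closed_csubspace (closure (range A))"
  unfolding closed_csubspace_def
proof (intro conjI ballI allI)
  have "A 0 = 0"
    by (simp add: bounded_clinear_simps[OF A])
  then have "0 \<in> range A"
    by (metis rangeI)
  then show "0 \<in> closure (range A)"
    by (rule closure_subset[THEN subsetD])
  \<comment> \<open>The closure is taken in one summand at a time: here \<open>y\<close> still lies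
    in the range, in the next step it is a limit.\<close>
  have 1: "x + y \<in> closure (range A)" if "x \<in> closure (range A)" "y \<in> range A" for x y
  proof -
    have "(\<lambda>x. x + y) ` range A \<subseteq> closure (range A)"
      using that(2) by (auto intro!: closure_subset[THEN subsetD] simp flip: bounded_clinear_simps(1)[OF A])
    then have "(\<lambda>x. x + y) ` closure (range A) \<subseteq> closure (range A)"
      by (intro image_closure_subset continuous_intros closed_closure)
    then show ?thesis
      using that(1) by blast
  qed
  show "x + y \<in> closure (range A)" if "x \<in> closure (range A)" "y \<in> closure (range A)" for x y
  proof -
    have "(+) x ` closure (range A) \<subseteq> closure (range A)"
      using 1[OF that(1)] by (intro image_closure_subset continuous_intros closed_closure) auto
    then show ?thesis
      using that(2) by blast
  qed
  show "c *\<^sub>C x \<in> closure (range A)" if "x \<in> closure (range A)" for c x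
    using closure_range_intertwine[OF bounded_linear_scaleC _ that, of c A "scaleC c"]
    by (simp add: bounded_clinear_scaleC[OF A])
qed simp

lemma coord_mem_h2_tensor: "x \<in> h2_tensor D \<Longrightarrow> coord x \<alpha> \<in> D"
  by (simp add: h2_tensor_def)

lemma h2_tensorI: "(\<And>\<alpha>. coord x \<alpha> \<in> D) \<Longrightarrow> x \<in> h2_tensor D"
  by (simp add: h2_tensor_def)

text \<open>Every coordinate of the image is a limit of linear combinations of coordinates of
  \<open>x\<close>. This keeps \<open>M\<^sub>i \<otimes> I\<close> inside the space on which a
  coincidence is given.\<close>

lemma tensor_op_id_mem_h2_tensor:
  fixes x :: "('n list, 'k::chilbert_space) l2"
    and A :: "('n list, complex) l2 \<Rightarrow> ('n list, complex) l2"
  assumes A: "bounded_clinear A" and D: "closed_csubspace D" and x: "x \<in> h2_tensor D"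
  shows "tensor_op A id x \<in> h2_tensor D"
proof (rule h2_tensorI)
  fix \<alpha> :: "'n list"
  let ?g = "\<lambda>\<beta>. coord (tensor_op A id (tensor (ket \<beta>) (coord x \<beta>))) \<alpha>"
  have "bounded_linear (\<lambda>y. coord (tensor_op A id (y :: ('n list, 'k) l2)) \<alpha>)"
    by (rule bounded_linear_compose[OF bounded_linear_coord
          bounded_clinearD[OF bounded_clinear_tensor_op_id[OF A]]])
  then have "(?g has_sum coord (tensor_op A id x) \<alpha>) UNIV"
    by (rule has_sum_bounded_linear[OF _ has_sum_tensor_ket])
  then have lim: "(sum ?g \<longlongrightarrow> coord (tensor_op A id x) \<alpha>) (finite_subsets_at_top UNIV)"
    by (simp add: has_sum_def)
  have "sum ?g F \<in> D" for F
    by (rule closed_csubspace_sum[OF D])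
      (simp add: tensor_op_id_tensor[OF A] coord_tensor closed_csubspace_scaleC[OF D]
        coord_mem_h2_tensor[OF x])
  then have "\<forall>\<^sub>F F in finite_subsets_at_top UNIV. sum ?g F \<in> D"
    by simp
  with lim show "coord (tensor_op A id x) \<alpha> \<in> D"
    by (intro Lim_in_closed_set[OF closed_csubspace_closed[OF D]]) auto
qed

lemma word_op_append: "word_op X (\<alpha> @ \<beta>) = word_op X \<alpha> \<circ> word_op X \<beta>"
  by (induction \<alpha>) auto

lemma bounded_clinear_word_op:
  assumes "\<And>i. bounded_clinear (X i)"
  shows "bounded_clinear (word_op X \<alpha>)"
proof (induction \<alpha>)
  case (Cons i \<alpha>)
  then show ?case
    using bounded_clinear_compose[OF assms[of i] Cons] by (simp add: o_def)
qed (use bounded_clinear_id(1) in \<open>simp add: id_def\<close>)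

lemma cadjoint_comp:
  assumes "bounded_clinear A" "bounded_clinear B"
  shows "cadjoint (A \<circ> B) = cadjoint B \<circ> cadjoint A"
  by (rule cadjoint_eqI)
    (use bounded_clinear_compose[OF bounded_clinear_cadjoint[OF assms(2)] bounded_clinear_cadjoint[OF assms(1)]]
      in \<open>simp_all add: o_def cinner_cadjoint_right assms\<close>)

lemma cadjoint_id: "cadjoint id = id" "cadjoint (\<lambda>x. x) = (\<lambda>x. x)"
  by (rule cadjoint_eqI; simp add: bounded_clinear_id)+

section \<open>The Poisson kernel and the complement of its range\<close>

context row_contraction
begin

lemmas bounded_word_op = bounded_clinear_word_op[of Y, OF bounded]

lemma cadjoint_word_op_snoc: "cadjoint (word_op Y (\<beta> @ [i])) h = cadjoint (Y i) (cadjoint (word_op Y \<beta>) h)"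
  unfolding word_op_append cadjoint_comp[OF bounded_word_op bounded_word_op] by simp

lemma cadjoint_word_op_Cons: "cadjoint (word_op Y (i # \<beta>)) h = cadjoint (word_op Y \<beta>) (cadjoint (Y i) h)"
  unfolding word_op.simps cadjoint_comp[OF bounded bounded_word_op] by simp

lemma state_zero_input: "state Y 1 h (\<lambda>_. 0) \<beta> = cadjoint (word_op Y \<beta>) h"
  by (induction \<beta> rule: rev_induct)
    (simp_all add: cadjoint_id cadjoint_word_op_snoc colligation_simps row_adj_def)

lemma coord_poisson_eq: "coord (poisson Y h) \<beta> = row_defect Y (cadjoint (word_op Y \<beta>) h)"
  by (simp add: coord_poisson response_def state_zero_input colligation_simps)

text \<open>In the adjoint of \<open>Y\<^sub>i Y\<^sub>\<beta>\<close> the factor for the first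
  letter acts first, so stripping that letter moves it onto the argument \<open>h\<close>.\<close>

lemma pull_Cons_poisson: "pull_Cons i (poisson Y h) = poisson Y (cadjoint (Y i) h)"
  by (rule l2_eqI) (simp add: coord_pull_Cons coord_poisson_eq cadjoint_word_op_Cons del: word_op.simps)

text \<open>The dual of \<open>pull_Cons_poisson\<close>, with \<open>y\<close> split by the first
  letter. It has the shape z = R w + \<Delta> y of a state recovered from its successors w and the
  current output.\<close>

lemma cadjoint_poisson:
  "cadjoint (poisson Y) y =
    row_op Y (\<chi> i. cadjoint (poisson Y) (pull_Cons i y)) + row_defect Y (coord y [])"
proof (rule cinner_eqI)
  fix h
  have "cinner (cadjoint (poisson Y) y) h = cinner y (poisson Y h)"
    by (rule cinner_cadjoint_left[OF bounded_poisson])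
  also have "\<dots> = cinner (coord y []) (row_defect Y h) +
      (\<Sum>i\<in>UNIV. cinner (pull_Cons i y) (poisson Y (cadjoint (Y i) h)))"
    by (simp add: cinner_pull_Cons[of y] pull_Cons_poisson coord_poisson_eq cadjoint_id)
  also have "\<dots> = cinner (row_defect Y (coord y [])) h +
      (\<Sum>i\<in>UNIV. cinner (cadjoint (poisson Y) (pull_Cons i y)) (cadjoint (Y i) h))"
    by (simp add: defect_cinner cinner_cadjoint_left[OF bounded_poisson])
  also have "\<dots> = cinner (row_op Y (\<chi> i. cadjoint (poisson Y) (pull_Cons i y)) +
      row_defect Y (coord y [])) h"
    by (simp add: cinner_add_left row_op_cinner cinner_vec_def row_adj_def)
  finally show "cinner (cadjoint (poisson Y) y) h = \<dots>" .
qed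

primrec pull :: "'n list \<Rightarrow> ('n list, 'h) l2 \<Rightarrow> ('n list, 'h) l2"
  where
    "pull [] y = y"
  | "pull (i # \<beta>) y = pull \<beta> (pull_Cons i y)"

lemma coord_pull: "coord (pull \<beta> y) \<gamma> = coord y (\<beta> @ \<gamma>)"
  by (induction \<beta> arbitrary: y) (simp_all add: coord_pull_Cons)

lemma pull_snoc: "pull (\<beta> @ [i]) y = pull_Cons i (pull \<beta> y)"
  by (induction \<beta> arbitrary: y) simp_all

lemma sum_norm_pull_le: "(\<Sum>\<beta> | length \<beta> = N. (norm (pull \<beta> y))\<^sup>2) \<le> (norm y)\<^sup>2"
proof (induction N arbitrary: y)
  case (Suc N)
  have "(\<Sum>\<beta> | length \<beta> = Suc N. (norm (pull \<beta> y))\<^sup>2) =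
      (\<Sum>i\<in>UNIV. \<Sum>\<beta> | length \<beta> = N. (norm (pull \<beta> (pull_Cons i y)))\<^sup>2)"
    by (subst sum_words_Cons) simp
  also have "\<dots> \<le> (\<Sum>i\<in>UNIV. (norm (pull_Cons i y))\<^sup>2)"
    by (intro sum_mono Suc)
  also have "\<dots> \<le> (norm y)\<^sup>2"
    using norm_pull_Cons[of y] by simp
  finally show ?case .
qed simp

text \<open>Running the colligation backwards from \<open>y\<close>: the state at \<open>\<beta>\<close> has to be
  \<open>K\<^sup>*\<close> applied to the part of \<open>y\<close> beyond \<open>\<beta>\<close>.\<close>

lemma poisson_transfer_decomposition:
  obtains h x where "y = poisson Y h + transfer Y 1 x"
    and "y \<in> h2_tensor (closure (range (row_defect Y))) \<Longrightarrow>
      x \<in> h2_tensor (closure (range (row_defect_star Y)))"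
proof -
  define z where "z \<beta> = cadjoint (poisson Y) (pull \<beta> y)" for \<beta>
  define w where "w \<beta> = (\<chi> i. z (\<beta> @ [i]))" for \<beta>
  \<comment> \<open>The adjoint colligation: successor states \<open>w\<close> and output
    \<open>y\<^sub>\<beta>\<close> come from the state \<open>R w + \<Delta> y\<^sub>\<beta>\<close>
    and the input \<open>\<Delta>\<^sub>* w - R\<^sup>* y\<^sub>\<beta>\<close>, with
    \<open>R = row_op Y\<close>.\<close>
  define x where "x \<beta> = row_defect_star Y (w \<beta>) - row_adj Y (coord y \<beta>)" for \<beta>
  have z: "z \<beta> = row_op Y (w \<beta>) + row_defect Y (coord y \<beta>)" for \<beta>
    unfolding z_def w_def by (subst cadjoint_poisson) (simp add: pull_snoc coord_pull)
  have w: "row_adj Y (z \<beta>) + row_defect_star Y (x \<beta>) = w \<beta>" for \<beta>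
    by (simp add: z x_def colligation_simps defect_star_defect_star row_adj_defect)
  have st: "state Y 1 (z []) x \<beta> = z \<beta>" for \<beta>
    by (induction \<beta> rule: rev_induct) (simp_all add: w, simp add: w_def)
  have out: "response Y 1 (z []) x \<beta> = coord y \<beta>" for \<beta>
    unfolding response_def st
    by (simp add: z x_def colligation_simps defect_defect row_op_defect_star)
  \<comment> \<open>By the forward balance the input energy is at most that of the states at level
    \<open>Suc N\<close> plus that of the outputs; each of the two is at most
    \<open>(norm y)\<^sup>2\<close>.\<close>
  have "(\<Sum>\<beta> | length \<beta> \<le> N. (norm (x \<beta>))\<^sup>2) \<le> 2 * (norm y)\<^sup>2" for N
  proof -
    have "norm (z \<beta>) \<le> norm (pull \<beta> y)" for \<beta>
      unfolding z_def using norm_cadjoint_le[OF bounded_poisson, of 1 "pull \<beta> y"] norm_poisson_le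
      by simp
    then have "(\<Sum>\<beta> | length \<beta> = Suc N. (norm (z \<beta>))\<^sup>2) \<le>
        (\<Sum>\<beta> | length \<beta> = Suc N. (norm (pull \<beta> y))\<^sup>2)"
      by (intro sum_mono power_mono) auto
    then have "(\<Sum>\<beta> | length \<beta> = Suc N. (norm (z \<beta>))\<^sup>2) \<le> (norm y)\<^sup>2"
      using sum_norm_pull_le[of y "Suc N"] by linarith
    then show ?thesis
      using state_norm_balance[of "z []" x N] sum_coord_le[OF finite_words_le[of N], of y]
        zero_le_power2[of "norm (z [])"]
      unfolding st out by linarith
  qed
  then have sq: "sq_summable x"
    by (rule sq_summable_words)
  show thesis
  proof
    show "y = poisson Y (z []) + transfer Y 1 (Abs_l2 x)"
    proof (rule l2_eqI)
      fix \<beta>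
      show "coord y \<beta> = coord (poisson Y (z []) + transfer Y 1 (Abs_l2 x)) \<beta>"
        using response_add[of 1 "z []" 0 "\<lambda>_. 0" x \<beta>]
        by (simp add: coord_poisson coord_transfer coord_Abs_l2[OF sq] out)
    qed
    assume y: "y \<in> h2_tensor (closure (range (row_defect Y)))"
    have "x \<beta> \<in> closure (range (row_defect_star Y))" for \<beta>
      unfolding x_def
    proof (rule closed_csubspace_diff[OF closed_csubspace_closure_range[OF bounded_defect_star]])
      show "row_adj Y (coord y \<beta>) \<in> closure (range (row_defect_star Y))"
        by (rule closure_range_intertwine[where A = "row_defect Y"])
          (simp_all add: bounded_clinearD bounded_row_adj row_adj_defect
            coord_mem_h2_tensor[OF y])
    qed (simp add: closure_subset[THEN subsetD])
    then show "Abs_l2 x \<in> h2_tensor (closure (range (row_defect_star Y)))"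
      by (intro h2_tensorI) (simp add: coord_Abs_l2[OF sq])
  qed
qed

lemma poisson_mem: "poisson Y h \<in> h2_tensor (closure (range (row_defect Y)))"
  by (rule h2_tensorI) (simp add: coord_poisson_eq closure_subset[THEN subsetD])

lemma transfer_mem:
  assumes "x \<in> h2_tensor (closure (range (row_defect_star Y)))"
  shows "transfer Y 1 x \<in> h2_tensor (closure (range (row_defect Y)))"
proof (rule h2_tensorI)
  fix \<beta>
  have "row_op Y (coord x \<beta>) \<in> closure (range (row_defect Y))"
    by (rule closure_range_intertwine[where A = "row_defect_star Y"])
      (simp_all add: bounded_clinearD bounded_row_op row_op_defect_star
        coord_mem_h2_tensor[OF assms])
  then show "coord (transfer Y 1 x) \<beta> \<in> closure (range (row_defect Y))"
    unfolding coord_transfer[OF zero_le_one order_refl] response_def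
    by (intro closed_csubspace_diff[OF closed_csubspace_closure_range[OF bounded_defect]])
      (simp add: closure_subset[THEN subsetD])
qed

text \<open>A single input at \<open>\<alpha>\<close> needs
  \<open>length \<gamma> - length \<alpha>\<close> steps to reach \<open>\<gamma>\<close>, and each
  step contributes a factor \<open>r\<close>. If \<open>\<gamma>\<close> is no longer than
  \<open>\<alpha>\<close>, the truncated subtraction gives exponent 0; the state is then 0 and only
  the direct term at \<open>\<gamma> = \<alpha>\<close> can remain.\<close>

lemma transfer_tensor_ket:
  assumes "0 \<le> r" "r \<le> 1"
  shows "coord (transfer Y r (tensor (ket \<alpha>) v)) \<gamma> =
    r ^ (length \<gamma> - length \<alpha>) *\<^sub>R coord (transfer Y 1 (tensor (ket \<alpha>) v)) \<gamma>"
proof -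
  let ?x = "coord (tensor (ket \<alpha>) v)"
  have st: "state Y r 0 ?x \<gamma> = r ^ (length \<gamma> - length \<alpha>) *\<^sub>R state Y 1 0 ?x \<gamma> \<and>
      (length \<gamma> \<le> length \<alpha> \<longrightarrow> state Y 1 0 ?x \<gamma> = 0)"
  proof (induction \<gamma> rule: rev_induct)
    case (snoc i \<gamma>)
    show ?case
    proof (cases "length \<gamma> < length \<alpha>")
      case True
      then have "\<gamma> \<noteq> \<alpha>" by auto
      with True snoc show ?thesis
        by (simp add: coord_tensor_ket colligation_simps)
    next
      case False
      then have len: "length (\<gamma> @ [i]) - length \<alpha> = Suc (length \<gamma> - length \<alpha>)" by simp
      show ?thesis
      proof (cases "\<gamma> = \<alpha>")
        case True
        then show ?thesis
          using snoc len by (simp add: coord_tensor_ket)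
      next
        case neq: False
        show ?thesis
          using snoc False unfolding len by (simp add: coord_tensor_ket neq colligation_simps)
      qed
    qed
  qed simp
  show ?thesis
    unfolding coord_transfer[OF assms] coord_transfer[OF zero_le_one order_refl] response_def
    using st by (cases "\<gamma> = \<alpha>") (simp_all add: coord_tensor_ket colligation_simps)
qed

end

text \<open>Finitely many coordinates converge, and on the tail
  \<open>\<bar>r ^ m i - 1\<bar> \<le> 1\<close> suffices. It handles the radial limits both of the
  transfer function and of the model.\<close>

lemma tendsto_diagonal_l2:
  assumes "\<forall>\<^sub>F r in at_left (1::real). \<forall>i. coord (u r) i = r ^ m i *\<^sub>R coord y i"
  shows "(u \<longlongrightarrow> y) (at_left 1)"
proof (rule tendstoI)
  fix e :: real assume e: "e > 0"
  obtain F where F: "finite F" "dist (\<Sum>i\<in>F. tensor (ket i) (coord y i)) y \<le> e / 2"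
    using has_sum_finite_approximation[OF has_sum_tensor_ket[of y], of "e / 2"] e by auto
  let ?s = "\<Sum>i\<in>F. tensor (ket i) (coord y i)"
    and ?d = "\<lambda>r. \<Sum>i\<in>F. (r ^ m i - 1) *\<^sub>R tensor (ket i) (coord y i)"
  have "(?d \<longlongrightarrow> (\<Sum>i\<in>F. (1 ^ m i - 1) *\<^sub>R tensor (ket i) (coord y i))) (at_left 1)"
    by (intro tendsto_intros)
  then have "\<forall>\<^sub>F r in at_left 1. norm (?d r) < e / 2"
    using e tendstoD[of ?d 0 "at_left 1" "e / 2"] by simp
  moreover have "\<forall>\<^sub>F r in at_left (1::real). 0 < r \<and> r < 1"
    by (rule eventually_at_leftI[of 0]) auto
  ultimately show "\<forall>\<^sub>F r in at_left 1. dist (u r) y < e"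
    using assms
  proof eventually_elim
    case (elim r)
    \<comment> \<open>After subtraction of the correction on \<open>F\<close>, the coordinates that
      are left are those of the tail \<open>y - s\<close>, each with a factor of modulus at most
      1.\<close>
    have "norm (u r - y - ?d r) \<le> 1 * norm (y - ?s)"
    proof (rule norm_l2_mono)
      fix i
      have "\<bar>r ^ m i - 1\<bar> \<le> 1"
        using elim(2) power_le_one[of r "m i"] zero_le_power[of r "m i"] by auto
      moreover have "coord (u r - y - ?d r) i = (r ^ m i - 1) *\<^sub>R coord (y - ?s) i"
        using elim(3) F(1) by (simp add: coord_sum coord_tensor_ket scaleR_left_diff_distrib if_distrib
            cong: if_cong)
      ultimately show "norm (coord (u r - y - ?d r) i) \<le> 1 * norm (coord (y - ?s) i)"
        by (simp only: norm_scaleR mult_right_mono norm_ge_zero)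
    qed simp
    then show ?case
      using elim(1) F(2) norm_triangle_ineq[of "u r - y - ?d r" "?d r"]
      by (simp add: dist_norm norm_minus_commute)
  qed
qed

context row_contraction
begin

lemma transfer_tendsto: "((\<lambda>r. transfer Y r x) \<longlongrightarrow> transfer Y 1 x) (at_left 1)"
proof (rule strong_limit_l2[where A = "transfer Y" and B = "transfer Y 1"])
  have ev: "\<forall>\<^sub>F r in at_left (1::real). 0 \<le> r \<and> r \<le> 1"
    by (rule eventually_at_leftI[of 0]) auto
  show "\<forall>\<^sub>F r in at_left 1. bounded_linear (transfer Y r) \<and> (\<forall>x. norm (transfer Y r x) \<le> norm x)"
    using ev by eventually_elim
      (simp add: bounded_clinearD bounded_transfer norm_transfer_le)
  show "bounded_linear (transfer Y 1)" "norm (transfer Y 1 x) \<le> norm x" for x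
    by (simp_all add: bounded_clinearD bounded_transfer norm_transfer_le)
  show "((\<lambda>r. transfer Y r (tensor (ket \<alpha>) v)) \<longlongrightarrow> transfer Y 1 (tensor (ket \<alpha>) v)) (at_left 1)"
    for \<alpha> v
  proof (rule tendsto_diagonal_l2[where m = "\<lambda>\<gamma>. length \<gamma> - length \<alpha>"])
    show "\<forall>\<^sub>F r in at_left 1. \<forall>\<gamma>. coord (transfer Y r (tensor (ket \<alpha>) v)) \<gamma> =
        r ^ (length \<gamma> - length \<alpha>) *\<^sub>R coord (transfer Y 1 (tensor (ket \<alpha>) v)) \<gamma>"
      using ev by eventually_elim (intro allI, rule transfer_tensor_ket, simp_all)
  qed
qed

text \<open>For \<open>r < 1\<close> the states form a vector of the tensor product themselves; this
  vector is the preimage that the inverse in \<open>char_fun_r\<close> asks for.\<close>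

lemma sq_summable_state:
  assumes r: "0 \<le> r" "r < 1"
  shows "sq_summable (state Y r 0 (coord x))"
proof -
  define q where "q = r\<^sup>2"
  have q: "0 \<le> q" "q < 1"
    using r by (simp_all add: q_def power_less_one_iff)
  let ?g = "\<lambda>\<beta>. (norm (state Y r 0 (coord x) \<beta>))\<^sup>2"
  \<comment> \<open>The fixed point of \<open>B \<mapsto> q * (B + (norm x)\<^sup>2)\<close>, by
    which the energy bound passes from level to level.\<close>
  define B where "B = q * (norm x)\<^sup>2 / (1 - q)"
  have B: "q * (B + (norm x)\<^sup>2) = B" "B \<ge> 0"
    using q by (simp_all add: B_def field_simps)
  have "(\<Sum>\<beta> | length \<beta> \<le> N. ?g \<beta>) \<le> B" for N
  proof (induction N)
    case 0
    then show ?case using B by simp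
  next
    case (Suc N)
    have "(\<Sum>i\<in>UNIV. ?g (\<beta> @ [i])) \<le> q * (?g \<beta> + (norm (coord x \<beta>))\<^sup>2)" for \<beta>
      unfolding sum_state_snoc q_def[symmetric] colligation_norm[symmetric]
      using q by (intro mult_left_mono) simp_all
    then have "(\<Sum>\<beta> | length \<beta> \<le> N. \<Sum>i\<in>UNIV. ?g (\<beta> @ [i])) \<le>
        (\<Sum>\<beta> | length \<beta> \<le> N. q * (?g \<beta> + (norm (coord x \<beta>))\<^sup>2))"
      by (intro sum_mono)
    also have "\<dots> = q * ((\<Sum>\<beta> | length \<beta> \<le> N. ?g \<beta>) + (\<Sum>\<beta> | length \<beta> \<le> N. (norm (coord x \<beta>))\<^sup>2))"
      by (simp add: sum.distrib flip: sum_distrib_left)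
    also have "\<dots> \<le> q * (B + (norm x)\<^sup>2)"
      using q by (intro mult_left_mono add_mono Suc sum_coord_le finite_words_le)
    finally show ?case
      using B by (subst sum_words_snoc) simp
  qed
  then show ?thesis
    by (rule sq_summable_words)
qed

end

section \<open>Identification of the characteristic function with the transfer function\<close>

lemma coord_sum_right_shift:
  fixes z :: "('n::finite list, 'k::chilbert_space) l2"
  assumes "\<And>i. bounded_clinear (C i)"
  shows "coord (\<Sum>i\<in>UNIV. r *\<^sub>R right_shift i (l2_map (C i) z)) [] = 0"
    and "coord (\<Sum>i\<in>UNIV. r *\<^sub>R right_shift i (l2_map (C i) z)) (\<beta> @ [j]) = r *\<^sub>R C j (coord z \<beta>)"
  using bounded_clinearD[OF assms]
  by (simp_all add: coord_sum coord_right_shift coord_l2_map if_distrib cong: if_cong)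

text \<open>Read at a word ending in j, the equation L z = S is the state recursion. So the states
  solve the linear equation behind the Fourier representation, and the two remaining terms of that
  representation form the output.\<close>

lemma char_fun_r_eq_transfer:
  fixes f :: "'n::finite \<Rightarrow> 'n ncps" and T :: "'n \<Rightarrow> 'h \<Rightarrow> 'h::chilbert_space"
  assumes "row_contraction (tuple_eval f T)" and r: "0 \<le> r" "r < 1"
  shows "char_fun_r f T r x = transfer (tuple_eval f T) r x"
proof -
  define Y where "Y = tuple_eval f T"
  interpret row_contraction Y
    using assms(1) by (simp add: Y_def)
  have d: "defect f T = row_defect Y" "defect_star f T = row_defect_star Y"
    by (simp_all add: defect_def row_defect_def defect_star_def row_defect_star_def Y_def)
  note adj = bounded_clinear_cadjoint[OF bounded]
  define z where "z = Abs_l2 (state Y r 0 (coord x))"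
  have z: "coord z = state Y r 0 (coord x)"
    by (simp add: z_def coord_Abs_l2 sq_summable_state[OF r])
  define L where "L z = z - (\<Sum>i\<in>UNIV. r *\<^sub>R right_shift i (l2_map (cadjoint (Y i)) z))"
    for z :: "('n list, 'h) l2"
  define S where "S = (\<Sum>i\<in>UNIV. r *\<^sub>R right_shift i (l2_map (\<lambda>v. v $ i)
      (l2_map (row_defect_star Y) x)))"
  have "L z = S"
  proof (rule l2_eqI)
    fix \<beta>
    show "coord (L z) \<beta> = coord S \<beta>"
    proof (cases \<beta> rule: rev_cases)
      case Nil
      show ?thesis
        unfolding Nil L_def S_def coord_diff coord_sum_right_shift(1)[OF adj]
          coord_sum_right_shift(1)[OF bounded_clinear_nth] by (simp add: z)
    next
      case (snoc \<gamma> j)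
      show ?thesis
        unfolding snoc L_def S_def coord_diff coord_sum_right_shift(2)[OF adj]
          coord_sum_right_shift(2)[OF bounded_clinear_nth]
        by (simp add: z coord_l2_map bounded_clinearD bounded_defect_star
            row_adj_def scaleR_add_right)
    qed
  qed
  \<comment> \<open>\<open>inv L S\<close> is the solution just found because L is injective: its
    coordinate at a word is that of the argument corrected by the coordinate at the word without its
    last letter.\<close>
  moreover have "inj L"
  proof (rule injI, rule l2_eqI)
    fix u v \<beta> assume eq: "L u = L v"
    show "coord u \<beta> = coord v \<beta>"
    proof (induction \<beta> rule: rev_induct)
      case Nil
      show ?case
        using arg_cong[OF eq, of "\<lambda>y. coord y []"]
        unfolding L_def coord_diff coord_sum_right_shift(1)[OF adj] by simp
    next
      case (snoc j \<beta>)
      then show ?case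
        using arg_cong[OF eq, of "\<lambda>y. coord y (\<beta> @ [j])"]
        unfolding L_def coord_diff coord_sum_right_shift(2)[OF adj] by simp
    qed
  qed
  ultimately have inv: "inv L S = z"
    by (metis inv_f_f)
  have "char_fun_r f T r x = - l2_map (row_op Y) x + l2_map (row_defect Y) (inv L S)"
    unfolding char_fun_r_def d Y_def[symmetric] tensor_op_id_left[OF bounded_row_op]
      tensor_op_id_left[OF bounded_defect] tensor_op_id_left[OF bounded_defect_star]
      tensor_op_right_mult[OF adj] tensor_op_right_mult[OF bounded_clinear_nth] L_def[abs_def] S_def ..
  also have "\<dots> = transfer Y r x"
    unfolding inv
    by (rule l2_eqI)
      (use r in \<open>simp add: coord_transfer response_def coord_l2_map bounded_clinearD
          bounded_row_op bounded_defect z\<close>)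
  finally show ?thesis by (simp add: Y_def)
qed

lemma char_fun_eq_transfer:
  assumes "row_contraction (tuple_eval f T)"
  shows "char_fun f T x = transfer (tuple_eval f T) 1 x"
  unfolding char_fun_def
proof (rule tendsto_Lim)
  have "\<forall>\<^sub>F r in at_left (1::real). 0 \<le> r \<and> r < 1"
    by (rule eventually_at_leftI[of 0]) auto
  then have "\<forall>\<^sub>F r in at_left 1. transfer (tuple_eval f T) r x = char_fun_r f T r x"
    by eventually_elim (simp add: char_fun_r_eq_transfer[OF assms])
  then show "((\<lambda>r. char_fun_r f T r x) \<longlongrightarrow> transfer (tuple_eval f T) 1 x) (at_left 1)"
    by (rule Lim_transform_eventually[OF row_contraction.transfer_tendsto[OF assms]])
qed simp

text \<open>The sum is the quadratic form at \<open>h\<close> of the operators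
  \<open>\<Sum> Y\<^sub>\<alpha> Y\<^sub>\<alpha>\<^sup>*\<close> from the definition of
  purity.\<close>

locale pure_row_contraction = row_contraction Y for Y :: "'n::finite \<Rightarrow> 'h \<Rightarrow> 'h::chilbert_space" +
  assumes pure: "(\<lambda>k. \<Sum>\<alpha> | length \<alpha> = k. (norm (cadjoint (word_op Y \<alpha>) h))\<^sup>2) \<longlonglongrightarrow> 0"
begin

text \<open>The balance is taken between a run with state \<open>h\<close> and input
  \<open>x\<close> and a run from \<open>k\<close> without input. The states of the first have
  bounded energy and those of the second are \<open>Y\<^sub>\<alpha>\<^sup>* k\<close>, so purity
  removes the boundary term. The case \<open>h = 0\<close> is orthogonality, the case
  \<open>x = 0\<close> is isometry.\<close>

lemma cinner_response_poisson:
  "cinner (Abs_l2 (response Y 1 h (coord x))) (poisson Y k) = cinner h k"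
proof -
  let ?z = "\<lambda>\<beta>. state Y 1 h (coord x) \<beta>" and ?z' = "\<lambda>\<beta>. state Y 1 k (\<lambda>_. 0) \<beta>"
  let ?p = "\<lambda>N. \<Sum>\<beta> | length \<beta> = Suc N. cinner (?z \<beta>) (?z' \<beta>)"
  \<comment> \<open>The square of \<open>B\<close> is all the energy fed into the first run, so
    \<open>B\<close> bounds its states at every level.\<close>
  define B where "B = sqrt ((norm h)\<^sup>2 + (norm x)\<^sup>2)"
  have "norm (?p N) \<le> B * sqrt (\<Sum>\<alpha> | length \<alpha> = Suc N. (norm (cadjoint (word_op Y \<alpha>) k))\<^sup>2)" for N
  proof -
    have "norm (?p N) \<le> (\<Sum>\<beta> | length \<beta> = Suc N. \<bar>norm (?z \<beta>)\<bar> * \<bar>norm (?z' \<beta>)\<bar>)"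
      by (rule order_trans[OF norm_sum]) (intro sum_mono, simp add: cinner_bound)
    also have "\<dots> \<le> L2_set (\<lambda>\<beta>. norm (?z \<beta>)) {\<beta>. length \<beta> = Suc N} *
        L2_set (\<lambda>\<beta>. norm (?z' \<beta>)) {\<beta>. length \<beta> = Suc N}"
      by (rule L2_set_mult_ineq)
    also have "\<dots> \<le> B * sqrt (\<Sum>\<alpha> | length \<alpha> = Suc N. (norm (cadjoint (word_op Y \<alpha>) k))\<^sup>2)"
    proof (rule mult_mono)
      have "(\<Sum>\<beta> | length \<beta> = Suc N. (norm (?z \<beta>))\<^sup>2) \<le> (norm h)\<^sup>2 + (norm x)\<^sup>2"
        using state_norm_balance[of h "coord x" N] sum_coord_le[OF finite_words_le[of N], of x]
          sum_nonneg[of "{\<beta>. length \<beta> \<le> N}" "\<lambda>\<beta>. (norm (response Y 1 h (coord x) \<beta>))\<^sup>2"]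
        by simp
      then show "L2_set (\<lambda>\<beta>. norm (?z \<beta>)) {\<beta>. length \<beta> = Suc N} \<le> B"
        by (simp add: L2_set_def B_def)
    qed (simp_all add: L2_set_def state_zero_input B_def sum_nonneg)
    finally show ?thesis .
  qed
  moreover have "(\<lambda>N. B * sqrt (\<Sum>\<alpha> | length \<alpha> = Suc N. (norm (cadjoint (word_op Y \<alpha>) k))\<^sup>2)) \<longlonglongrightarrow>
      B * sqrt 0"
    by (intro tendsto_intros LIMSEQ_Suc[OF pure])
  ultimately have p0: "?p \<longlonglongrightarrow> 0"
    by (intro Lim_null_comparison[of ?p]) (auto simp only: real_sqrt_zero mult_zero_right intro: always_eventually)
  let ?y = "Abs_l2 (response Y 1 h (coord x))"
  have cy: "coord ?y = response Y 1 h (coord x)"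
    by (simp add: coord_Abs_l2 sq_summable_response)
  have "(\<lambda>N. \<Sum>\<beta> | length \<beta> \<le> N. cinner (coord ?y \<beta>) (coord (poisson Y k) \<beta>)) \<longlonglongrightarrow>
      cinner ?y (poisson Y k)"
    by (rule has_sum_words_tendsto[OF has_sum_cinner_l2])
  with p0 have "(\<lambda>N. ?p N + (\<Sum>\<beta> | length \<beta> \<le> N. cinner (coord ?y \<beta>) (coord (poisson Y k) \<beta>))) \<longlonglongrightarrow>
      0 + cinner ?y (poisson Y k)"
    by (rule tendsto_add)
  moreover have "?p N + (\<Sum>\<beta> | length \<beta> \<le> N. cinner (coord ?y \<beta>) (coord (poisson Y k) \<beta>)) =
      cinner h k" for N
    using state_balance[of h "coord x" k "\<lambda>_. 0" N] by (simp add: cy coord_poisson)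
  ultimately show ?thesis
    using LIMSEQ_unique[OF tendsto_const] by fastforce
qed

lemma transfer_orthogonal_poisson: "cinner (transfer Y 1 x) (poisson Y k) = 0"
  using cinner_response_poisson[of 0 x k] by (simp add: transfer_def)

lemma cinner_poisson: "cinner (poisson Y h) (poisson Y k) = cinner h k"
  using cinner_response_poisson[of h 0 k] by (simp add: coord_zero_fun poisson_def)

end

section \<open>Left multiplication by the coordinates\<close>

lemma nc_mult_splits: "nc_mult p q w = (\<Sum>(u, v) | u @ v = w. p u * q v)"
  unfolding nc_mult_def
  by (rule sum.reindex_bij_witness[of _ "\<lambda>s. length (fst s)" "\<lambda>k. (take k w, drop k w)"]) auto

lemma finite_splits: "finite {(u, v). u @ v = w}" "finite {s. fst s @ snd s = w}"
proof -
  have "{s. fst s @ snd s = w} \<subseteq> (\<lambda>k. (take k w, drop k w)) ` {..length w}"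
  proof
    fix s assume "s \<in> {s. fst s @ snd s = w}"
    then show "s \<in> (\<lambda>k. (take k w, drop k w)) ` {..length w}"
      by (intro image_eqI[of _ _ "length (fst s)"]) auto
  qed
  then show "finite {s. fst s @ snd s = w}"
    by (rule finite_subset) simp
  then show "finite {(u, v). u @ v = w}"
    by (simp add: split_def)
qed

lemma nc_mult_assoc: "nc_mult (nc_mult p q) r = nc_mult p (nc_mult q r)"
proof
  fix w
  have "nc_mult (nc_mult p q) r w =
      (\<Sum>(s, t)\<in>(SIGMA s:{(u, v). u @ v = w}. {(u, v). u @ v = fst s}). p (fst t) * q (snd t) * r (snd s))"
    unfolding nc_mult_splits
    by (subst sum.Sigma[symmetric])
      (auto simp: finite_splits sum_distrib_right split_def intro!: sum.cong)
  also have "\<dots> =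
      (\<Sum>(s, t)\<in>(SIGMA s:{(u, v). u @ v = w}. {(u, v). u @ v = snd s}). p (fst s) * (q (fst t) * r (snd t)))"
    by (rule sum.reindex_bij_witness[of _ "\<lambda>((a, b), (c, d)). ((a @ c, d), (a, c))"
          "\<lambda>((a, b), (c, d)). ((c, d @ b), (d, b))"]) auto
  also have "\<dots> = nc_mult p (nc_mult q r) w"
    unfolding nc_mult_splits
    by (subst sum.Sigma[symmetric])
      (auto simp: finite_splits sum_distrib_left split_def intro!: sum.cong)
  finally show "nc_mult (nc_mult p q) r w = nc_mult p (nc_mult q r) w" .
qed

lemma nc_mult_one_left [simp]: "nc_mult nc_one p = p"
proof
  fix w
  have "nc_mult nc_one p w = (\<Sum>k\<le>length w. if k = 0 then p w else 0)"
    unfolding nc_mult_def by (intro sum.cong) (auto simp: nc_one_def)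
  then show "nc_mult nc_one p w = p w" by simp
qed

lemma nc_mult_sum_left:
  "nc_mult (\<lambda>w. \<Sum>\<alpha>\<in>S. c \<alpha> * p \<alpha> w) q w = (\<Sum>\<alpha>\<in>S. c \<alpha> * nc_mult (p \<alpha>) q w)"
  unfolding nc_mult_def sum_distrib_right sum_distrib_left
  by (subst sum.swap) (simp add: mult.assoc)

lemma nc_mult_sum_right:
  "nc_mult p (\<lambda>w. \<Sum>\<alpha>\<in>S. c \<alpha> * q \<alpha> w) w = (\<Sum>\<alpha>\<in>S. c \<alpha> * nc_mult p (q \<alpha>) w)"
  unfolding nc_mult_def sum_distrib_right sum_distrib_left
  by (subst sum.swap) (simp add: mult_ac)

lemma nc_word_append: "nc_word f (\<alpha> @ \<beta>) = nc_mult (nc_word f \<alpha>) (nc_word f \<beta>)"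
  by (induction \<alpha>) (simp_all add: nc_mult_assoc)

lemma nc_word_var: "nc_word nc_var \<alpha> w = (if w = \<alpha> then 1 else 0)"
proof (induction \<alpha> arbitrary: w)
  case (Cons i \<alpha>)
  show ?case
  proof (cases w)
    case Nil
    then show ?thesis
      by (simp add: nc_mult_def nc_var_def)
  next
    case w: (Cons j v)
    have "nc_word nc_var (i # \<alpha>) w = (\<Sum>k\<le>length w. if k = 1 then nc_var i [j] * nc_word nc_var \<alpha> v else 0)"
      unfolding nc_word.simps nc_mult_def
    proof (intro sum.cong refl)
      fix k assume "k \<in> {..length w}"
      then show "nc_var i (take k w) * nc_word nc_var \<alpha> (drop k w) =
          (if k = 1 then nc_var i [j] * nc_word nc_var \<alpha> v else 0)"
        using w by (cases k; cases "k - 1"; cases v) (auto simp: nc_var_def)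
    qed
    also have "\<dots> = nc_var i [j] * nc_word nc_var \<alpha> v"
      using w by (simp add: Suc_le_eq)
    finally show ?thesis
      unfolding w Cons nc_var_def by auto
  qed
qed (simp add: nc_one_def)

section \<open>Case (A): substitution into polynomials\<close>

lemma poly_comp_superset:
  assumes "finite S" "\<And>\<alpha>. p \<alpha> \<noteq> 0 \<Longrightarrow> \<alpha> \<in> S"
  shows "poly_comp p f w = (\<Sum>\<alpha>\<in>S. p \<alpha> * nc_word f \<alpha> w)"
  unfolding poly_comp_def using assms by (intro sum.mono_neutral_left) auto

lemma nc_polynomial_mult:
  assumes "nc_polynomial p" "nc_polynomial q"
  shows "nc_polynomial (nc_mult p q)"
proof -
  have "{w. nc_mult p q w \<noteq> 0} \<subseteq> (\<lambda>(u, v). u @ v) ` ({u. p u \<noteq> 0} \<times> {v. q v \<noteq> 0})"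
  proof (rule subsetI)
    fix w assume "w \<in> {w. nc_mult p q w \<noteq> 0}"
    then have "\<exists>s\<in>{(u, v). u @ v = w}. p (fst s) * q (snd s) \<noteq> 0"
      unfolding nc_mult_splits split_def by (metis (mono_tags, lifting) mem_Collect_eq sum.neutral)
    then show "w \<in> (\<lambda>(u, v). u @ v) ` ({u. p u \<noteq> 0} \<times> {v. q v \<noteq> 0})"
      by force
  qed
  then show ?thesis
    using assms unfolding nc_polynomial_def by (auto intro: finite_subset)
qed

lemma nc_polynomial_word:
  assumes "\<And>j. nc_polynomial (f j)"
  shows "nc_polynomial (nc_word f \<alpha>)"
proof (induction \<alpha>)
  case Nil
  have "{w. nc_one w \<noteq> 0} \<subseteq> {[]}"
    by (auto simp: nc_one_def)
  then show ?case
    by (auto simp: nc_polynomial_def intro: finite_subset)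
qed (simp add: nc_polynomial_mult assms)

text \<open>Substitution turns concatenation of words into products. Grouping pairs of words by
  their concatenation also accounts for cancellations in the coefficients of the product.\<close>

lemma poly_comp_mult:
  assumes p: "nc_polynomial p" and q: "nc_polynomial q"
  shows "poly_comp (nc_mult p q) g = nc_mult (poly_comp p g) (poly_comp q g)"
proof
  fix w
  let ?P = "{u. p u \<noteq> 0}" and ?Q = "{v. q v \<noteq> 0}"
  let ?S = "(\<lambda>(u, v). u @ v) ` (?P \<times> ?Q)"
  have fin: "finite ?P" "finite ?Q"
    using p q by (auto simp: nc_polynomial_def)
  have coeff: "nc_mult p q \<gamma> = (\<Sum>s\<in>{s \<in> ?P \<times> ?Q. fst s @ snd s = \<gamma>}. p (fst s) * q (snd s))" for \<gamma>
    unfolding nc_mult_splits split_def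
    by (rule sum.mono_neutral_right) (use finite_splits[of \<gamma>] in \<open>auto simp: split_def\<close>)
  have "\<gamma> \<in> ?S" if "nc_mult p q \<gamma> \<noteq> 0" for \<gamma>
  proof (rule ccontr)
    assume "\<gamma> \<notin> ?S"
    then have "{s \<in> ?P \<times> ?Q. fst s @ snd s = \<gamma>} = {}"
      by force
    then show False
      using that unfolding coeff by (simp only: sum.empty)
  qed
  then have "poly_comp (nc_mult p q) g w = (\<Sum>\<gamma>\<in>?S. nc_mult p q \<gamma> * nc_word g \<gamma> w)"
    using fin by (intro poly_comp_superset) auto
  also have "\<dots> = (\<Sum>\<gamma>\<in>?S. \<Sum>s\<in>{s \<in> ?P \<times> ?Q. fst s @ snd s = \<gamma>}.
      p (fst s) * q (snd s) * nc_word g (fst s @ snd s) w)"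
    unfolding coeff sum_distrib_right by (intro sum.cong refl) auto
  also have "\<dots> = (\<Sum>s\<in>?P \<times> ?Q. p (fst s) * q (snd s) * nc_word g (fst s @ snd s) w)"
    using fin by (intro sum.group) auto
  also have "\<dots> = (\<Sum>u\<in>?P. \<Sum>v\<in>?Q. p u * (q v * nc_mult (nc_word g u) (nc_word g v) w))"
    by (simp add: sum.cartesian_product split_def nc_word_append mult.assoc)
  also have "\<dots> = (\<Sum>u\<in>?P. p u * nc_mult (nc_word g u) (poly_comp q g) w)"
    unfolding poly_comp_def[of q, abs_def] nc_mult_sum_right sum_distrib_left ..
  also have "\<dots> = nc_mult (poly_comp p g) (poly_comp q g) w"
    unfolding poly_comp_def[of p, abs_def] nc_mult_sum_left ..
  finally show "poly_comp (nc_mult p q) g w = nc_mult (poly_comp p g) (poly_comp q g) w" .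
qed

lemma poly_comp_one: "poly_comp nc_one g = nc_one"
proof
  fix w
  show "poly_comp nc_one g w = nc_one w"
    by (subst poly_comp_superset[of "{[]}"]) (auto simp: nc_one_def split: if_splits)
qed

lemma poly_comp_nc_word:
  assumes "\<And>j. nc_polynomial (f j)"
  shows "poly_comp (nc_word f \<alpha>) g = nc_word (\<lambda>j. poly_comp (f j) g) \<alpha>"
  by (induction \<alpha>) (simp_all add: poly_comp_one poly_comp_mult assms nc_polynomial_word)

text \<open>Substituting \<open>g\<close> undoes substituting \<open>f\<close>. Hence polynomials
  are determined by what they become under \<open>f\<close>, which is how case (A) identifies
  coordinates.\<close>

lemma poly_comp_left_inverse:
  assumes p: "nc_polynomial p" and f: "\<And>j. nc_polynomial (f j)"
    and inv: "\<And>j. poly_comp (f j) g = nc_var j"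
  shows "poly_comp (poly_comp p f) g = p"
proof
  fix w
  let ?P = "{\<alpha>. p \<alpha> \<noteq> 0}"
  \<comment> \<open>Contains the support of \<open>poly_comp p f\<close> and of every word in
    \<open>f\<close> that occurs, so that all inner sums have the same range and the summations can
    be interchanged.\<close>
  let ?S = "\<Union>\<alpha>\<in>?P. {\<gamma>. nc_word f \<alpha> \<gamma> \<noteq> 0}"
  have fin: "finite ?P" "finite ?S"
    using p nc_polynomial_word[of f, OF f] by (auto simp: nc_polynomial_def)
  have "poly_comp (poly_comp p f) g w = (\<Sum>\<gamma>\<in>?S. poly_comp p f \<gamma> * nc_word g \<gamma> w)"
  proof (rule poly_comp_superset[OF fin(2)])
    fix \<gamma> assume "poly_comp p f \<gamma> \<noteq> 0"
    then have "\<exists>\<alpha>\<in>?P. p \<alpha> * nc_word f \<alpha> \<gamma> \<noteq> 0"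
      unfolding poly_comp_def by (metis (mono_tags, lifting) sum.neutral)
    then show "\<gamma> \<in> ?S" by auto
  qed
  also have "\<dots> = (\<Sum>\<gamma>\<in>?S. \<Sum>\<alpha>\<in>?P. p \<alpha> * (nc_word f \<alpha> \<gamma> * nc_word g \<gamma> w))"
    unfolding poly_comp_def[of p] sum_distrib_right by (simp add: mult.assoc)
  also have "\<dots> = (\<Sum>\<alpha>\<in>?P. p \<alpha> * (\<Sum>\<gamma>\<in>?S. nc_word f \<alpha> \<gamma> * nc_word g \<gamma> w))"
    by (subst sum.swap) (simp add: sum_distrib_left)
  also have "\<dots> = (\<Sum>\<alpha>\<in>?P. p \<alpha> * nc_word nc_var \<alpha> w)"
  proof (intro sum.cong refl)
    fix \<alpha> assume "\<alpha> \<in> ?P"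
    then have "(\<Sum>\<gamma>\<in>?S. nc_word f \<alpha> \<gamma> * nc_word g \<gamma> w) = poly_comp (nc_word f \<alpha>) g w"
      by (intro poly_comp_superset[OF fin(2), symmetric]) auto
    then show "p \<alpha> * (\<Sum>\<gamma>\<in>?S. nc_word f \<alpha> \<gamma> * nc_word g \<gamma> w) = p \<alpha> * nc_word nc_var \<alpha> w"
      by (simp add: poly_comp_nc_word[of f, OF f] inv)
  qed
  also have "\<dots> = p w"
    using fin(1) by (simp add: nc_word_var if_distrib cong: if_cong)
  finally show "poly_comp (poly_comp p f) g w = p w" .
qed

text \<open>Coordinates of the sum of all
  \<open>c\<^sub>\<alpha> f\<^sub>\<alpha>\<^sub>\<beta>\<close>. For \<open>\<gamma>\<close>
  shorter than \<open>\<beta>\<close> the truncated subtraction makes the test compare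
  \<open>\<gamma>\<close> itself with \<open>\<beta>\<close>, which fails as it should.\<close>

definition append_word :: "('n list \<Rightarrow> complex) \<Rightarrow> 'n list \<Rightarrow> 'n list \<Rightarrow> complex"
  where "append_word c \<beta> \<gamma> = (if drop (length \<gamma> - length \<beta>) \<gamma> = \<beta>
    then c (take (length \<gamma> - length \<beta>) \<gamma>) else 0)"

lemma append_word_append [simp]: "append_word c \<beta> (\<alpha> @ \<beta>) = c \<alpha>"
  by (simp add: append_word_def)

lemma append_word_eq_0:
  assumes "\<gamma> \<notin> range (\<lambda>\<alpha>. \<alpha> @ \<beta>)"
  shows "append_word c \<beta> \<gamma> = 0"
proof -
  have "drop (length \<gamma> - length \<beta>) \<gamma> \<noteq> \<beta>"
    using assms by (metis append_take_drop_id rangeI)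
  then show ?thesis by (simp add: append_word_def)
qed

text \<open>Reindexing by \<gamma> = \<alpha>\<beta>. The ranges \<open>S\<close> and
  \<open>R\<close> are compared only where the terms are nonzero, so that in case (S) the same
  length bound can serve on both sides.\<close>

lemma sum_append_word:
  fixes F :: "'n list \<Rightarrow> 'a::chilbert_space"
  assumes "finite S" "\<And>\<alpha>. c \<alpha> \<noteq> 0 \<Longrightarrow> F (\<alpha> @ \<beta>) \<noteq> 0 \<Longrightarrow> \<alpha> @ \<beta> \<in> S \<longleftrightarrow> \<alpha> \<in> R" "finite R"
  shows "(\<Sum>\<gamma>\<in>S. append_word c \<beta> \<gamma> *\<^sub>C F \<gamma>) = (\<Sum>\<alpha>\<in>R. c \<alpha> *\<^sub>C F (\<alpha> @ \<beta>))"
proof -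
  let ?h = "\<lambda>\<alpha>. c \<alpha> *\<^sub>C F (\<alpha> @ \<beta>)" and ?e = "\<lambda>\<alpha>. \<alpha> @ \<beta>"
  have h: "?h \<alpha> \<noteq> 0 \<Longrightarrow> \<alpha> @ \<beta> \<in> S \<longleftrightarrow> \<alpha> \<in> R" for \<alpha>
    using assms(2)[of \<alpha>] by force
  have "(\<Sum>\<gamma>\<in>S. append_word c \<beta> \<gamma> *\<^sub>C F \<gamma>) =
      (\<Sum>\<gamma>\<in>?e ` {\<alpha> \<in> R. ?h \<alpha> \<noteq> 0}. append_word c \<beta> \<gamma> *\<^sub>C F \<gamma>)"
  proof (rule sum.mono_neutral_right[OF assms(1)])
    show "?e ` {\<alpha> \<in> R. ?h \<alpha> \<noteq> 0} \<subseteq> S"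
      using h by auto
    show "\<forall>\<gamma>\<in>S - ?e ` {\<alpha> \<in> R. ?h \<alpha> \<noteq> 0}. append_word c \<beta> \<gamma> *\<^sub>C F \<gamma> = 0"
    proof
      fix \<gamma> assume "\<gamma> \<in> S - ?e ` {\<alpha> \<in> R. ?h \<alpha> \<noteq> 0}"
      then show "append_word c \<beta> \<gamma> *\<^sub>C F \<gamma> = 0"
        using h by (cases "\<gamma> \<in> range ?e") (auto simp: append_word_eq_0)
    qed
  qed
  also have "\<dots> = (\<Sum>\<alpha>\<in>{\<alpha> \<in> R. ?h \<alpha> \<noteq> 0}. ?h \<alpha>)"
    by (subst sum.reindex) (auto simp: inj_on_def)
  also have "\<dots> = (\<Sum>\<alpha>\<in>R. ?h \<alpha>)"
    using assms(3) by (intro sum.mono_neutral_left) auto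
  finally show ?thesis .
qed

lemmas sum_append_word_complex = sum_append_word[where 'a = complex, unfolded scaleC_complex_def]

lemma append_word_eq_nc_mult: "append_word c \<beta> = nc_mult c (nc_word nc_var \<beta>)"
proof
  fix \<gamma>
  have "nc_mult c (nc_word nc_var \<beta>) \<gamma> =
      (\<Sum>k\<le>length \<gamma>. if k = length \<gamma> - length \<beta> then append_word c \<beta> \<gamma> else 0)"
    unfolding nc_mult_def by (intro sum.cong) (auto simp: nc_word_var append_word_def)
  then show "append_word c \<beta> \<gamma> = nc_mult c (nc_word nc_var \<beta>) \<gamma>"
    by simp
qed

text \<open>Both sides are polynomials that become \<open>Z\<^sub>i f\<^sub>\<beta>\<close> under
  substitution of \<open>f\<close>; \<open>poly_comp_left_inverse\<close> then identifies
  them.\<close>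

lemma left_mult_A_coord:
  assumes "model_A f a M"
  shows "coord (M i (ket \<beta>)) = append_word (coord (a i)) \<beta>"
proof -
  obtain g where f: "\<And>j. nc_polynomial (f j)" and g: "\<And>j. poly_comp (f j) g = nc_var j"
    using assms unfolding model_A_def by blast
  have a: "nc_polynomial (coord (a i))" "poly_comp (coord (a i)) f = nc_var i"
    and M: "left_mult_A f (nc_var i) (M i)"
    using assms unfolding model_A_def by blast+
  have "{\<alpha>. coord (ket \<beta>) \<alpha> \<noteq> 0} = {\<beta>}"
    by (auto simp: coord_ket)
  then have ket: "nc_polynomial (coord (ket \<beta>))" "poly_comp (coord (ket \<beta>)) f = nc_word f \<beta>"
    by (auto simp: nc_polynomial_def poly_comp_def fun_eq_iff coord_ket)
  then have p1: "nc_polynomial (coord (M i (ket \<beta>)))"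
    and c1: "poly_comp (coord (M i (ket \<beta>))) f = nc_mult (nc_var i) (nc_word f \<beta>)"
    using M unfolding left_mult_A_def by auto
  have app: "append_word (coord (a i)) \<beta> = nc_mult (coord (a i)) (coord (ket \<beta>))"
    unfolding append_word_eq_nc_mult by (simp add: nc_word_var[abs_def] ket.rep_eq)
  have p2: "nc_polynomial (append_word (coord (a i)) \<beta>)"
    and "poly_comp (append_word (coord (a i)) \<beta>) f = nc_mult (nc_var i) (nc_word f \<beta>)"
    unfolding app by (simp_all add: nc_polynomial_mult poly_comp_mult a ket)
  with c1 show ?thesis
    using poly_comp_left_inverse[OF p1, of f g] poly_comp_left_inverse[OF p2, of f g] f g by metis
qed

section \<open>Case (S): triangularity in the degree\<close>

lemma nc_word_degree:
  assumes "\<And>j. f j [] = 0"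
  shows "length w < length \<alpha> \<Longrightarrow> nc_word f \<alpha> w = 0"
proof (induction \<alpha> arbitrary: w)
  case (Cons i \<alpha>)
  have "f i (take k w) * nc_word f \<alpha> (drop k w) = 0" if "k \<le> length w" for k
    using Cons that assms[of i] by (cases k) auto
  then show ?case
    unfolding nc_word.simps nc_mult_def by (intro sum.neutral) simp
qed simp

text \<open>The lowest-degree part of a product of the series is the product of their linear parts:
  a split that gives the first factor no letter meets f(0) = 0, and one that gives it two or more
  leaves too short a word for the others.\<close>

lemma nc_word_Cons_leading:
  assumes f: "\<And>j. f j [] = 0" and len: "length w = length \<alpha>"
  shows "nc_word f (i # \<alpha>) (j # w) = f i [j] * nc_word f \<alpha> w"
proof -
  have "nc_word f (i # \<alpha>) (j # w) =
      (\<Sum>k\<le>length (j # w). if k = 1 then f i [j] * nc_word f \<alpha> w else 0)"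
    unfolding nc_word.simps nc_mult_def
  proof (intro sum.cong refl)
    fix k assume k: "k \<in> {..length (j # w)}"
    consider "k = 0" | "k = 1" | l where "k = Suc (Suc l)"
      by (metis One_nat_def not0_implies_Suc)
    then show "f i (take k (j # w)) * nc_word f \<alpha> (drop k (j # w)) =
        (if k = 1 then f i [j] * nc_word f \<alpha> w else 0)"
    proof cases
      case 3
      then have "nc_word f \<alpha> (drop k (j # w)) = 0"
        using k len by (intro nc_word_degree f) auto
      with 3 show ?thesis by simp
    qed (simp_all add: f)
  qed
  also have "\<dots> = f i [j] * nc_word f \<alpha> w"
    by (simp add: Suc_le_eq)
  finally show ?thesis .
qed

text \<open>In degree \<open>k\<close> the leading parts of the \<open>f\<^sub>\<alpha>\<close>
  arise from the monomials by the \<open>k\<close>-th tensor power of the Jacobian. The induction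
  inverts one tensor factor at a time, beginning with the first letter.\<close>

lemma leading_part_injective:
  fixes f :: "'n::finite \<Rightarrow> 'n ncps"
  assumes f: "\<And>j. f j [] = 0" and J: "det (\<chi> i j. f i [j]) \<noteq> 0"
    and zero: "\<And>w. length w = k \<Longrightarrow> (\<Sum>\<alpha> | length \<alpha> = k. x \<alpha> * nc_word f \<alpha> w) = 0"
  shows "length \<alpha> = k \<Longrightarrow> x \<alpha> = 0"
  using zero
proof (induction k arbitrary: x \<alpha>)
  case 0
  have "{\<alpha> :: 'n list. length \<alpha> = 0} = {[]}" by auto
  then show ?case
    using 0(1) 0(2)[of "[]"] by (simp add: nc_one_def)
next
  case (Suc k)
  obtain B where B: "(\<chi> i j. f i [j]) ** B = mat 1"
    using J unfolding invertible_det_nz[symmetric] invertible_def by blast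
  have "(\<Sum>\<beta> | length \<beta> = k. x (m # \<beta>) * nc_word f \<beta> w) = 0" if w: "length w = k" for m w
  proof -
    define v where "v i = (\<Sum>\<beta> | length \<beta> = k. x (i # \<beta>) * nc_word f \<beta> w)" for i
    have "(\<Sum>i\<in>UNIV. f i [j] * v i) = 0" for j
    proof -
      have "(\<Sum>i\<in>UNIV. f i [j] * v i) =
          (\<Sum>i\<in>UNIV. \<Sum>\<beta> | length \<beta> = k. x (i # \<beta>) * nc_word f (i # \<beta>) (j # w))"
        unfolding v_def sum_distrib_left
        using w by (intro sum.cong refl) (simp only: mem_Collect_eq nc_word_Cons_leading[of f, OF f] mult_ac)
      also have "\<dots> = 0"
        using Suc.prems(2)[of "j # w"] w unfolding sum_words_Cons by simp
      finally show ?thesis .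
    qed
    \<comment> \<open>The column \<open>m\<close> of the right inverse \<open>B\<close> of the
      Jacobian isolates \<open>v m\<close>.\<close>
    then have "0 = (\<Sum>j\<in>UNIV. (\<Sum>i\<in>UNIV. f i [j] * v i) * B $ j $ m)"
      by simp
    also have "\<dots> = (\<Sum>i\<in>UNIV. v i * (\<Sum>j\<in>UNIV. f i [j] * B $ j $ m))"
      unfolding sum_distrib_left sum_distrib_right by (subst sum.swap) (simp add: mult_ac)
    also have "\<dots> = (\<Sum>i\<in>UNIV. v i * (mat 1 $ i $ m))"
      unfolding B[symmetric] matrix_matrix_mult_def by simp
    also have "\<dots> = v m"
      by (simp add: mat_def if_distrib cong: if_cong)
    finally show ?thesis by (simp add: v_def)
  qed
  then have "x (m # \<beta>) = 0" if "length \<beta> = k" for m \<beta>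
    using Suc.IH[of \<beta> "\<lambda>\<beta>. x (m # \<beta>)"] that by blast
  then show ?case
    using Suc.prems(1) by (cases \<alpha>) auto
qed

text \<open>Triangular system: once all shorter coefficients vanish, the coefficients of the series
  in degree |\<alpha>| see only leading parts.\<close>

lemma series_injective:
  fixes f :: "'n::finite \<Rightarrow> 'n ncps"
  assumes f: "\<And>j. f j [] = 0" and J: "det (\<chi> i j. f i [j]) \<noteq> 0"
    and zero: "\<And>w. (\<Sum>\<alpha> | length \<alpha> \<le> length w. x \<alpha> * nc_word f \<alpha> w) = 0"
  shows "x \<alpha> = 0"
proof (induction "length \<alpha>" arbitrary: \<alpha> rule: less_induct)
  case less
  show ?case
  proof (rule leading_part_injective[OF f J _ refl])
    fix w :: "'n list" assume w: "length w = length \<alpha>"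
    have "(\<Sum>\<gamma> | length \<gamma> = length \<alpha>. x \<gamma> * nc_word f \<gamma> w) =
        (\<Sum>\<gamma> | length \<gamma> \<le> length w. x \<gamma> * nc_word f \<gamma> w)"
      using less w by (intro sum.mono_neutral_left finite_words_le) (auto simp: less_le)
    then show "(\<Sum>\<gamma> | length \<gamma> = length \<alpha>. x \<gamma> * nc_word f \<gamma> w) = 0"
      using zero[of w] by simp
  qed
qed

lemma left_mult_S_coord:
  fixes f :: "'n::finite \<Rightarrow> 'n ncps"
  assumes "model_S f a M"
  shows "coord (M i (ket \<beta>)) = append_word (coord (a i)) \<beta>"
proof -
  have f: "\<And>j. f j [] = 0" and J: "det (\<chi> i j. f i [j]) \<noteq> 0"
    and a: "series_of f (a i) = nc_var i" and M: "left_mult_S f (nc_var i) (M i)"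
    using assms unfolding model_S_def by blast+
  note deg = nc_word_degree[of f, OF f]
  have ket: "series_of f (ket \<beta>) = nc_word f \<beta>"
  proof
    fix w
    have "series_of f (ket \<beta>) w = (\<Sum>\<alpha> | length \<alpha> \<le> length w. if \<alpha> = \<beta> then nc_word f \<beta> w else 0)"
      unfolding series_of_def by (intro sum.cong) (auto simp: coord_ket)
    also have "\<dots> = nc_word f \<beta> w"
      using deg[of w \<beta>] by (simp add: finite_words_le)
    finally show "series_of f (ket \<beta>) w = nc_word f \<beta> w" .
  qed
  have 1: "series_of f (M i (ket \<beta>)) w = nc_mult (nc_var i) (nc_word f \<beta>) w" for w
    using M unfolding left_mult_S_def ket[symmetric] by simp
  have 2: "(\<Sum>\<gamma> | length \<gamma> \<le> length w. append_word (coord (a i)) \<beta> \<gamma> * nc_word f \<gamma> w) =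
      nc_mult (nc_var i) (nc_word f \<beta>) w" for w
  proof -
    \<comment> \<open>One range for all prefixes of \<open>w\<close>; the words that are longer than
      a given prefix contribute 0 there.\<close>
    let ?R = "{\<alpha> :: 'n list. length \<alpha> \<le> length w}"
    have "(\<Sum>\<gamma> | length \<gamma> \<le> length w. append_word (coord (a i)) \<beta> \<gamma> * nc_word f \<gamma> w) =
        (\<Sum>\<alpha>\<in>?R. coord (a i) \<alpha> * nc_word f (\<alpha> @ \<beta>) w)"
      using deg by (intro sum_append_word_complex finite_words_le) (force simp: not_le)
    also have "\<dots> = nc_mult (\<lambda>u. \<Sum>\<alpha>\<in>?R. coord (a i) \<alpha> * nc_word f \<alpha> u) (nc_word f \<beta>) w"
      by (simp add: nc_mult_sum_left nc_word_append)
    also have "\<dots> = nc_mult (series_of f (a i)) (nc_word f \<beta>) w"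
      unfolding nc_mult_def series_of_def
    proof (rule sum.cong[OF refl], rule arg_cong2[where f = times, OF _ refl])
      fix k
      have "nc_word f \<alpha> (take k w) = 0" if "\<alpha> \<in> ?R - {\<alpha>. length \<alpha> \<le> length (take k w)}" for \<alpha>
        by (rule deg) (use that in \<open>simp only: Diff_iff mem_Collect_eq not_le\<close>)
      then show "(\<Sum>\<alpha>\<in>?R. coord (a i) \<alpha> * nc_word f \<alpha> (take k w)) =
          (\<Sum>\<alpha> | length \<alpha> \<le> length (take k w). coord (a i) \<alpha> * nc_word f \<alpha> (take k w))"
        by (intro sum.mono_neutral_right finite_words_le) auto
    qed
    finally show ?thesis by (simp add: a)
  qed
  have "coord (M i (ket \<beta>)) \<gamma> - append_word (coord (a i)) \<beta> \<gamma> = 0" for \<gamma>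
    by (rule series_injective[of f, OF f J])
      (use 1 2 in \<open>simp add: left_diff_distrib sum_subtractf series_of_def\<close>)
  then show ?thesis
    by auto
qed

section \<open>Case (F): values of free holomorphic functions\<close>

lemma finite_words_less: "finite {\<alpha> :: 'n::finite list. length \<alpha> < N}"
  by (rule finite_subset[OF _ finite_words_le[of N]]) auto

lemma bounded_clinear_partial_eval:
  assumes "\<And>i. bounded_clinear (X i)"
  shows "bounded_clinear (partial_eval c X N)"
  unfolding partial_eval_def[abs_def]
  by (rule bounded_clinear_sum, rule bounded_clinear_sum, rule bounded_clinear_scaleC_op,
      rule bounded_clinear_word_op, rule assms)

lemma partial_eval_eq_sum:
  "partial_eval c X N h = (\<Sum>\<alpha> :: 'n::finite list | length \<alpha> < N. c \<alpha> *\<^sub>C word_op X \<alpha> h)"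
proof -
  have "(\<Sum>k\<in>{..<N}. \<Sum>\<alpha>\<in>{\<alpha> \<in> {\<alpha>. length \<alpha> < N}. length \<alpha> = k}. c \<alpha> *\<^sub>C word_op X \<alpha> h) =
      (\<Sum>\<alpha> | length \<alpha> < N. c \<alpha> *\<^sub>C word_op X \<alpha> h)"
    by (intro sum.group finite_words_less) auto
  moreover have "{\<alpha> \<in> {\<alpha> :: 'n list. length \<alpha> < N}. length \<alpha> = k} = {\<alpha>. length \<alpha> = k}"
    if "k < N" for k
    using that by auto
  ultimately show ?thesis
    by (simp add: partial_eval_def)
qed

lemma norm_tendsto_pointwise:
  assumes "norm_tendsto A L F" "\<And>t. bounded_clinear (A t)"
  shows "((\<lambda>t. A t h) \<longlongrightarrow> L h) F"
proof -
  have L: "bounded_clinear L" and lim: "((\<lambda>t. onorm (\<lambda>h. A t h - L h)) \<longlongrightarrow> 0) F"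
    using assms(1) by (auto simp: norm_tendsto_def)
  have "norm (A t h - L h) \<le> onorm (\<lambda>h. A t h - L h) * norm h" for t
    by (rule onorm[OF bounded_clinearD[OF bounded_clinear_diff[OF assms(2) L]]])
  then have "((\<lambda>t. A t h - L h) \<longlongrightarrow> 0) F"
    by (intro Lim_null_comparison[OF always_eventually tendsto_mult_left_zero[OF lim, of "norm h"]])
      blast
  then show ?thesis
    by (rule Lim_null[THEN iffD2])
qed

lemma norm_eval_unique:
  assumes "norm_eval c X L" "norm_eval c X L'" "\<And>i. bounded_clinear (X i)"
  shows "L = L'"
proof
  fix h
  note B = bounded_clinear_partial_eval[of X, OF assms(3)]
  show "L h = L' h"
    using norm_tendsto_pointwise[OF assms(1)[unfolded norm_eval_def] B, of h]
      norm_tendsto_pointwise[OF assms(2)[unfolded norm_eval_def] B, of h]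
    by (rule LIMSEQ_unique)
qed

lemma hol_eval_eqI:
  assumes "norm_eval c X L" "\<And>i. bounded_clinear (X i)"
  shows "hol_eval c X = L"
  unfolding hol_eval_def using norm_eval_unique[OF _ assms] assms(1) by (intro the_equality)

lemma hol_eval_indicator:
  assumes "\<And>i. bounded_clinear (X i)"
  shows "hol_eval (\<lambda>\<alpha>. if \<alpha> = \<beta> then 1 else 0) X = word_op X \<beta>"
proof (rule hol_eval_eqI)
  let ?c = "\<lambda>\<alpha>. if \<alpha> = \<beta> then 1 else 0"
  have "partial_eval ?c X N h = word_op X \<beta> h" if "length \<beta> < N" for N h
  proof -
    have "partial_eval ?c X N h = (\<Sum>\<alpha> | length \<alpha> < N. if \<alpha> = \<beta> then word_op X \<beta> h else 0)"
      unfolding partial_eval_eq_sum by (intro sum.cong) auto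
    then show ?thesis
      using that by (simp add: finite_words_less)
  qed
  then have "\<forall>\<^sub>F N in sequentially. 0 = onorm (\<lambda>h. partial_eval ?c X N h - word_op X \<beta> h)"
    by (intro eventually_mono[OF eventually_gt_at_top[of "length \<beta>"]]) (simp add: onorm_zero)
  then show "norm_eval ?c X (word_op X \<beta>)"
    unfolding norm_eval_def norm_tendsto_def
    by (auto intro: Lim_transform_eventually[OF tendsto_const] bounded_clinear_word_op assms)
qed (rule assms)

text \<open>With the first letter split off, the sum is the row applied to the vector of the sums
  for the remaining letters, and each letter costs one factor \<open>q\<close>. The triangle
  inequality would lose a factor that grows with the number of words.\<close>

lemma norm_homogeneous_part_le:
  fixes X :: "'n::finite \<Rightarrow> 'h \<Rightarrow> 'h::chilbert_space"
  assumes X: "\<And>v. norm (row_op X v) \<le> q * norm v" and q: "q \<ge> 0"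
    and lin: "\<And>i. bounded_clinear (X i)"
  shows "(norm (\<Sum>\<alpha> | length \<alpha> = k. c \<alpha> *\<^sub>C word_op X \<alpha> h))\<^sup>2 \<le>
    (q ^ k)\<^sup>2 * (\<Sum>\<alpha> | length \<alpha> = k. (cmod (c \<alpha>))\<^sup>2) * (norm h)\<^sup>2"
proof (induction k arbitrary: c)
  case 0
  have "{\<alpha> :: 'n list. length \<alpha> = 0} = {[]}" by auto
  then show ?case by (simp add: power_mult_distrib)
next
  case (Suc k)
  define v where "v = (\<chi> i. \<Sum>\<beta> | length \<beta> = k. c (i # \<beta>) *\<^sub>C word_op X \<beta> h)"
  have "(\<Sum>\<alpha> | length \<alpha> = Suc k. c \<alpha> *\<^sub>C word_op X \<alpha> h) = row_op X v"
    unfolding sum_words_Cons row_op_def v_def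
    by (simp add: bounded_clinear_simps[OF lin])
  also have "(norm (row_op X v))\<^sup>2 \<le> (q * norm v)\<^sup>2"
    by (intro power_mono X) simp
  also have "\<dots> = q\<^sup>2 * (\<Sum>i\<in>UNIV. (norm (v $ i))\<^sup>2)"
    by (simp add: power_mult_distrib norm_vec_sq)
  also have "\<dots> \<le> q\<^sup>2 * (\<Sum>i\<in>UNIV. (q ^ k)\<^sup>2 * (\<Sum>\<beta> | length \<beta> = k. (cmod (c (i # \<beta>)))\<^sup>2) * (norm h)\<^sup>2)"
    unfolding v_def using Suc.IH by (intro mult_left_mono sum_mono) auto
  also have "\<dots> = (q ^ Suc k)\<^sup>2 * (\<Sum>\<alpha> | length \<alpha> = Suc k. (cmod (c \<alpha>))\<^sup>2) * (norm h)\<^sup>2"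
    unfolding sum_words_Cons
    by (simp add: power_mult_distrib mult_ac flip: sum_distrib_left sum_distrib_right)
  finally show ?case .
qed

text \<open>Square-summable coefficients and a row of norm \<open>q < 1\<close> bound the
  homogeneous parts by a geometric series. The norm limit behind \<open>hol_eval\<close> thus
  exists, and the definite description denotes it.\<close>

lemma hol_eval_pointwise:
  assumes X: "X \<in> op_ball 1" and c: "sq_summable c"
  shows "(\<lambda>N. partial_eval c X N h) \<longlonglongrightarrow> hol_eval c X h"
proof -
  have lin: "\<And>i. bounded_clinear (X i)" and q1: "onorm (row_op X) < 1"
    using X by (auto simp: op_ball_def op_tuples_def)
  define q where "q = onorm (row_op X)"
  have row: "bounded_linear (row_op X)"
    unfolding row_op_def[abs_def]
    by (intro bounded_clinearD bounded_clinear_sum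
        bounded_clinear_compose[OF lin bounded_clinear_nth])
  have q: "0 \<le> q" "q < 1" "\<And>v. norm (row_op X v) \<le> q * norm v"
    using q1 onorm_pos_le[OF row] onorm[OF row] by (auto simp: q_def)
  define C where "C = norm (Abs_l2 c)"
  define p where "p k h = (\<Sum>\<alpha> | length \<alpha> = k. c \<alpha> *\<^sub>C word_op X \<alpha> h)" for k h
  have p_le: "norm (p k h) \<le> q ^ k * (C * norm h)" for k h
  proof -
    have "(norm (p k h))\<^sup>2 \<le> (q ^ k)\<^sup>2 * (\<Sum>\<alpha> | length \<alpha> = k. (cmod (c \<alpha>))\<^sup>2) * (norm h)\<^sup>2"
      unfolding p_def by (rule norm_homogeneous_part_le[OF q(3,1) lin])
    also have "\<dots> \<le> (q ^ k)\<^sup>2 * C\<^sup>2 * (norm h)\<^sup>2"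
      using sum_coord_le[OF finite_words, of "Abs_l2 c" k]
      by (intro mult_right_mono mult_left_mono) (simp_all add: C_def coord_Abs_l2[OF c])
    also have "\<dots> = (q ^ k * (C * norm h))\<^sup>2"
      by (simp add: power_mult_distrib)
    finally show ?thesis
      by (rule power2_le_imp_le) (use q in \<open>simp add: C_def\<close>)
  qed
  \<comment> \<open>Bounded operators as elements of a Banach space, in which an absolutely
    convergent series has a limit in operator norm.\<close>
  define P where "P k = Blinfun (p k)" for k
  have P: "blinfun_apply (P k) = p k" for k
    unfolding P_def p_def[abs_def]
    by (intro bounded_linear_Blinfun_apply bounded_clinearD bounded_clinear_sum
        bounded_clinear_scaleC_op bounded_clinear_word_op lin)
  have "summable (\<lambda>k. norm (P k))"
  proof (rule summable_comparison_test')
    show "summable (\<lambda>k. q ^ k * C)"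
      using q by (intro summable_mult2 summable_geometric) simp
    show "norm (norm (P k)) \<le> q ^ k * C" for k
      unfolding real_norm_def abs_norm_cancel
      by (rule norm_blinfun_bound) (use q p_le in \<open>simp_all add: P C_def mult.assoc\<close>)
  qed
  then have sums: "(\<lambda>N. \<Sum>k<N. P k) \<longlonglongrightarrow> suminf P"
    by (rule summable_LIMSEQ[OF summable_norm_cancel])
  define L where "L = blinfun_apply (suminf P)"
  have pe: "partial_eval c X N h = blinfun_apply (\<Sum>k<N. P k) h" for N h
    by (simp add: partial_eval_def blinfun.sum_left P p_def)
  have pw: "(\<lambda>N. partial_eval c X N h) \<longlonglongrightarrow> L h" for h
    unfolding pe L_def by (rule bounded_linear.tendsto[OF blinfun.bounded_linear_left sums])
  have "bounded_clinear L"
    unfolding bounded_clinear_def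
  proof (intro conjI allI)
    show "L (a *\<^sub>C x) = a *\<^sub>C L x" for a x
      by (rule LIMSEQ_unique[OF pw[of "a *\<^sub>C x"]])
        (simp add: bounded_clinear_scaleC[OF bounded_clinear_partial_eval[of X, OF lin]]
          bounded_linear.tendsto[OF bounded_linear_scaleC pw])
  qed (simp add: L_def blinfun.bounded_linear_right)
  moreover have "(\<lambda>N. onorm (\<lambda>h. partial_eval c X N h - L h)) \<longlonglongrightarrow> 0"
    using tendsto_norm_zero[OF LIM_zero[OF sums]]
    by (simp add: pe L_def norm_blinfun.rep_eq blinfun.diff_left[abs_def])
  ultimately have "norm_eval c X L"
    by (simp add: norm_eval_def norm_tendsto_def)
  then have "hol_eval c X = L"
    by (rule hol_eval_eqI[OF _ lin])
  with pw show ?thesis by simp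
qed

text \<open>Only words \<alpha>\<beta> contribute on the left, so the truncation there exceeds the
  one on the right by |\<beta>|.\<close>

lemma partial_eval_append_word:
  shows "partial_eval (append_word c \<beta>) X (N + length \<beta>) h = partial_eval c X N (word_op X \<beta> h)"
  unfolding partial_eval_eq_sum
  by (subst sum_append_word[where R = "{\<alpha>. length \<alpha> < N}"])
    (simp_all add: finite_words_less word_op_append)

lemma sq_summable_append_word:
  assumes "sq_summable c"
  shows "sq_summable (append_word c \<beta>)"
proof (rule sq_summableI)
  fix F :: "'a list set" assume F: "finite F"
  let ?e = "\<lambda>\<alpha>. \<alpha> @ \<beta>"
  have "(\<Sum>\<gamma>\<in>F. (norm (append_word c \<beta> \<gamma>))\<^sup>2) = (\<Sum>\<gamma>\<in>?e ` (?e -` F). (norm (append_word c \<beta> \<gamma>))\<^sup>2)"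
    by (rule sum.mono_neutral_right[OF F]) (auto intro!: append_word_eq_0)
  also have "\<dots> = (\<Sum>\<alpha>\<in>?e -` F. (norm (c \<alpha>))\<^sup>2)"
    by (subst sum.reindex) (auto simp: inj_on_def)
  also have "\<dots> \<le> (norm (Abs_l2 c))\<^sup>2"
    using sum_coord_le[of "?e -` F" "Abs_l2 c"] F
    by (simp add: finite_vimageI inj_on_def coord_Abs_l2[OF assms])
  finally show "(\<Sum>\<gamma>\<in>F. (norm (append_word c \<beta> \<gamma>))\<^sup>2) \<le> (norm (Abs_l2 c))\<^sup>2" .
qed

lemma nc_radius_ge_1:
  assumes c: "sq_summable c"
  shows "nc_radius c \<ge> 1"
  unfolding nc_radius_def
proof (rule conv_radius_geI_ex)
  fix r :: real assume r: "0 < r" "ereal r < 1"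
  define C where "C = norm (Abs_l2 c)"
  have le: "norm (sqrt (\<Sum>\<alpha> | length \<alpha> = k. (cmod (c \<alpha>))\<^sup>2) * r ^ k) \<le> C * r ^ k" for k
  proof -
    have "sqrt (\<Sum>\<alpha> | length \<alpha> = k. (cmod (c \<alpha>))\<^sup>2) \<le> C"
      using sum_coord_le[OF finite_words, of "Abs_l2 c" k]
      by (intro real_le_lsqrt) (simp_all add: C_def coord_Abs_l2[OF c] sum_nonneg)
    then show ?thesis
      using r by (simp add: abs_mult sum_nonneg mult_right_mono)
  qed
  have "summable (\<lambda>k. C * r ^ k)"
    using r by (intro summable_mult summable_geometric) (simp add: one_ereal_def)
  then have "summable (\<lambda>k. sqrt (\<Sum>\<alpha> | length \<alpha> = k. (cmod (c \<alpha>))\<^sup>2) * r ^ k)"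
    by (rule summable_comparison_test') (rule le)
  then show "\<exists>z. norm z = r \<and> summable (\<lambda>k. sqrt (\<Sum>\<alpha> | length \<alpha> = k. (cmod (c \<alpha>))\<^sup>2) * z ^ k)"
    using r by (intro exI[of _ r]) auto
qed

text \<open>The difference \<open>G\<close> of the two coefficient families is square-summable and
  vanishes at every f(X). By the nondegeneracy condition in \<open>model_F\<close> it is
  zero.\<close>

lemma left_mult_F_coord:
  fixes f :: "'n::finite \<Rightarrow> 'n ncps"
  assumes "model_F f a M"
  shows "coord (M i (ket \<beta>)) = append_word (coord (a i)) \<beta>"
proof -
  obtain \<gamma> where \<gamma>: "\<gamma> > 0"
    and ball: "\<And>X :: 'n ell2_tuple. X \<in> op_ball \<gamma> \<Longrightarrow> (\<lambda>j. hol_eval (f j) X) \<in> op_ball 1"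
    and nondeg: "\<And>G. nc_radius G \<ge> 1 \<Longrightarrow> G \<noteq> (\<lambda>\<alpha>. 0) \<Longrightarrow>
      \<exists>X\<in>op_ball \<gamma> :: 'n ell2_tuple set. hol_eval G (\<lambda>j. hol_eval (f j) X) \<noteq> (\<lambda>h. 0)"
    and a: "\<And>i (X :: 'n ell2_tuple). X \<in> op_ball \<gamma> \<Longrightarrow> hol_eval (coord (a i)) (\<lambda>j. hol_eval (f j) X) = X i"
    and M: "left_mult_F \<gamma> f (nc_var i) (M i)"
    using assms unfolding model_F_def by blast
  define G where "G \<alpha> = coord (M i (ket \<beta>)) \<alpha> - append_word (coord (a i)) \<beta> \<alpha>" for \<alpha>
  have sqa: "sq_summable (append_word (coord (a i)) \<beta>)"
    by (rule sq_summable_append_word) simp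
  have sqG: "sq_summable G"
    unfolding G_def by (rule sq_summable_diff[OF sq_summable_coord sqa])
  have "hol_eval G (\<lambda>j. hol_eval (f j) X) = (\<lambda>h. 0)" if X: "X \<in> op_ball \<gamma>" for X :: "'n ell2_tuple"
  proof
    fix h
    define Z where "Z j = hol_eval (f j) X" for j
    have Z: "Z \<in> op_ball 1"
      using ball[OF X] by (simp add: Z_def[abs_def])
    have linX: "\<And>i. bounded_clinear (X i)" and linZ: "\<And>i. bounded_clinear (Z i)"
      using X Z by (auto simp: op_ball_def op_tuples_def)
    have var: "hol_eval (nc_var i) X = X i"
      using hol_eval_indicator[of X "[i]", OF linX] by (simp add: nc_var_def[abs_def] o_def)
    have ket: "hol_eval (coord (ket \<beta>)) Z = word_op Z \<beta>"
      using hol_eval_indicator[of Z \<beta>, OF linZ] by (simp add: ket.rep_eq)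
    have "hol_eval (coord (M i (ket \<beta>))) Z = hol_eval (nc_var i) X \<circ> hol_eval (coord (ket \<beta>)) Z"
      using M X unfolding left_mult_F_def Z_def[abs_def] by blast
    then have "hol_eval (coord (M i (ket \<beta>))) Z = X i \<circ> word_op Z \<beta>"
      unfolding var ket .
    \<comment> \<open>The index shift by \<open>length \<beta>\<close> aligns this sequence with
      \<open>partial_eval_append_word\<close>.\<close>
    then have 1: "(\<lambda>N. partial_eval (coord (M i (ket \<beta>))) Z (N + length \<beta>) h) \<longlonglongrightarrow> X i (word_op Z \<beta> h)"
      using hol_eval_pointwise[OF Z sq_summable_coord, of "M i (ket \<beta>)" h]
      by (intro LIMSEQ_ignore_initial_segment) simp
    have 2: "(\<lambda>N. partial_eval (append_word (coord (a i)) \<beta>) Z (N + length \<beta>) h) \<longlonglongrightarrow> X i (word_op Z \<beta> h)"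
      unfolding partial_eval_append_word
      using hol_eval_pointwise[OF Z sq_summable_coord, of "a i" "word_op Z \<beta> h"] a[OF X, of i]
      by (simp add: Z_def[abs_def])
    have "partial_eval G Z N h = partial_eval (coord (M i (ket \<beta>))) Z N h -
        partial_eval (append_word (coord (a i)) \<beta>) Z N h" for N
    proof -
      have "(c - d) *\<^sub>C k = c *\<^sub>C k - d *\<^sub>C k" for c d and k :: "(nat, complex) l2"
        using scaleC_add_left[of "c - d" d k] by simp
      then show ?thesis
        by (simp add: partial_eval_def G_def sum_subtractf)
    qed
    then have "(\<lambda>N. partial_eval G Z (N + length \<beta>) h) \<longlonglongrightarrow> 0"
      using tendsto_diff[OF 1 2] by simp
    moreover have "(\<lambda>N. partial_eval G Z (N + length \<beta>) h) \<longlonglongrightarrow> hol_eval G Z h"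
      by (intro LIMSEQ_ignore_initial_segment hol_eval_pointwise[OF Z sqG])
    ultimately show "hol_eval G (\<lambda>j. hol_eval (f j) X) h = 0"
      using LIMSEQ_unique by (simp add: Z_def[abs_def])
  qed
  then have "G = (\<lambda>\<alpha>. 0)"
    using nondeg[OF nc_radius_ge_1[OF sqG]] by blast
  then show ?thesis
    by (auto simp: G_def fun_eq_iff)
qed

lemma
  assumes "model_property f a M"
  shows model_coord: "coord (M i (ket \<beta>)) = append_word (coord (a i)) \<beta>"
    and model_bounded: "bounded_clinear (M i)"
proof -
  show "coord (M i (ket \<beta>)) = append_word (coord (a i)) \<beta>"
    using assms left_mult_A_coord left_mult_S_coord left_mult_F_coord
    unfolding model_property_def by metis
  show "bounded_clinear (M i)"
    using assms unfolding model_property_def model_A_def model_S_def model_F_def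
      left_mult_A_def left_mult_S_def left_mult_F_def by blast
qed

section \<open>Evaluation of power series\<close>

lemma sot_eval_unique: "sot_eval c X L \<Longrightarrow> sot_eval c X L' \<Longrightarrow> L = L'"
  unfolding sot_eval_def sot_tendsto_def by (auto intro: LIMSEQ_unique)

lemma rad_eval_unique:
  assumes "rad_eval c X L" "rad_eval c X L'" and X: "\<And>i. bounded_clinear (X i)"
  shows "L = L'"
proof
  fix h
  obtain d P where P: "d \<in> {0<..<1}" "\<And>r. r \<in> {d<..<1} \<Longrightarrow> norm_eval c (\<lambda>i h. r *\<^sub>R X i h) (P r)"
    "sot_tendsto P L (at_left 1)"
    using assms(1) unfolding rad_eval_def by blast
  obtain d' P' where P': "d' \<in> {0<..<1}" "\<And>r. r \<in> {d'<..<1} \<Longrightarrow> norm_eval c (\<lambda>i h. r *\<^sub>R X i h) (P' r)"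
    "sot_tendsto P' L' (at_left 1)"
    using assms(2) unfolding rad_eval_def by blast
  have "\<forall>\<^sub>F r in at_left (1::real). max d d' < r \<and> r < 1"
    by (rule eventually_at_leftI[of "max d d'"]) (use P(1) P'(1) in auto)
  then have eq: "\<forall>\<^sub>F r in at_left 1. P r h = P' r h"
  proof eventually_elim
    case (elim r)
    then have "P r = P' r"
      by (intro norm_eval_unique[OF P(2) P'(2)]) (auto intro: bounded_clinear_scaleR_op X)
    then show ?case by simp
  qed
  have lim: "((\<lambda>r. P r h) \<longlongrightarrow> L h) (at_left 1)" "((\<lambda>r. P' r h) \<longlongrightarrow> L' h) (at_left 1)"
    using P(3) P'(3) by (auto simp: sot_tendsto_def)
  show "L h = L' h"
    by (rule tendsto_unique[OF trivial_limit_at_left_real Lim_transform_eventually[OF lim(1) eq] lim(2)])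
qed

lemma tuple_eval_sot:
  assumes "X \<in> conv_sot f"
  shows "sot_eval (f j) X (tuple_eval f X j)"
proof -
  obtain L where L: "sot_eval (f j) X L"
    using assms by (auto simp: conv_sot_def)
  then have "(THE Y. sot_eval (f j) X Y) = L"
    using sot_eval_unique by (intro the_equality) blast+
  with L show ?thesis
    using assms by (simp add: tuple_eval_def)
qed

lemma tuple_eval_rad:
  assumes "X \<in> conv_rad f" "X \<notin> conv_sot f"
  shows "rad_eval (f j) X (tuple_eval f X j)"
proof -
  obtain L where L: "rad_eval (f j) X L" and X: "\<And>i. bounded_clinear (X i)"
    using assms(1) by (auto simp: conv_rad_def op_tuples_def)
  then have "(THE Y. rad_eval (f j) X Y) = L"
    using rad_eval_unique by (intro the_equality) blast+
  with L show ?thesis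
    using assms(2) by (simp add: tuple_eval_def)
qed

lemma bounded_tuple_eval:
  assumes "X \<in> conv_sot f \<union> conv_rad f"
  shows "bounded_clinear (tuple_eval f X j)"
proof (cases "X \<in> conv_sot f")
  case True
  then show ?thesis
    using tuple_eval_sot[of X f j] by (simp add: sot_eval_def sot_tendsto_def)
next
  case False
  then show ?thesis
    using assms tuple_eval_rad[of X f j] by (auto simp: rad_eval_def sot_tendsto_def)
qed

lemma nc_domain_row_contraction:
  assumes "T \<in> nc_domain f a"
  shows "row_contraction (tuple_eval f T)"
proof
  have conv: "T \<in> conv_sot f \<union> conv_rad f" and le: "onorm (row_op (tuple_eval f T)) \<le> 1"
    using assms by (auto simp: nc_domain_def inverse_eq_def)
  show b: "bounded_clinear (tuple_eval f T i)" for i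
    by (rule bounded_tuple_eval[OF conv])
  have "bounded_linear (row_op (tuple_eval f T))"
    unfolding row_op_def[abs_def]
    by (intro bounded_clinearD bounded_clinear_sum
        bounded_clinear_compose[OF b bounded_clinear_nth])
  from onorm[OF this] show "norm (row_op (tuple_eval f T) v) \<le> norm v" for v
    by (rule order_trans) (use mult_right_mono[OF le norm_ge_zero[of v]] in simp)
qed

lemma nc_domain_pure_row_contraction:
  assumes "T \<in> nc_domain f a" "pure_tuple f T"
  shows "pure_row_contraction (tuple_eval f T)"
proof -
  interpret row_contraction "tuple_eval f T"
    by (rule nc_domain_row_contraction[OF assms(1)])
  show ?thesis
  proof
    fix h
    let ?A = "\<lambda>\<alpha>. word_op (tuple_eval f T) \<alpha>"
    have "(\<lambda>k. \<Sum>\<alpha> | length \<alpha> = k. ?A \<alpha> (cadjoint (?A \<alpha>) h)) \<longlonglongrightarrow> 0"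
      using assms(2) by (simp add: pure_tuple_def sot_tendsto_def)
    then have "(\<lambda>k. cinner (\<Sum>\<alpha> | length \<alpha> = k. ?A \<alpha> (cadjoint (?A \<alpha>) h)) h) \<longlonglongrightarrow> cinner 0 h"
      by (rule bounded_linear.tendsto[OF bounded_linear_cinner_left])
    moreover have "cinner (\<Sum>\<alpha> | length \<alpha> = k. ?A \<alpha> (cadjoint (?A \<alpha>) h)) h =
        complex_of_real (\<Sum>\<alpha> | length \<alpha> = k. (norm (cadjoint (?A \<alpha>) h))\<^sup>2)" for k
      unfolding cinner_sum_left of_real_sum
      by (simp only: cinner_cadjoint_right[OF bounded_word_op, symmetric] cinner_self)
    ultimately have "(\<lambda>k. complex_of_real (\<Sum>\<alpha> | length \<alpha> = k. (norm (cadjoint (?A \<alpha>) h))\<^sup>2)) \<longlonglongrightarrow>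
        complex_of_real 0"
      by simp
    then show "(\<lambda>k. \<Sum>\<alpha> | length \<alpha> = k. (norm (cadjoint (?A \<alpha>) h))\<^sup>2) \<longlonglongrightarrow> 0"
      by (simp only: tendsto_of_real_iff)
  qed
qed

lemma word_op_scaleR:
  assumes "\<And>i. bounded_clinear (X i)"
  shows "word_op (\<lambda>i h. r *\<^sub>R X i h) \<alpha> h = r ^ length \<alpha> *\<^sub>R word_op X \<alpha> h"
  by (induction \<alpha>) (simp_all add: bounded_clinear_simps[OF assms])

lemma partial_eval_scaleR:
  assumes "\<And>i. bounded_clinear (X i)"
  shows "partial_eval c (\<lambda>i h. r *\<^sub>R X i h) N h =
    partial_eval (\<lambda>\<alpha>. complex_of_real (r ^ length \<alpha>) * c \<alpha>) X N h"
  unfolding partial_eval_def word_op_scaleR[of X, OF assms]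
  by (simp add: scaleR_scaleC scaleC_scaleC mult.commute)

text \<open>As \<open>K\<^sup>*\<close> sends \<open>f\<^sub>\<gamma> \<otimes> k\<close> to
  \<open>Y\<^sub>\<gamma> \<Delta> k\<close>, pairing the sum of the
  \<open>c\<^sub>\<alpha> f\<^sub>\<alpha>\<^sub>\<beta> \<otimes> k\<close> with K h evaluates
  \<open>c\<close> at \<open>Y\<close> weakly. For square-summable \<open>c\<close> and a row of
  norm 1 this weak convergence is available without any on the operators themselves.\<close>

lemma (in row_contraction) cinner_partial_eval_tendsto:
  assumes c: "sq_summable c"
  shows "(\<lambda>N. cinner (partial_eval c Y N (word_op Y \<beta> (row_defect Y k))) h) \<longlonglongrightarrow>
    cinner (tensor (Abs_l2 (append_word c \<beta>)) k) (poisson Y h)"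
proof -
  let ?u = "tensor (Abs_l2 (append_word c \<beta>)) k"
  have cu: "coord ?u \<gamma> = append_word c \<beta> \<gamma> *\<^sub>C k" for \<gamma>
    by (simp add: coord_tensor coord_Abs_l2 sq_summable_append_word[OF c])
  have term_eq: "cinner (coord ?u \<gamma>) (coord (poisson Y h) \<gamma>) =
      append_word c \<beta> \<gamma> * cinner (word_op Y \<gamma> (row_defect Y k)) h" for \<gamma>
    unfolding cu coord_poisson_eq cinner_scaleC_left
    by (simp add: defect_cinner[symmetric] cinner_cadjoint_right[OF bounded_word_op])
  have "(\<lambda>N. \<Sum>\<gamma> | length \<gamma> \<le> N. append_word c \<beta> \<gamma> * cinner (word_op Y \<gamma> (row_defect Y k)) h)
      \<longlonglongrightarrow> cinner ?u (poisson Y h)"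
    using has_sum_words_tendsto[OF has_sum_cinner_l2[of ?u "poisson Y h"]] by (simp only: term_eq)
  then have lim: "(\<lambda>N. \<Sum>\<gamma> | length \<gamma> \<le> N + length \<beta>.
      append_word c \<beta> \<gamma> * cinner (word_op Y \<gamma> (row_defect Y k)) h) \<longlonglongrightarrow> cinner ?u (poisson Y h)"
    by (rule LIMSEQ_ignore_initial_segment)
  \<comment> \<open>\<open>partial_eval\<close> sums over lengths strictly below its bound, whence
    \<open>Suc N\<close>.\<close>
  have "(\<Sum>\<gamma> | length \<gamma> \<le> N + length \<beta>.
      append_word c \<beta> \<gamma> * cinner (word_op Y \<gamma> (row_defect Y k)) h) =
      cinner (partial_eval c Y (Suc N) (word_op Y \<beta> (row_defect Y k))) h" for N
  proof -
    have "(\<Sum>\<gamma> | length \<gamma> \<le> N + length \<beta>.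
        append_word c \<beta> \<gamma> * cinner (word_op Y \<gamma> (row_defect Y k)) h) =
        (\<Sum>\<alpha> | length \<alpha> \<le> N. c \<alpha> * cinner (word_op Y (\<alpha> @ \<beta>) (row_defect Y k)) h)"
      by (rule sum_append_word_complex) (auto simp: finite_words_le)
    also have "\<dots> = cinner (partial_eval c Y (Suc N) (word_op Y \<beta> (row_defect Y k))) h"
      by (simp add: partial_eval_eq_sum cinner_sum_left cinner_scaleC_left word_op_append less_Suc_eq_le)
    finally show ?thesis .
  qed
  with lim have "(\<lambda>N. cinner (partial_eval c Y (Suc N) (word_op Y \<beta> (row_defect Y k))) h) \<longlonglongrightarrow>
      cinner ?u (poisson Y h)"
    by simp
  then show ?thesis
    by (rule LIMSEQ_imp_Suc)
qed

text \<open>This is where \<open>g(f(T)) = T\<close> enters: it says that \<open>T\<^sub>i K\<^sup>* = K\<^sup>* (M\<^sub>i \<otimes> I)\<close>.\<close>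

lemma cinner_model_poisson_ket:
  assumes model: "model_property f a M" and T: "T \<in> nc_domain f a"
  defines "Y \<equiv> tuple_eval f T"
  shows "cinner (tensor (M i (ket \<beta>)) k) (poisson Y h) =
    cinner (T i (word_op Y \<beta> (row_defect Y k))) h"
proof -
  interpret row_contraction Y
    unfolding Y_def by (rule nc_domain_row_contraction[OF T])
  let ?v = "word_op Y \<beta> (row_defect Y k)" and ?a = "coord (a i)"
  have Abs: "Abs_l2 (append_word ?a \<beta>) = M i (ket \<beta>)"
    unfolding model_coord[OF model, symmetric] by (rule coord_inverse)
  have lim: "(\<lambda>N. cinner (partial_eval ?a Y N ?v) h) \<longlonglongrightarrow> cinner (tensor (M i (ket \<beta>)) k) (poisson Y h)"
    using cinner_partial_eval_tendsto[of ?a \<beta> k h] by (simp add: Abs)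
  have "sot_eval ?a Y (T i) \<or> rad_eval ?a Y (T i)"
    using T by (auto simp: nc_domain_def inverse_eq_def Y_def)
  then show ?thesis
  proof
    assume "sot_eval ?a Y (T i)"
    then have "(\<lambda>N. partial_eval ?a Y N ?v) \<longlonglongrightarrow> T i ?v"
      by (simp add: sot_eval_def sot_tendsto_def)
    then have "(\<lambda>N. cinner (partial_eval ?a Y N ?v) h) \<longlonglongrightarrow> cinner (T i ?v) h"
      by (rule bounded_linear.tendsto[OF bounded_linear_cinner_left])
    with lim show ?thesis
      by (rule LIMSEQ_unique)
  next
    assume "rad_eval ?a Y (T i)"
    then obtain d P where P: "d \<in> {0<..<1}"
      "\<And>r. r \<in> {d<..<1} \<Longrightarrow> norm_eval ?a (\<lambda>i h. r *\<^sub>R Y i h) (P r)"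
      and lim_P: "sot_tendsto P (T i) (at_left 1)"
      unfolding rad_eval_def by blast
    \<comment> \<open>Evaluating \<open>a\<^sub>i\<close> at \<open>r Y\<close> is evaluating these
      damped coefficients at \<open>Y\<close> itself.\<close>
    define c where "c r \<alpha> = complex_of_real (r ^ length \<alpha>) * ?a \<alpha>" for r \<alpha>
    define u where "u r = Abs_l2 (append_word (c r) \<beta>)" for r
    have ev: "\<forall>\<^sub>F r in at_left (1::real). d < r \<and> r < 1"
      by (rule eventually_at_leftI[of d]) (use P(1) in auto)
    have sqc: "sq_summable (c r)" if "d < r" "r < 1" for r
    proof (rule sq_summable_bound[OF sq_summable_coord, where C = 1])
      show "norm (c r \<alpha>) \<le> 1 * norm (?a \<alpha>)" for \<alpha>
        using that P(1) by (simp add: c_def norm_mult norm_power mult_left_le_one_le power_le_one)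
    qed
    have "cinner (P r ?v) h = cinner (tensor (u r) k) (poisson Y h)" if r: "d < r" "r < 1" for r
    proof -
      have "(\<lambda>N. partial_eval ?a (\<lambda>i h. r *\<^sub>R Y i h) N ?v) \<longlonglongrightarrow> P r ?v"
        using P(2)[of r] r unfolding norm_eval_def
        by (intro norm_tendsto_pointwise bounded_clinear_partial_eval bounded_clinear_scaleR_op bounded)
          auto
      then have "(\<lambda>N. cinner (partial_eval (c r) Y N ?v) h) \<longlonglongrightarrow> cinner (P r ?v) h"
        unfolding partial_eval_scaleR[of Y, OF bounded] c_def[abs_def]
        by (rule bounded_linear.tendsto[OF bounded_linear_cinner_left])
      then show ?thesis
        using cinner_partial_eval_tendsto[OF sqc[OF r], of \<beta> k h] unfolding u_def
        by (rule LIMSEQ_unique)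
    qed
    then have eq: "\<forall>\<^sub>F r in at_left 1. cinner (tensor (u r) k) (poisson Y h) = cinner (P r ?v) h"
      using ev by (auto elim!: eventually_mono)
    \<comment> \<open>The damping exponent at \<gamma> = \<alpha>\<beta> is |\<alpha>| = |\<gamma>|
      - |\<beta>|, a diagonal perturbation of \<open>M i (ket \<beta>)\<close>.\<close>
    have "(u \<longlongrightarrow> M i (ket \<beta>)) (at_left 1)"
    proof (rule tendsto_diagonal_l2[where m = "\<lambda>\<gamma>. length \<gamma> - length \<beta>"])
      show "\<forall>\<^sub>F r in at_left 1. \<forall>\<gamma>. coord (u r) \<gamma> =
          r ^ (length \<gamma> - length \<beta>) *\<^sub>R coord (M i (ket \<beta>)) \<gamma>"
        using ev
      proof eventually_elim
        case (elim r)
        then have "coord (u r) = append_word (c r) \<beta>"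
          by (simp add: u_def coord_Abs_l2 sq_summable_append_word sqc)
        then show ?case
          by (auto simp: model_coord[OF model] append_word_def c_def scaleR_conv_of_real)
      qed
    qed
    then have "((\<lambda>r. cinner (tensor (u r) k) (poisson Y h)) \<longlongrightarrow>
        cinner (tensor (M i (ket \<beta>)) k) (poisson Y h)) (at_left 1)"
      by (intro bounded_linear.tendsto[OF bounded_linear_cinner_left]
          bounded_linear.tendsto[OF bounded_clinearD[OF bounded_clinear_tensor_left]])
    then have "((\<lambda>r. cinner (P r ?v) h) \<longlongrightarrow> cinner (tensor (M i (ket \<beta>)) k) (poisson Y h)) (at_left 1)"
      using eq by (rule Lim_transform_eventually)
    moreover have "((\<lambda>r. cinner (P r ?v) h) \<longlongrightarrow> cinner (T i ?v) h) (at_left 1)"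
      using lim_P by (intro bounded_linear.tendsto[OF bounded_linear_cinner_left]) (simp add: sot_tendsto_def)
    ultimately show ?thesis
      by (rule tendsto_unique[OF trivial_limit_at_left_real])
  qed
qed

text \<open>The basis expansion of K h reduces the claim to \<open>cinner_model_poisson_ket\<close>.
  The resulting sum is the inner product of K h with \<open>K T\<^sub>i\<^sup>* k\<close>, and K is
  isometric.\<close>

lemma cinner_model_poisson:
  assumes model: "model_property f a M" and T: "T \<in> nc_domain f a" "pure_tuple f T"
  defines "Y \<equiv> tuple_eval f T"
  shows "cinner (tensor_op (M i) id (poisson Y h)) (poisson Y k) = cinner (T i h) k"
proof -
  interpret pure_row_contraction Y
    unfolding Y_def by (rule nc_domain_pure_row_contraction[OF T])
  have Ti: "bounded_clinear (T i)"
    using T(1) by (simp add: nc_domain_def op_tuples_def)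
  note Mi = model_bounded[OF model, of i]
  let ?y = "coord (poisson Y h)"
  have "bounded_linear (\<lambda>y. cinner (tensor_op (M i) id y) (poisson Y k))"
    by (rule bounded_linear_compose[OF bounded_linear_cinner_left
          bounded_clinearD[OF bounded_clinear_tensor_op_id[OF Mi]]])
  then have "((\<lambda>\<beta>. cinner (tensor_op (M i) id (tensor (ket \<beta>) (?y \<beta>))) (poisson Y k)) has_sum
      cinner (tensor_op (M i) id (poisson Y h)) (poisson Y k)) UNIV"
    by (rule has_sum_bounded_linear[OF _ has_sum_tensor_ket])
  moreover have "cinner (tensor_op (M i) id (tensor (ket \<beta>) (?y \<beta>))) (poisson Y k) =
      cinner (?y \<beta>) (coord (poisson Y (cadjoint (T i) k)) \<beta>)" for \<beta>
    unfolding tensor_op_id_tensor[OF Mi] Y_def cinner_model_poisson_ket[OF model T(1)]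
    unfolding Y_def[symmetric]
    by (simp add: coord_poisson_eq cinner_cadjoint_right[OF Ti] cinner_cadjoint_right[OF bounded_word_op]
        defect_cinner[symmetric])
  ultimately have "((\<lambda>\<beta>. cinner (?y \<beta>) (coord (poisson Y (cadjoint (T i) k)) \<beta>)) has_sum
      cinner (tensor_op (M i) id (poisson Y h)) (poisson Y k)) UNIV"
    by simp
  then have "cinner (tensor_op (M i) id (poisson Y h)) (poisson Y k) =
      cinner (poisson Y h) (poisson Y (cadjoint (T i) k))"
    by (rule has_sum_unique[OF _ has_sum_cinner_l2])
  also have "\<dots> = cinner (T i h) k"
    by (simp add: cinner_poisson cinner_cadjoint_right[OF Ti])
  finally show ?thesis .
qed

section \<open>Coincidence implies unitary equivalence\<close>

lemma unitary_between_UNIV: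
  assumes "unitary_between UNIV UNIV U"
  shows "bounded_clinear U" "norm (U x) = norm x" "U (cadjoint U y) = y" "cadjoint U (U x) = x"
proof -
  have U: "U (x + y) = U x + U y" "U (c *\<^sub>C x) = c *\<^sub>C U x" "cinner (U x) (U y) = cinner x y" for x y c
    using assms by (auto simp: unitary_between_def)
  have surj: "\<exists>x. y = U x" for y
    using assms by (auto simp: unitary_between_def)
  show n: "norm (U x) = norm x" for x
  proof -
    have "complex_of_real ((norm (U x))\<^sup>2) = complex_of_real ((norm x)\<^sup>2)"
      by (simp only: cinner_self[symmetric] U(3))
    then show ?thesis
      by (simp only: of_real_eq_iff) (simp add: power2_eq_iff_nonneg)
  qed
  show b: "bounded_clinear U"
    by (rule bounded_clinearI[where K = 1]) (simp_all add: U n)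
  show inv: "cadjoint U (U x) = x" for x
    by (rule cinner_eqI) (simp add: cinner_cadjoint_left[OF b] U(3))
  show "U (cadjoint U y) = y"
    using surj[of y] inv by auto
qed

lemma unitarily_equivalent_if_coincide:
  assumes model: "model_property f a M"
    and T: "T \<in> nc_domain f a" "pure_tuple f T" and T': "T' \<in> nc_domain f a" "pure_tuple f T'"
    and coincide: "coincide M
      (defect_space_star f T) (defect_space f T) (char_fun f T)
      (defect_space_star f T') (defect_space f T') (char_fun f T')"
  shows "unitarily_equivalent T T'"
proof -
  define Y where "Y = tuple_eval f T"
  define Y' where "Y' = tuple_eval f T'"
  interpret Y: pure_row_contraction Y
    unfolding Y_def by (rule nc_domain_pure_row_contraction[OF T])
  interpret Y': pure_row_contraction Y'
    unfolding Y'_def by (rule nc_domain_pure_row_contraction[OF T'])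
  define D E where "D = closure (range (row_defect_star Y))" and "E = closure (range (row_defect Y))"
  define D' E' where "D' = closure (range (row_defect_star Y'))" and "E' = closure (range (row_defect Y'))"
  have spaces: "defect_space_star f T = D" "defect_space f T = E"
    "defect_space_star f T' = D'" "defect_space f T' = E'"
    by (simp_all add: D_def E_def D'_def E'_def defect_space_star_def defect_space_def defect_def
        defect_star_def row_defect_def row_defect_star_def Y_def Y'_def)
  have cE: "closed_csubspace E"
    unfolding E_def by (intro closed_csubspace_closure_range Y.bounded_defect)
  have char: "char_fun f T = transfer Y 1" "char_fun f T' = transfer Y' 1"
    unfolding Y_def Y'_def
    by (intro ext char_fun_eq_transfer nc_domain_row_contraction[OF T(1)]
        nc_domain_row_contraction[OF T'(1)])+
  note P_mem = Y.poisson_mem[folded E_def] and P'_mem = Y'.poisson_mem[folded E'_def]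
  note Th_mem = Y.transfer_mem[folded D_def E_def]
  obtain W1 W2 where W1: "unitary_between (h2_tensor D) (h2_tensor D') W1"
    and ma: "multi_analytic M E E' W2" and W2: "unitary_between (h2_tensor E) (h2_tensor E') W2"
    and comm: "\<And>x. x \<in> h2_tensor D \<Longrightarrow> transfer Y' 1 (W1 x) = W2 (transfer Y 1 x)"
    using coincide unfolding coincide_def spaces char by blast
  have W1_surj: "\<exists>x\<in>h2_tensor D. y = W1 x" if "y \<in> h2_tensor D'" for y
    using W1 that by (auto simp: unitary_between_def)
  have W2_mem: "W2 x \<in> h2_tensor E'" if "x \<in> h2_tensor E" for x
    using W2 that by (auto simp: unitary_between_def)
  have W2_surj: "\<exists>x\<in>h2_tensor E. y = W2 x" if "y \<in> h2_tensor E'" for y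
    using W2 that by (auto simp: unitary_between_def)
  have W2_add: "W2 (x + y) = W2 x + W2 y" and W2_scaleC: "W2 (c *\<^sub>C x) = c *\<^sub>C W2 x"
    and W2_cinner: "cinner (W2 x) (W2 y) = cinner x y"
    if "x \<in> h2_tensor E" "y \<in> h2_tensor E" for x y c
    using W2 that by (auto simp: unitary_between_def)
  have W2_M: "W2 (tensor_op (M i) id x) = tensor_op (M i) id (W2 x)" if "x \<in> h2_tensor E" for i x
    using ma that by (auto simp: multi_analytic_def)
  have orth: "cinner (W2 (poisson Y h)) (W2 (transfer Y 1 x)) = 0" if "x \<in> h2_tensor D" for h x
    using Y.transfer_orthogonal_poisson[of x h] cnj_cinner[of "transfer Y 1 x" "poisson Y h"]
    by (simp add: W2_cinner P_mem Th_mem that)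
  have orth': "cinner (poisson Y' k) (transfer Y' 1 x) = 0" for k x
    using Y'.transfer_orthogonal_poisson[of x k] cnj_cinner[of "transfer Y' 1 x" "poisson Y' k"]
    by simp
  \<comment> \<open>As W1 is onto, the component of \<open>W2 (poisson Y h)\<close> in the range of
    \<open>transfer Y' 1\<close> is the image under W2 of an element of the range of
    \<open>transfer Y 1\<close>. It is therefore orthogonal to \<open>W2 (poisson Y h)\<close> and
    must vanish.\<close>
  have "\<exists>k. W2 (poisson Y h) = poisson Y' k" for h
  proof -
    obtain k x' where dec: "W2 (poisson Y h) = poisson Y' k + transfer Y' 1 x'"
      and "W2 (poisson Y h) \<in> h2_tensor E' \<Longrightarrow> x' \<in> h2_tensor D'"
      using Y'.poisson_transfer_decomposition[of "W2 (poisson Y h)"] unfolding D'_def E'_def by blast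
    then have "x' \<in> h2_tensor D'"
      using W2_mem[OF P_mem] by blast
    then obtain x where x: "x \<in> h2_tensor D" "x' = W1 x"
      using W1_surj by blast
    have "cinner (W2 (poisson Y h)) (transfer Y' 1 x') = 0"
      unfolding x(2) comm[OF x(1)] by (rule orth[OF x(1)])
    then have "cinner (transfer Y' 1 x') (transfer Y' 1 x') = 0"
      unfolding dec cinner_add_left orth' by simp
    with dec show ?thesis by auto
  qed
  then obtain U where U: "\<And>h. W2 (poisson Y h) = poisson Y' (U h)"
    by metis
  have P'_inj: "k = k'" if "poisson Y' k = poisson Y' k'" for k k'
  proof (rule cinner_eqI)
    show "cinner k z = cinner k' z" for z
      using that Y'.cinner_poisson[of k z] Y'.cinner_poisson[of k' z] by simp
  qed
  note P_simps = bounded_clinear_simps[OF Y.bounded_poisson]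
  note P'_simps = bounded_clinear_simps[OF Y'.bounded_poisson]
  have "U (h + k) = U h + U k" for h k
    by (rule P'_inj) (simp add: P'_simps U[symmetric] P_simps W2_add P_mem)
  moreover have "U (c *\<^sub>C h) = c *\<^sub>C U h" for c h
    by (rule P'_inj) (simp add: P'_simps U[symmetric] P_simps W2_scaleC[OF P_mem P_mem])
  moreover have "cinner (U h) (U k) = cinner h k" for h k
    unfolding Y'.cinner_poisson[symmetric] U[symmetric] W2_cinner[OF P_mem P_mem]
    by (rule Y.cinner_poisson)
  \<comment> \<open>The same argument in the other direction: decompose the preimage of
    \<open>poisson Y' k\<close> under W2.\<close>
  moreover have "\<exists>h. k = U h" for k
  proof -
    obtain y where y: "y \<in> h2_tensor E" "poisson Y' k = W2 y"
      using W2_surj[OF P'_mem] by blast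
    obtain h x where dec: "y = poisson Y h + transfer Y 1 x"
      and "y \<in> h2_tensor E \<Longrightarrow> x \<in> h2_tensor D"
      using Y.poisson_transfer_decomposition[of y] unfolding D_def E_def by blast
    then have x: "x \<in> h2_tensor D"
      using y(1) by blast
    have "poisson Y' k = poisson Y' (U h) + transfer Y' 1 (W1 x)"
      unfolding y(2) dec W2_add[OF P_mem Th_mem[OF x]] U comm[OF x] ..
    then have eq: "transfer Y' 1 (W1 x) = poisson Y' (k - U h)"
      by (simp add: P'_simps)
    have "cinner (transfer Y' 1 (W1 x)) (transfer Y' 1 (W1 x)) = 0"
      by (subst (1) eq) (rule orth')
    then have "poisson Y' (k - U h) = poisson Y' 0"
      using eq by (simp add: P'_simps)
    then have "k - U h = 0"
      by (rule P'_inj)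
    then show ?thesis by auto
  qed
  then have "range U = UNIV"
    by blast
  ultimately have un: "unitary_between UNIV UNIV U"
    by (simp add: unitary_between_def)
  have "T i = cadjoint U \<circ> T' i \<circ> U" for i
  proof
    fix h
    show "T i h = (cadjoint U \<circ> T' i \<circ> U) h"
    proof (rule cinner_eqI)
      fix k
      \<comment> \<open>W2 preserves inner products on \<open>h2_tensor E\<close>, so the vector has
        to be placed there first.\<close>
      have M_mem: "tensor_op (M i) id (poisson Y h) \<in> h2_tensor E"
        by (rule tensor_op_id_mem_h2_tensor[OF model_bounded[OF model] cE P_mem])
      have "cinner (T i h) k = cinner (tensor_op (M i) id (poisson Y h)) (poisson Y k)"
        unfolding Y_def by (rule cinner_model_poisson[OF model T, symmetric])
      also have "\<dots> = cinner (tensor_op (M i) id (poisson Y' (U h))) (poisson Y' (U k))"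
        unfolding W2_cinner[OF M_mem P_mem, symmetric] W2_M[OF P_mem] U ..
      also have "\<dots> = cinner (T' i (U h)) (U k)"
        unfolding Y'_def by (rule cinner_model_poisson[OF model T'])
      also have "\<dots> = cinner ((cadjoint U \<circ> T' i \<circ> U) h) k"
        by (simp add: cinner_cadjoint_left[OF unitary_between_UNIV(1)[OF un]])
      finally show "cinner (T i h) k = cinner ((cadjoint U \<circ> T' i \<circ> U) h) k" .
    qed
  qed
  with un show ?thesis
    unfolding unitarily_equivalent_def by blast
qed

section \<open>Unitary equivalence implies coincidence\<close>

text \<open>The inverse is a parameter of its own, so that every result can be applied with the two
  spaces exchanged, through \<open>swap\<close>.\<close>

locale unitary_pair =
  fixes U :: "'h::chilbert_space \<Rightarrow> 'k::chilbert_space" and V :: "'k \<Rightarrow> 'h"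
  assumes bounded_U: "bounded_clinear U" and bounded_V: "bounded_clinear V"
    and VU [simp]: "V (U x) = x" and UV [simp]: "U (V y) = y"
    and norm_U [simp]: "norm (U x) = norm x"
    and adjoint: "cinner (U x) y = cinner x (V y)"
begin

lemma norm_V [simp]: "norm (V y) = norm y"
  using norm_U[of "V y"] by simp

lemma swap: "unitary_pair V U"
proof
  show "cinner (V y) x = cinner y (U x)" for x y
    using arg_cong[OF adjoint[of x y], of cnj] by simp
qed (simp_all add: bounded_U bounded_V)

lemma cinner_U: "cinner (U x) (U y) = cinner x y"
  by (simp add: adjoint)

lemma word_op_intertwine:
  assumes "\<And>i x. U (X i x) = X' i (U x)"
  shows "U (word_op X \<alpha> x) = word_op X' \<alpha> (U x)"
  by (induction \<alpha>) (simp_all add: assms)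

lemma partial_eval_intertwine:
  assumes "\<And>i x. U (X i x) = X' i (U x)"
  shows "partial_eval c X' N y = U (partial_eval c X N (V y))"
  by (simp add: partial_eval_def bounded_clinear_simps[OF bounded_U]
      word_op_intertwine[of X X', OF assms])

lemma bounded_conj: "bounded_clinear L \<Longrightarrow> bounded_clinear (\<lambda>y. U (L (V y)))"
  by (intro bounded_clinear_compose[OF bounded_U] bounded_clinear_compose[OF _ bounded_V])

lemma sot_tendsto_conj:
  assumes "sot_tendsto A L F"
  shows "sot_tendsto (\<lambda>t y. U (A t (V y))) (\<lambda>y. U (L (V y))) F"
  using assms bounded_linear.tendsto[OF bounded_clinearD[OF bounded_U]]
  by (auto simp: sot_tendsto_def bounded_conj)

lemma norm_tendsto_conj:
  assumes "norm_tendsto A L F" "\<And>t. bounded_clinear (A t)"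
  shows "norm_tendsto (\<lambda>t y. U (A t (V y))) (\<lambda>y. U (L (V y))) F"
proof -
  have L: "bounded_clinear L" and lim: "((\<lambda>t. onorm (\<lambda>h. A t h - L h)) \<longlongrightarrow> 0) F"
    using assms(1) by (auto simp: norm_tendsto_def)
  have "norm (onorm (\<lambda>y. U (A t (V y)) - U (L (V y)))) \<le> onorm (\<lambda>h. A t h - L h)" for t
  proof -
    have b: "bounded_linear (\<lambda>h. A t h - L h)"
      by (intro bounded_clinearD bounded_clinear_diff assms L)
    have "bounded_linear (\<lambda>y. U (A t (V y)) - U (L (V y)))"
      by (intro bounded_clinearD bounded_clinear_diff bounded_conj assms L)
    then have "0 \<le> onorm (\<lambda>y. U (A t (V y)) - U (L (V y)))"
      by (rule onorm_pos_le)
    moreover have "onorm (\<lambda>y. U (A t (V y)) - U (L (V y))) \<le> onorm (\<lambda>h. A t h - L h)"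
    proof (rule onorm_bound[OF onorm_pos_le[OF b]])
      show "norm (U (A t (V y)) - U (L (V y))) \<le> onorm (\<lambda>h. A t h - L h) * norm y" for y
        using onorm[OF b, of "V y"] by (simp flip: bounded_clinear_simps(2)[OF bounded_U])
    qed
    ultimately show ?thesis by simp
  qed
  then have "((\<lambda>t. onorm (\<lambda>y. U (A t (V y)) - U (L (V y)))) \<longlongrightarrow> 0) F"
    by (intro Lim_null_comparison[OF always_eventually lim]) blast
  with L show ?thesis
    by (simp add: norm_tendsto_def bounded_conj)
qed

lemma sot_eval_conj:
  assumes "\<And>i x. U (X i x) = X' i (U x)" "sot_eval c X L"
  shows "sot_eval c X' (\<lambda>y. U (L (V y)))"
  using sot_tendsto_conj[OF assms(2)[unfolded sot_eval_def]]
  by (simp add: sot_eval_def partial_eval_intertwine[of X X', OF assms(1), abs_def])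

lemma rad_eval_conj:
  assumes "\<And>i x. U (X i x) = X' i (U x)" "rad_eval c X L" and X: "\<And>i. bounded_clinear (X i)"
  shows "rad_eval c X' (\<lambda>y. U (L (V y)))"
proof -
  obtain d P where P: "d \<in> {0<..<1}" "\<And>r. r \<in> {d<..<1} \<Longrightarrow> norm_eval c (\<lambda>i h. r *\<^sub>R X i h) (P r)"
    "sot_tendsto P L (at_left 1)"
    using assms(2) unfolding rad_eval_def by blast
  have "norm_eval c (\<lambda>i h. r *\<^sub>R X' i h) (\<lambda>y. U (P r (V y)))" if r: "r \<in> {d<..<1}" for r
  proof -
    have b: "bounded_clinear (partial_eval c (\<lambda>i h. r *\<^sub>R X i h) N)" for N
      by (intro bounded_clinear_partial_eval bounded_clinear_scaleR_op X)
    have eq: "partial_eval c (\<lambda>i h. r *\<^sub>R X' i h) =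
        (\<lambda>N y. U (partial_eval c (\<lambda>i h. r *\<^sub>R X i h) N (V y)))"
      by (intro ext partial_eval_intertwine) (simp add: bounded_clinear_simps[OF bounded_U] assms(1))
    show ?thesis
      unfolding norm_eval_def eq
      by (rule norm_tendsto_conj[OF P(2)[OF r, unfolded norm_eval_def] b])
  qed
  with P(1) sot_tendsto_conj[OF P(3)] show ?thesis
    unfolding rad_eval_def by (intro bexI[of _ d] exI[of _ "\<lambda>r y. U (P r (V y))"]) auto
qed

lemma conv_sot_conj:
  assumes "\<And>i x. U (X i x) = X' i (U x)" "X' \<in> op_tuples" "X \<in> conv_sot f"
  shows "X' \<in> conv_sot f"
  using assms(2,3) sot_eval_conj[of X X', OF assms(1)] unfolding conv_sot_def by blast

text \<open>\<open>tuple_eval\<close> chooses its prescription by membership in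
  \<open>conv_sot\<close>. Conjugation by \<open>U\<close> and by \<open>V\<close> preserves this
  membership, so both tuples are evaluated in the same way.\<close>

lemma tuple_eval_conj:
  assumes "\<And>i x. U (X i x) = X' i (U x)" "X \<in> op_tuples" "X' \<in> op_tuples"
    "X \<in> conv_sot f \<union> conv_rad f" "X' \<in> conv_sot f \<union> conv_rad f"
  shows "U (tuple_eval f X j x) = tuple_eval f X' j (U x)"
proof -
  have "tuple_eval f X' j = (\<lambda>y. U (tuple_eval f X j (V y)))"
  proof (cases "X \<in> conv_sot f")
    case True
    then have "X' \<in> conv_sot f"
      by (rule conv_sot_conj[of X X', OF assms(1,3)])
    from tuple_eval_sot[OF this] sot_eval_conj[of X X', OF assms(1) tuple_eval_sot[OF True]]
    show ?thesis
      by (rule sot_eval_unique)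
  next
    case False
    have "V (X' i y) = X i (V y)" for i y
      using assms(1)[of i "V y"] VU[of "X i (V y)"] by simp
    then have "X' \<notin> conv_sot f"
      using False unitary_pair.conv_sot_conj[OF swap, of X' X] assms(2) by blast
    then have rad: "rad_eval (f j) X' (tuple_eval f X' j)" "rad_eval (f j) X (tuple_eval f X j)"
      using False assms(4,5) by (auto intro: tuple_eval_rad)
    have lin: "\<And>i. bounded_clinear (X i)" "\<And>i. bounded_clinear (X' i)"
      using assms(2,3) by (auto simp: op_tuples_def)
    from rad(1) rad_eval_conj[of X X', OF assms(1) rad(2) lin(1)] show ?thesis
      by (rule rad_eval_unique) (rule lin)
  qed
  then show ?thesis by simp
qed

text \<open>\<open>I \<otimes> U\<close> and \<open>M\<^sub>i \<otimes> I\<close> act on different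
  tensor factors, so they commute on elementary tensors and hence everywhere.\<close>

lemma multi_analytic_l2_map:
  fixes M :: "'n \<Rightarrow> 'n h2 \<Rightarrow> 'n h2"
  assumes M: "\<And>i. bounded_clinear (M i)" and UD: "U ` D \<subseteq> D'" and VD: "V ` D' \<subseteq> D"
  shows "multi_analytic M D D' (l2_map U)"
    and "unitary_between (h2_tensor D) (h2_tensor D') (l2_map U :: ('n list, 'h) l2 \<Rightarrow> ('n list, 'k) l2)"
proof -
  note lin = bounded_clinear_l2_map[OF bounded_U]
  note c = coord_l2_map[OF bounded_clinearD[OF bounded_U]]
    and cV = coord_l2_map[OF bounded_clinearD[OF bounded_V]]
  have mem: "l2_map U x \<in> h2_tensor D'" if "x \<in> h2_tensor D" for x :: "('n list, 'h) l2"
    using that UD by (auto simp: h2_tensor_def c)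
  have memV: "l2_map V y \<in> h2_tensor D" if "y \<in> h2_tensor D'" for y :: "('n list, 'k) l2"
    using that VD by (auto simp: h2_tensor_def cV)
  have inv: "l2_map U (l2_map V y) = y" for y :: "('n list, 'k) l2"
    by (rule l2_eqI) (simp add: c cV)
  have comm: "l2_map U (tensor_op (M i) id x) = tensor_op (M i) id (l2_map U x)"
    for i and x :: "('n list, 'h) l2"
  proof (rule bounded_linear_eq_on_tensor_ket[where A = "\<lambda>x. l2_map U (tensor_op (M i) id x)"
        and B = "\<lambda>x. tensor_op (M i) id (l2_map U x)"])
    show "bounded_linear (\<lambda>x :: ('n list, 'h) l2. l2_map U (tensor_op (M i) id x))"
      "bounded_linear (\<lambda>x :: ('n list, 'h) l2. tensor_op (M i) id (l2_map U x))"
      by (intro bounded_clinearD bounded_clinear_compose[OF lin]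
          bounded_clinear_compose[OF _ lin] bounded_clinear_tensor_op_id M)+
  qed (simp add: tensor_op_id_tensor[OF M] l2_map_tensor[OF bounded_U])
  have "norm (l2_map U x) \<le> 1 * norm x" for x :: "('n list, 'h) l2"
    by (rule norm_l2_mono) (simp_all add: c)
  then have "\<exists>B. \<forall>x\<in>h2_tensor D. norm (l2_map U (x :: ('n list, 'h) l2)) \<le> B * norm x"
    by blast
  with mem comm show "multi_analytic M D D' (l2_map U)"
    by (auto simp: multi_analytic_def bounded_clinear_simps[OF lin])
  have "cinner (l2_map U x) (l2_map U y) = cinner x y" for x y :: "('n list, 'h) l2"
    unfolding cinner_l2_def by (simp add: c cinner_U)
  moreover have "l2_map U ` h2_tensor D = (h2_tensor D' :: ('n list, 'k) l2 set)"
    using mem memV inv by (metis image_eqI image_subsetI subsetI subset_antisym)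
  ultimately show "unitary_between (h2_tensor D) (h2_tensor D')
      (l2_map U :: ('n list, 'h) l2 \<Rightarrow> ('n list, 'k) l2)"
    by (simp add: unitary_between_def bounded_clinear_simps[OF lin])
qed

lemma unitary_pair_vec:
  "unitary_pair (\<lambda>v :: 'h ^ 'n. \<chi> i. U (v $ i)) (\<lambda>v. \<chi> i. V (v $ i))"
proof
  show "norm (\<chi> i. U (v $ i)) = norm v" for v :: "'h ^ 'n"
    by (simp add: norm_vec_def)
  show "cinner (\<chi> i. U (v $ i)) w = cinner v (\<chi> i. V (w $ i))" for v :: "'h ^ 'n" and w
    by (simp add: cinner_vec_def adjoint)
qed (auto intro!: bounded_clinear_vec bounded_clinear_compose[OF bounded_U]
    bounded_clinear_compose[OF bounded_V] bounded_clinear_nth)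

end

locale intertwined_row_contractions = unitary_pair U V + Y: row_contraction Y + Y': row_contraction Y'
  for U :: "'h::chilbert_space \<Rightarrow> 'k::chilbert_space" and V
    and Y :: "'n::finite \<Rightarrow> 'h \<Rightarrow> 'h" and Y' :: "'n \<Rightarrow> 'k \<Rightarrow> 'k" +
  assumes intertwine: "U (Y i x) = Y' i (U x)"
begin

abbreviation U' :: "'h ^ 'n \<Rightarrow> 'k ^ 'n"
  where "U' v \<equiv> \<chi> i. U (v $ i)"

lemma row_op_intertwine: "U (row_op Y v) = row_op Y' (U' v)"
  by (simp add: row_op_def bounded_clinear_simps[OF bounded_U] intertwine)

text \<open>Taking adjoints in the relation for the inverse, V Y' = Y V, gives the relation for the
  adjoint entries.\<close>

lemma row_adj_intertwine: "U' (row_adj Y h) = row_adj Y' (U h)"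
proof -
  have "U (cadjoint (Y i) h) = cadjoint (Y' i) (U h)" for i
  proof (rule cinner_eqI)
    fix z
    have "V (Y' i z) = Y i (V z)"
      using intertwine[of i "V z"] VU[of "Y i (V z)"] by simp
    then show "cinner (U (cadjoint (Y i) h)) z = cinner (cadjoint (Y' i) (U h)) z"
      by (simp add: adjoint cinner_cadjoint_left[OF Y.bounded] cinner_cadjoint_left[OF Y'.bounded])
  qed
  then show ?thesis
    by (simp add: row_adj_def vec_eq_iff)
qed

lemma defect_intertwine: "U (row_defect Y h) = row_defect Y' (U h)"
  unfolding Y.defect_eq_series Y'.defect_eq_series
  by (rule sqrt_series_intertwine)
    (simp_all add: Y.contraction_RRs Y'.contraction_RRs bounded_clinearD bounded_U
      row_op_intertwine row_adj_intertwine)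

lemma bounded_U': "bounded_clinear U'"
  by (intro bounded_clinear_vec bounded_clinear_compose[OF bounded_U] bounded_clinear_nth)

lemma defect_star_intertwine: "U' (row_defect_star Y v) = row_defect_star Y' (U' v)"
  unfolding Y.defect_star_eq_series Y'.defect_star_eq_series
  by (rule sqrt_series_intertwine[where V = U'])
    (simp_all only: Y.contraction_RsR Y'.contraction_RsR bounded_clinearD[OF bounded_U']
      row_op_intertwine row_adj_intertwine)

lemma state_intertwine: "U (state Y 1 h x \<beta>) = state Y' 1 (U h) (\<lambda>\<beta>. U' (x \<beta>)) \<beta>"
proof (induction \<beta> rule: rev_induct)
  case (snoc i \<beta>)
  have "U (state Y 1 h x (\<beta> @ [i])) =
      U' (row_adj Y (state Y 1 h x \<beta>)) $ i + U' (row_defect_star Y (x \<beta>)) $ i"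
    by (simp add: bounded_clinear_simps[OF bounded_U])
  then show ?case
    unfolding row_adj_intertwine defect_star_intertwine snoc by simp
qed simp

lemma transfer_intertwine: "transfer Y' 1 (l2_map U' x) = l2_map U (transfer Y 1 x)"
proof (rule l2_eqI)
  fix \<beta>
  have "coord (l2_map U' x) = (\<lambda>\<beta>. U' (coord x \<beta>))"
    by (intro ext coord_l2_map bounded_clinearD bounded_U')
  moreover have "U 0 = 0"
    by (simp add: bounded_clinear_simps[OF bounded_U])
  ultimately show "coord (transfer Y' 1 (l2_map U' x)) \<beta> = coord (l2_map U (transfer Y 1 x)) \<beta>"
    using state_intertwine[of 0 "coord x" \<beta>]
    by (simp add: Y'.coord_transfer Y.coord_transfer response_def bounded_clinear_simps[OF bounded_U]
        coord_l2_map bounded_clinearD bounded_U defect_intertwine row_op_intertwine)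
qed

lemma image_defect_spaces:
  "U ` closure (range (row_defect Y)) \<subseteq> closure (range (row_defect Y'))"
  "U' ` closure (range (row_defect_star Y)) \<subseteq> closure (range (row_defect_star Y'))"
  using closure_range_intertwine[where A = "row_defect Y" and B = "row_defect Y'" and V = U and V' = U]
    closure_range_intertwine[where A = "row_defect_star Y" and B = "row_defect_star Y'"
      and V = U' and V' = U']
    bounded_clinearD[OF bounded_U] bounded_clinearD[OF bounded_U']
    defect_intertwine defect_star_intertwine
  by blast+

lemma swap_intertwined: "intertwined_row_contractions V U Y' Y"
proof -
  interpret s: unitary_pair V U by (rule swap)
  show ?thesis
  proof
    show "V (Y' i z) = Y i (V z)" for i z
      using intertwine[of i "V z"] VU[of "Y i (V z)"] by simp
  qed
qed

end

lemma coincide_if_unitarily_equivalent: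
  assumes M: "\<And>i. bounded_clinear (M i)"
    and T: "T \<in> nc_domain f a" and T': "T' \<in> nc_domain f a"
    and equiv: "unitarily_equivalent T T'"
  shows "coincide M
      (defect_space_star f T) (defect_space f T) (char_fun f T)
      (defect_space_star f T') (defect_space f T') (char_fun f T')"
proof -
  obtain U where un: "unitary_between UNIV UNIV U" and TU: "\<And>i. T i = cadjoint U \<circ> T' i \<circ> U"
    using equiv unfolding unitarily_equivalent_def by blast
  note U = unitary_between_UNIV[OF un]
  interpret unitary_pair U "cadjoint U"
    by unfold_locales
      (simp_all add: U bounded_clinear_cadjoint cinner_cadjoint_right)
  define Y where "Y = tuple_eval f T"
  define Y' where "Y' = tuple_eval f T'"
  interpret Y: row_contraction Y
    unfolding Y_def by (rule nc_domain_row_contraction[OF T])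
  interpret Y': row_contraction Y'
    unfolding Y'_def by (rule nc_domain_row_contraction[OF T'])
  interpret intertwined_row_contractions U "cadjoint U" Y Y'
  proof
    show "U (Y i x) = Y' i (U x)" for i x
      unfolding Y_def Y'_def
      by (rule tuple_eval_conj)
        (use T T' in \<open>auto simp: TU U nc_domain_def inverse_eq_def\<close>)
  qed
  interpret s: intertwined_row_contractions "cadjoint U" U Y' Y
    by (rule swap_intertwined)
  interpret v: unitary_pair U' "\<lambda>v. \<chi> i. cadjoint U (v $ i)"
    by (rule unitary_pair_vec)
  have spaces: "defect_space_star f T = closure (range (row_defect_star Y))"
    "defect_space f T = closure (range (row_defect Y))"
    "defect_space_star f T' = closure (range (row_defect_star Y'))"
    "defect_space f T' = closure (range (row_defect Y'))"
    by (simp_all add: defect_space_star_def defect_space_def defect_def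
        defect_star_def row_defect_def row_defect_star_def Y_def Y'_def)
  have char: "char_fun f T = transfer Y 1" "char_fun f T' = transfer Y' 1"
    unfolding Y_def Y'_def
    by (intro ext char_fun_eq_transfer nc_domain_row_contraction[OF T]
        nc_domain_row_contraction[OF T'])+
  show ?thesis
    unfolding coincide_def spaces char
    using multi_analytic_l2_map[of M, OF M image_defect_spaces(1) s.image_defect_spaces(1)]
      v.multi_analytic_l2_map[of M, OF M image_defect_spaces(2) s.image_defect_spaces(2)]
      transfer_intertwine
    by blast
qed

theorem theorem7p3:
  fixes f :: "'n::finite \<Rightarrow> 'n ncps"
    and a :: "'n \<Rightarrow> 'n h2"
    and M :: "'n \<Rightarrow> 'n h2 \<Rightarrow> 'n h2"
    and T :: "'n \<Rightarrow> 'h \<Rightarrow> 'h::chilbert_space"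
    and T' :: "'n \<Rightarrow> 'k \<Rightarrow> 'k::chilbert_space"
  assumes "model_property f a M"
    and "T \<in> nc_domain f a" and "pure_tuple f T"
    and "T' \<in> nc_domain f a" and "pure_tuple f T'"
  shows "unitarily_equivalent T T' \<longleftrightarrow>
    coincide M
      (defect_space_star f T) (defect_space f T) (char_fun f T)
      (defect_space_star f T') (defect_space f T') (char_fun f T')"
  using coincide_if_unitarily_equivalent[of M, OF model_bounded[OF assms(1)] assms(2,4)]
    unitarily_equivalent_if_coincide[OF assms]
  by blast

end
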